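(* Let $\mathbf{a}\in\mathfrak{A}_3$ be generic. There are exactly $2$ simple $\mathcal{A}_{[\mathbf{a}]}$-modules up to isomorphism, namely $\Bbbk_e$ and $L$. Moreover, $M_e$ is the projective cover, and the injective hull, of $\Bbbk_e$; also, $M_{(13)(23)}$ is the projective cover, and the injective hull, of $L$.
   Context: $\Bbbk$ is an algebraically closed field of characteristic $0$. $\mathcal{O}_2^3=\{(12),(13),(23)\}\subset\mathbb{S}_3$; $\Bbbk^{\mathbb{S}_3}$ is the algebra of functions on $\mathbb{S}_3$ with basis the characteristic functions $\delta_g$ of $\{g\}$, $g\in\mathbb{S}_3$. $\mathfrak{A}_3=\{\mathbf{a}=(a_{(12)},a_{(13)},a_{(23)})\in\Bbbk^3: a_{(12)}+a_{(13)}+a_{(23)}=0\}$. For $\mathbf{a}\in\mathfrak{A}_3$ and $(ij)\in\mathcal{O}_2^3$ put $f_{ij}=\sum_{g\in\mathbb{S}_3}(a_{(ij)}-a_{g^{-1}(ij)g})\delta_g\in\Bbbk^{\mathbb{S}_3}$. $\mathcal{A}_{[\mathbf{a}]}$ is the algebra generated by $\Bbbk^{\mathbb{S}_3}$ and $x_{(12)},x_{(13)},x_{(23)}$ with relations $\delta_h x_{(ij)}=x_{(ij)}\delta_{(ij)h}$ ($h\in\mathbb{S}_3$), $x_{(ij)}^2=f_{ij}$, $x_{(13)}x_{(23)}+x_{(23)}x_{(12)}+x_{(12)}x_{(13)}=0$ and $x_{(23)}x_{(13)}+x_{(13)}x_{(12)}+x_{(12)}x_{(23)}=0$. (It is known to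 have dimension $72$ and to contain $\Bbbk^{\mathbb{S}_3}$ as a subalgebra; it is a Hopf algebra with $\Delta(x_{(ij)})=x_{(ij)}\otimes1+\sum_{h\in\mathbb{S}_3}\operatorname{sgn}(h)\delta_h\otimes x_{h^{-1}(ij)h}$ and $\Bbbk^{\mathbb{S}_3}$ as Hopf subalgebra.) Modules are left modules. For an $\mathcal{A}_{[\mathbf{a}]}$-module $M$ and $g\in\mathbb{S}_3$, $M[g]=\delta_g\cdot M$. The Verma module is $M_g=\mathcal{A}_{[\mathbf{a}]}\otimes_{\Bbbk^{\mathbb{S}_3}}\Bbbk_g$, where $\Bbbk_g$ is the one-dimensional $\Bbbk^{\mathbb{S}_3}$-module with $f\cdot 1=f(g)1$. $\mathbf{a}$ is generic when $a_{(12)},a_{(13)},a_{(23)}$ are pairwise distinct. $\Bbbk_e$ also denotes the one-dimensional $\mathcal{A}_{[\mathbf{a}]}$-module on which every $x_{(ij)}$ acts by $0$ and $f\in\Bbbk^{\mathbb{S}_3}$ acts by $f(e)$. For $\mathbf{a}$ generic, $L$ is the $\mathcal{A}_{[\mathbf{a}]}$-module with basis $\{v_g: e\neq g\in\mathbb{S}_3\}$, $v_g\in L[g]$, and $x_{(ij)}\cdot v_g=v_{(ij)g}$ if $\operatorname{sgn} g=1$, $x_{(ij)}\cdot v_g=f_{ij}(g)v_{(ij)g}$ if $\operatorname{sgn} g=-1$ (read as $0$ when $g=(ij)$, since $f_{ij}((ij))=0$). *)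

theory Defs
  imports
    "HOL-Algebra.Module"
    "HOL-Algebra.QuotRing"
    "HOL-Algebra.Free_Abelian_Groups"
    "HOL-Algebra.Sym_Groups"
    "HOL-Combinatorics.Permutations"
    "HOL-Computational_Algebra.Polynomial"
    "HOL-Library.Poly_Mapping"
begin

section \<open>Left modules over a not necessarily commutative ring\<close>

text \<open>
  The locale \<^locale>\<open>module\<close> requires a commutative base ring, so the same axioms are
  restated here over an arbitrary ring. The fields \<^const>\<open>mult\<close> and \<^const>\<open>one\<close> of the
  record of a module carry no meaning.
\<close>

locale left_module = R?: ring R + M?: abelian_group M
  for R :: "('r, 'x) ring_scheme" and M :: "('r, 'm) module" (structure) +
  assumes smult_closed:
      "\<lbrakk>r \<in> carrier R; x \<in> carrier M\<rbrakk> \<Longrightarrow> r \<odot>\<^bsub>M\<^esub> x \<in> carrier M"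
    and smult_l_distr:
      "\<lbrakk>r \<in> carrier R; s \<in> carrier R; x \<in> carrier M\<rbrakk> \<Longrightarrow>
        (r \<oplus>\<^bsub>R\<^esub> s) \<odot>\<^bsub>M\<^esub> x = r \<odot>\<^bsub>M\<^esub> x \<oplus>\<^bsub>M\<^esub> s \<odot>\<^bsub>M\<^esub> x"
    and smult_r_distr:
      "\<lbrakk>r \<in> carrier R; x \<in> carrier M; y \<in> carrier M\<rbrakk> \<Longrightarrow>
        r \<odot>\<^bsub>M\<^esub> (x \<oplus>\<^bsub>M\<^esub> y) = r \<odot>\<^bsub>M\<^esub> x \<oplus>\<^bsub>M\<^esub> r \<odot>\<^bsub>M\<^esub> y"
    and smult_assoc:
      "\<lbrakk>r \<in> carrier R; s \<in> carrier R; x \<in> carrier M\<rbrakk> \<Longrightarrow>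
        (r \<otimes>\<^bsub>R\<^esub> s) \<odot>\<^bsub>M\<^esub> x = r \<odot>\<^bsub>M\<^esub> (s \<odot>\<^bsub>M\<^esub> x)"
    and smult_one:
      "x \<in> carrier M \<Longrightarrow> \<one>\<^bsub>R\<^esub> \<odot>\<^bsub>M\<^esub> x = x"

definition mod_hom ::
    "('r, 'x) ring_scheme \<Rightarrow> ('r, 'm) module \<Rightarrow> ('r, 'n) module \<Rightarrow> ('m \<Rightarrow> 'n) set" where
  "mod_hom R M N =
    {h \<in> carrier M \<rightarrow> carrier N.
       (\<forall>x\<in>carrier M. \<forall>y\<in>carrier M. h (x \<oplus>\<^bsub>M\<^esub> y) = h x \<oplus>\<^bsub>N\<^esub> h y) \<and>
       (\<forall>r\<in>carrier R. \<forall>x\<in>carrier M. h (r \<odot>\<^bsub>M\<^esub> x) = r \<odot>\<^bsub>N\<^esub> h x)}"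

definition mod_isomorphic ::
    "('r, 'x) ring_scheme \<Rightarrow> ('r, 'm) module \<Rightarrow> ('r, 'n) module \<Rightarrow> bool" where
  "mod_isomorphic R M N \<longleftrightarrow> (\<exists>h\<in>mod_hom R M N. bij_betw h (carrier M) (carrier N))"

definition simple_module :: "('r, 'x) ring_scheme \<Rightarrow> ('r, 'm) module \<Rightarrow> bool" where
  "simple_module R M \<longleftrightarrow>
     left_module R M \<and> carrier M \<noteq> {\<zero>\<^bsub>M\<^esub>} \<and>
     (\<forall>H. submodule H R M \<longrightarrow> H = {\<zero>\<^bsub>M\<^esub>} \<or> H = carrier M)"

text \<open>
  Projectivity and injectivity quantify over all modules. Since a definition cannot quantify
  over types, the types of the elements of the test modules are parameters; a theorem with
  these left as type variables holds for test modules of every type.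
\<close>

definition projective_module ::
    "'m itself \<Rightarrow> 'n itself \<Rightarrow> ('r, 'x) ring_scheme \<Rightarrow> ('r, 'p) module \<Rightarrow> bool" where
  "projective_module _ _ R P \<longleftrightarrow>
     left_module R P \<and>
     (\<forall>(N :: ('r, 'm) module) (N' :: ('r, 'n) module) g h.
        left_module R N \<and> left_module R N' \<and>
        g \<in> mod_hom R N N' \<and> g ` carrier N = carrier N' \<and> h \<in> mod_hom R P N' \<longrightarrow>
        (\<exists>k\<in>mod_hom R P N. \<forall>x\<in>carrier P. g (k x) = h x))"

definition injective_module ::
    "'m itself \<Rightarrow> 'n itself \<Rightarrow> ('r, 'x) ring_scheme \<Rightarrow> ('r, 'e) module \<Rightarrow> bool" where
  "injective_module _ _ R E \<longleftrightarrow>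
     left_module R E \<and>
     (\<forall>(N :: ('r, 'm) module) (N' :: ('r, 'n) module) g h.
        left_module R N \<and> left_module R N' \<and>
        g \<in> mod_hom R N N' \<and> inj_on g (carrier N) \<and> h \<in> mod_hom R N E \<longrightarrow>
        (\<exists>k\<in>mod_hom R N' E. \<forall>x\<in>carrier N. k (g x) = h x))"

definition superfluous :: "('r, 'x) ring_scheme \<Rightarrow> ('r, 'm) module \<Rightarrow> 'm set \<Rightarrow> bool" where
  "superfluous R M K \<longleftrightarrow>
     submodule K R M \<and>
     (\<forall>H. submodule H R M \<and> H <+>\<^bsub>M\<^esub> K = carrier M \<longrightarrow> H = carrier M)"

definition essential :: "('r, 'x) ring_scheme \<Rightarrow> ('r, 'm) module \<Rightarrow> 'm set \<Rightarrow> bool" where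
  "essential R M K \<longleftrightarrow>
     submodule K R M \<and>
     (\<forall>H. submodule H R M \<and> H \<inter> K = {\<zero>\<^bsub>M\<^esub>} \<longrightarrow> H = {\<zero>\<^bsub>M\<^esub>})"

definition is_projective_cover ::
    "'m itself \<Rightarrow> 'n itself \<Rightarrow> ('r, 'x) ring_scheme \<Rightarrow> ('r, 'p) module \<Rightarrow> ('r, 's) module \<Rightarrow> bool"
  where
  "is_projective_cover T T' R P S \<longleftrightarrow>
     projective_module T T' R P \<and> left_module R S \<and>
     (\<exists>h\<in>mod_hom R P S. h ` carrier P = carrier S \<and> superfluous R P (a_kernel P S h))"

definition is_injective_hull ::
    "'m itself \<Rightarrow> 'n itself \<Rightarrow> ('r, 'x) ring_scheme \<Rightarrow> ('r, 'e) module \<Rightarrow> ('r, 's) module \<Rightarrow> bool"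
  where
  "is_injective_hull T T' R E S \<longleftrightarrow>
     injective_module T T' R E \<and> left_module R S \<and>
     (\<exists>h\<in>mod_hom R S E. inj_on h (carrier S) \<and> essential R E (h ` carrier S))"


section \<open>Extension of scalars\<close>

text \<open>
  For a ring homomorphism \<open>\<phi>\<close> from \<open>B\<close> to \<open>A\<close> and a left \<open>B\<close>-module \<open>N\<close>, the left
  \<open>A\<close>-module \<open>A \<otimes>\<^sub>B N\<close> is the free abelian group on \<open>A \<times> N\<close> modulo the
  balanced biadditive relations.
\<close>

definition tensor_relations ::
    "('b, 'y) ring_scheme \<Rightarrow> ('a, 'x) ring_scheme \<Rightarrow> ('b \<Rightarrow> 'a) \<Rightarrow> ('b, 'n) module \<Rightarrow>
     ('a \<times> 'n \<Rightarrow>\<^sub>0 int) set" where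
  "tensor_relations B A \<phi> N =
     {frag_of (x \<oplus>\<^bsub>A\<^esub> y, n) - frag_of (x, n) - frag_of (y, n) | x y n.
        x \<in> carrier A \<and> y \<in> carrier A \<and> n \<in> carrier N} \<union>
     {frag_of (x, m \<oplus>\<^bsub>N\<^esub> n) - frag_of (x, m) - frag_of (x, n) | x m n.
        x \<in> carrier A \<and> m \<in> carrier N \<and> n \<in> carrier N} \<union>
     {frag_of (x \<otimes>\<^bsub>A\<^esub> \<phi> b, n) - frag_of (x, b \<odot>\<^bsub>N\<^esub> n) | x b n.
        x \<in> carrier A \<and> b \<in> carrier B \<and> n \<in> carrier N}"

definition extend_scalars ::
    "('b, 'y) ring_scheme \<Rightarrow> ('a, 'x) ring_scheme \<Rightarrow> ('b \<Rightarrow> 'a) \<Rightarrow> ('b, 'n) module \<Rightarrow>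
     ('a, ('a \<times> 'n \<Rightarrow>\<^sub>0 int) set) module" where
  "extend_scalars B A \<phi> N =
    (let F = free_Abelian_group (carrier A \<times> carrier N);
         T = generate F (tensor_relations B A \<phi> N)
     in \<lparr>carrier = carrier (F Mod T), monoid.mult = undefined, one = undefined,
         ring.zero = \<one>\<^bsub>F Mod T\<^esub>, ring.add = (\<otimes>\<^bsub>F Mod T\<^esub>),
         module.smult = (\<lambda>r C. the_elem
           ((\<lambda>p. T #>\<^bsub>F\<^esub> frag_extend (\<lambda>(x, n). frag_of (r \<otimes>\<^bsub>A\<^esub> x, n)) p) ` C))\<rparr>)"


section \<open>Free algebras\<close>

text \<open>Words under concatenation, written additively so that the multiplication of
  \<open>'g word \<Rightarrow>\<^sub>0 'k\<close> is that of the monoid algebra.\<close>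

datatype 'g word = Word (letters: "'g list")

instantiation word :: (type) monoid_add
begin

definition zero_word :: "'g word" where "zero_word = Word []"

definition plus_word :: "'g word \<Rightarrow> 'g word \<Rightarrow> 'g word" where
  "plus_word v w = Word (letters v @ letters w)"

instance
  by standard (simp_all add: zero_word_def plus_word_def)

end

definition free_algebra :: "'g set \<Rightarrow> ('g word \<Rightarrow>\<^sub>0 'k::field) ring" where
  "free_algebra G =
     \<lparr>carrier = {p. \<forall>w\<in>Poly_Mapping.keys p. set (letters w) \<subseteq> G},
      monoid.mult = (*), one = 1, ring.zero = 0, ring.add = (+)\<rparr>"

definition gen :: "'g \<Rightarrow> 'g word \<Rightarrow>\<^sub>0 'k::field" where
  "gen s = Poly_Mapping.single (Word [s]) 1"

definition scal :: "'k \<Rightarrow> 'g word \<Rightarrow>\<^sub>0 'k::field" where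
  "scal c = Poly_Mapping.single 0 c"


section \<open>The algebra and its modules\<close>

abbreviation S3 :: "(nat \<Rightarrow> nat) monoid" where
  "S3 \<equiv> sym_group 3"

abbreviation t12 :: "nat \<Rightarrow> nat" where "t12 \<equiv> transpose 1 2"
abbreviation t13 :: "nat \<Rightarrow> nat" where "t13 \<equiv> transpose 1 3"
abbreviation t23 :: "nat \<Rightarrow> nat" where "t23 \<equiv> transpose 2 3"

definition O23 :: "(nat \<Rightarrow> nat) set" where
  "O23 = {t12, t13, t23}"

text \<open>A triple of scalars indexed by \<^const>\<open>O23\<close> is a function of which only the values on
  \<^const>\<open>O23\<close> are ever used.\<close>

definition frakA3 :: "((nat \<Rightarrow> nat) \<Rightarrow> 'k::field) set" where
  "frakA3 = {a. a t12 + a t13 + a t23 = 0}"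

definition generic :: "((nat \<Rightarrow> nat) \<Rightarrow> 'k) \<Rightarrow> bool" where
  "generic a \<longleftrightarrow> a t12 \<noteq> a t13 \<and> a t12 \<noteq> a t23 \<and> a t13 \<noteq> a t23"

definition f_val :: "((nat \<Rightarrow> nat) \<Rightarrow> 'k::field) \<Rightarrow> (nat \<Rightarrow> nat) \<Rightarrow> (nat \<Rightarrow> nat) \<Rightarrow> 'k" where
  "f_val a t g = a t - a (inv\<^bsub>S3\<^esub> g \<otimes>\<^bsub>S3\<^esub> t \<otimes>\<^bsub>S3\<^esub> g)"

definition fun_ring :: "((nat \<Rightarrow> nat) \<Rightarrow> 'k::field) ring" where
  "fun_ring =
     \<lparr>carrier = carrier S3 \<rightarrow>\<^sub>E UNIV,
      monoid.mult = (\<lambda>u v. \<lambda>g\<in>carrier S3. u g * v g), one = (\<lambda>g\<in>carrier S3. 1),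
      ring.zero = (\<lambda>g\<in>carrier S3. 0), ring.add = (\<lambda>u v. \<lambda>g\<in>carrier S3. u g + v g)\<rparr>"

text \<open>\<open>Delta g\<close> stands for the characteristic function of \<open>{g}\<close>, \<open>Xgen t\<close> for the generator
  indexed by the transposition \<open>t\<close>.\<close>

datatype sgen = Delta "nat \<Rightarrow> nat" | Xgen "nat \<Rightarrow> nat"

definition generators :: "sgen set" where
  "generators = Delta ` carrier S3 \<union> Xgen ` O23"

definition free_fun :: "((nat \<Rightarrow> nat) \<Rightarrow> 'k) \<Rightarrow> sgen word \<Rightarrow>\<^sub>0 'k::field" where
  "free_fun u = (\<Sum>g\<in>carrier S3. scal (u g) * gen (Delta g))"

text \<open>The first two sets present the algebra of functions on \<^term>\<open>S3\<close> on its basis of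
  characteristic functions.\<close>

definition relators :: "((nat \<Rightarrow> nat) \<Rightarrow> 'k::field) \<Rightarrow> (sgen word \<Rightarrow>\<^sub>0 'k) set" where
  "relators a =
     {gen (Delta g) * gen (Delta h) - (if g = h then gen (Delta g) else 0) | g h.
        g \<in> carrier S3 \<and> h \<in> carrier S3} \<union>
     {(\<Sum>g\<in>carrier S3. gen (Delta g)) - 1} \<union>
     {gen (Delta h) * gen (Xgen t) - gen (Xgen t) * gen (Delta (t \<otimes>\<^bsub>S3\<^esub> h)) | h t.
        h \<in> carrier S3 \<and> t \<in> O23} \<union>
     {gen (Xgen t) * gen (Xgen t) - free_fun (f_val a t) | t. t \<in> O23} \<union>
     {gen (Xgen t13) * gen (Xgen t23) + gen (Xgen t23) * gen (Xgen t12) + gen (Xgen t12) * gen (Xgen t13),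
      gen (Xgen t23) * gen (Xgen t13) + gen (Xgen t13) * gen (Xgen t12) + gen (Xgen t12) * gen (Xgen t23)}"

type_synonym 'k alg_elem = "(sgen word \<Rightarrow>\<^sub>0 'k) set"

definition rel_ideal :: "((nat \<Rightarrow> nat) \<Rightarrow> 'k::field) \<Rightarrow> (sgen word \<Rightarrow>\<^sub>0 'k) set" where
  "rel_ideal a = Idl\<^bsub>free_algebra generators\<^esub> (relators a)"

definition algA :: "((nat \<Rightarrow> nat) \<Rightarrow> 'k::field) \<Rightarrow> 'k alg_elem ring" where
  "algA a = free_algebra generators Quot rel_ideal a"

definition fun_incl :: "((nat \<Rightarrow> nat) \<Rightarrow> 'k::field) \<Rightarrow> ((nat \<Rightarrow> nat) \<Rightarrow> 'k) \<Rightarrow> 'k alg_elem" where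
  "fun_incl a u = rel_ideal a +>\<^bsub>free_algebra generators\<^esub> free_fun u"

definition eval_module :: "(nat \<Rightarrow> nat) \<Rightarrow> ((nat \<Rightarrow> nat) \<Rightarrow> 'k::field, 'k) module" where
  "eval_module g =
     \<lparr>carrier = UNIV, monoid.mult = undefined, one = undefined, ring.zero = 0, ring.add = (+),
      module.smult = (\<lambda>u c. u g * c)\<rparr>"

definition verma ::
    "((nat \<Rightarrow> nat) \<Rightarrow> 'k::field) \<Rightarrow> (nat \<Rightarrow> nat) \<Rightarrow>
     ('k alg_elem, ('k alg_elem \<times> 'k \<Rightarrow>\<^sub>0 int) set) module" where
  "verma a g = extend_scalars fun_ring (algA a) (fun_incl a) (eval_module g)"

text \<open>
  Modules given by a basis indexed by \<open>I\<close> and the images \<open>b s i\<close> of the basis vectors under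
  the generators. Vectors are coordinate functions vanishing outside \<open>I\<close>. A class of the
  quotient algebra acts through any of its representatives; \<^const>\<open>the_elem\<close> gives a
  meaningful value exactly when the action does not depend on the representative.
\<close>

definition gen_act ::
    "'i set \<Rightarrow> ('s \<Rightarrow> 'i \<Rightarrow> 'i \<Rightarrow> 'k::field) \<Rightarrow> 's \<Rightarrow> ('i \<Rightarrow> 'k) \<Rightarrow> 'i \<Rightarrow> 'k" where
  "gen_act I b s v = (\<lambda>j. \<Sum>i\<in>I. v i * b s i j)"

definition free_act ::
    "'i set \<Rightarrow> ('s \<Rightarrow> 'i \<Rightarrow> 'i \<Rightarrow> 'k::field) \<Rightarrow> ('s word \<Rightarrow>\<^sub>0 'k) \<Rightarrow> ('i \<Rightarrow> 'k) \<Rightarrow> 'i \<Rightarrow> 'k" where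
  "free_act I b p v =
     (\<lambda>j. \<Sum>w\<in>Poly_Mapping.keys p. Poly_Mapping.lookup p w * foldr (gen_act I b) (letters w) v j)"

definition basis_module ::
    "'i set \<Rightarrow> ('s \<Rightarrow> 'i \<Rightarrow> 'i \<Rightarrow> 'k::field) \<Rightarrow> (('s word \<Rightarrow>\<^sub>0 'k) set, 'i \<Rightarrow> 'k) module" where
  "basis_module I b =
     \<lparr>carrier = {v. \<forall>i. i \<notin> I \<longrightarrow> v i = 0}, monoid.mult = undefined, one = undefined,
      ring.zero = (\<lambda>_. 0), ring.add = (\<lambda>v w i. v i + w i),
      module.smult = (\<lambda>C v. the_elem ((\<lambda>p. free_act I b p v) ` C))\<rparr>"

definition unit_vec :: "'i \<Rightarrow> 'i \<Rightarrow> 'k::field" where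
  "unit_vec i = (\<lambda>j. if j = i then 1 else 0)"

fun k_e_act :: "sgen \<Rightarrow> (nat \<Rightarrow> nat) \<Rightarrow> (nat \<Rightarrow> nat) \<Rightarrow> 'k::field" where
  "k_e_act (Delta h) g = (if h = g then unit_vec g else (\<lambda>_. 0))"
| "k_e_act (Xgen t) g = (\<lambda>_. 0)"

definition k_e :: "('k::field alg_elem, (nat \<Rightarrow> nat) \<Rightarrow> 'k) module" where
  "k_e = basis_module {\<one>\<^bsub>S3\<^esub>} k_e_act"

text \<open>For \<open>g = t\<close> the scalar \<^term>\<open>f_val a t g\<close> is zero, so the vector outside the index set
  below does not contribute.\<close>

fun L_act :: "((nat \<Rightarrow> nat) \<Rightarrow> 'k::field) \<Rightarrow> sgen \<Rightarrow> (nat \<Rightarrow> nat) \<Rightarrow> (nat \<Rightarrow> nat) \<Rightarrow> 'k" where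
  "L_act a (Delta h) g = (if h = g then unit_vec g else (\<lambda>_. 0))"
| "L_act a (Xgen t) g =
     (if sign g = 1 then unit_vec (t \<otimes>\<^bsub>S3\<^esub> g)
      else (\<lambda>j. f_val a t g * unit_vec (t \<otimes>\<^bsub>S3\<^esub> g) j))"

definition L_module ::
    "((nat \<Rightarrow> nat) \<Rightarrow> 'k::field) \<Rightarrow> ('k alg_elem, (nat \<Rightarrow> nat) \<Rightarrow> 'k) module" where
  "L_module a = basis_module (carrier S3 - {\<one>\<^bsub>S3\<^esub>}) (L_act a)"

end

(*
  Write e, c, d for the even permutations ("hubs") and T0, T1, T2 for the transpositions ("tips").
  Every x_(ij) is a sum of arrows between a hub and a tip, and the defining relations become
  relations of a quiver with one arrow in each direction between any hub and any tip. Since a is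
  generic, the arrows between {c, d} and the tips are invertible, so that the weights different
  from e carry matrix units and the algebra is Morita equivalent to its corner at e and c. That
  corner has the basis delta_e, delta_c, al0, al1 (from e to c), be0, be1 (from c to e), al0 be1
  and be0 al1, with al_i be_i = be_i al_i = 0, al1 be0 = - al0 be1 and be1 al0 = - be0 al1.

  For eps = delta_e put nu = be0 al1, for eps = delta_c put nu = al0 be1. Then eps A eps is
  spanned by eps and nu with nu^2 = 0, and reading off the coefficient of nu is a perfect pairing
  of the right ideal eps A with the left ideal A eps. Hence A eps is projective with a simple top
  and, being the dual of eps A, injective with socle generated by nu, where top and socle are
  isomorphic. The elements nu are nonzero because they act nontrivially on two explicit
  modules of dimension 12.
*)

theory Submission
  imports Defs
begin

section \<open>Modules over a ring\<close>

text \<open>The algebra is known through generators and relations, so spanning statements are cheap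
  and independence statements are not. All independence is reduced to \<nu> \<noteq> 0 at the two
  vertices: spanning sets of \<epsilon>A and A\<epsilon> whose products are dual up to multiples of
  \<epsilon> are automatically bases. The relations between the al_j and be_j come from the
  vanishing of f at e: a detour through e and back to the same tip is zero. As the al_j add up to
  zero over the three tips, and the be_j too, polarising al_j be_j = 0 and be_j al_j = 0 gives the
  two sign rules. The test modules for injectivity may be infinite-dimensional, so a homomorphism
  into A\<epsilon> is turned into a linear functional, extended by Zorn's lemma, and turned back
  with the dual bases. A Verma module is a tensor product; identifying it with A\<epsilon> rests on
  the fact that r \<otimes> 1 = 0 forces r\<epsilon> = 0. A simple module cannot be killed by both
  delta_e and delta_c, because every other weight idempotent factors through delta_c; a vector of
  one of these weights makes it a quotient of one of the two Verma modules.\<close>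

context left_module
begin

lemma smult_zero_l: "x \<in> carrier M \<Longrightarrow> \<zero>\<^bsub>R\<^esub> \<odot> x = \<zero>"
  using smult_l_distr[of "\<zero>\<^bsub>R\<^esub>" "\<zero>\<^bsub>R\<^esub>" x] smult_closed[of "\<zero>\<^bsub>R\<^esub>" x]
  by (metis M.add.l_cancel_one' R.zero_closed R.l_zero)

lemma smult_zero_r: "r \<in> carrier R \<Longrightarrow> r \<odot> \<zero> = \<zero>"
  using smult_r_distr[of r "\<zero>" "\<zero>"] smult_closed[of r "\<zero>"]
  by (metis M.add.l_cancel_one' M.zero_closed M.l_zero)

lemma smult_minus_l:
  assumes "r \<in> carrier R" "x \<in> carrier M"
  shows "(\<ominus>\<^bsub>R\<^esub> r) \<odot> x = \<ominus> (r \<odot> x)"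
proof -
  have "(\<ominus>\<^bsub>R\<^esub> r) \<odot> x \<oplus> r \<odot> x = \<zero>"
    using assms smult_l_distr[of "\<ominus>\<^bsub>R\<^esub> r" r x] smult_zero_l by (simp add: R.l_neg)
  then show ?thesis
    using assms smult_closed M.minus_equality by (metis R.a_inv_closed)
qed

lemma submoduleI:
  assumes "H \<subseteq> carrier M" "\<zero> \<in> H"
    and "\<And>x y. x \<in> H \<Longrightarrow> y \<in> H \<Longrightarrow> x \<oplus> y \<in> H"
    and smult: "\<And>r x. r \<in> carrier R \<Longrightarrow> x \<in> H \<Longrightarrow> r \<odot> x \<in> H"
  shows "submodule H R M"
proof -
  have "\<ominus> x \<in> H" if "x \<in> H" for x
    using smult[of "\<ominus>\<^bsub>R\<^esub> \<one>\<^bsub>R\<^esub>" x] that assms(1) smult_minus_l[of "\<one>\<^bsub>R\<^esub>" x] smult_one[of x] by auto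
  then have "subgroup H (add_monoid M)"
    using assms by (intro subgroup.intro) (auto simp: a_inv_def)
  then show ?thesis
    using assms by (intro submodule.intro submodule_axioms.intro) auto
qed

lemma submoduleD:
  assumes "submodule H R M"
  shows "H \<subseteq> carrier M" "\<zero> \<in> H"
    "x \<in> H \<Longrightarrow> y \<in> H \<Longrightarrow> x \<oplus> y \<in> H"
    "r \<in> carrier R \<Longrightarrow> x \<in> H \<Longrightarrow> r \<odot> x \<in> H"
proof -
  interpret submodule H R M by fact
  show "H \<subseteq> carrier M" "\<zero> \<in> H" using subset one_closed by auto
  show "x \<in> H \<Longrightarrow> y \<in> H \<Longrightarrow> x \<oplus> y \<in> H" using m_closed by simp
  show "r \<in> carrier R \<Longrightarrow> x \<in> H \<Longrightarrow> r \<odot> x \<in> H" using smult_closed by blast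
qed

lemma smult_finsum:
  assumes "finite J" "r \<in> carrier R" "f \<in> J \<rightarrow> carrier M"
  shows "r \<odot> finsum M f J = finsum M (\<lambda>j. r \<odot> f j) J"
  using assms(1,3)
proof (induction J)
  case (insert j J)
  have "(\<lambda>j. r \<odot> f j) \<in> J \<rightarrow> carrier M" "f \<in> J \<rightarrow> carrier M"
    using insert assms(2) smult_closed by auto
  with insert assms(2) show ?case
    by (simp add: smult_r_distr smult_closed)
qed (simp add: smult_zero_r assms)

lemma finsum_smult:
  assumes "finite J" "x \<in> carrier M" "f \<in> J \<rightarrow> carrier R"
  shows "finsum R f J \<odot> x = finsum M (\<lambda>j. f j \<odot> x) J"
  using assms(1,3)
proof (induction J)
  case (insert j J)
  have "(\<lambda>j. f j \<odot> x) \<in> J \<rightarrow> carrier M" "f \<in> J \<rightarrow> carrier R"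
    using insert assms(2) smult_closed by auto
  with insert assms(2) show ?case
    by (simp add: smult_l_distr smult_closed)
qed (simp add: smult_zero_l assms)

lemma finsum_mult_smult:
  assumes "finite J" "x \<in> carrier M" "\<And>j. j \<in> J \<Longrightarrow> s j \<in> carrier R" "\<And>j. j \<in> J \<Longrightarrow> c j \<in> carrier R"
  shows "finsum R (\<lambda>j. s j \<otimes>\<^bsub>R\<^esub> c j) J \<odot> x = finsum M (\<lambda>j. s j \<odot> (c j \<odot> x)) J"
proof -
  have "finsum R (\<lambda>j. s j \<otimes>\<^bsub>R\<^esub> c j) J \<odot> x = finsum M (\<lambda>j. (s j \<otimes>\<^bsub>R\<^esub> c j) \<odot> x) J"
    using assms by (intro finsum_smult) auto
  also have "\<dots> = finsum M (\<lambda>j. s j \<odot> (c j \<odot> x)) J"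
    using assms by (intro M.finsum_cong') (auto simp: smult_assoc smult_closed)
  finally show ?thesis .
qed

end

section \<open>Homomorphisms, their images and kernels\<close>

lemma mod_homD:
  assumes "h \<in> mod_hom R M N"
  shows "x \<in> carrier M \<Longrightarrow> h x \<in> carrier N"
    "x \<in> carrier M \<Longrightarrow> y \<in> carrier M \<Longrightarrow> h (x \<oplus>\<^bsub>M\<^esub> y) = h x \<oplus>\<^bsub>N\<^esub> h y"
    "r \<in> carrier R \<Longrightarrow> x \<in> carrier M \<Longrightarrow> h (r \<odot>\<^bsub>M\<^esub> x) = r \<odot>\<^bsub>N\<^esub> h x"
  using assms unfolding mod_hom_def by auto

lemma mod_homI:
  assumes "\<And>x. x \<in> carrier M \<Longrightarrow> h x \<in> carrier N"
    "\<And>x y. x \<in> carrier M \<Longrightarrow> y \<in> carrier M \<Longrightarrow> h (x \<oplus>\<^bsub>M\<^esub> y) = h x \<oplus>\<^bsub>N\<^esub> h y"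
    "\<And>r x. r \<in> carrier R \<Longrightarrow> x \<in> carrier M \<Longrightarrow> h (r \<odot>\<^bsub>M\<^esub> x) = r \<odot>\<^bsub>N\<^esub> h x"
  shows "h \<in> mod_hom R M N"
  using assms unfolding mod_hom_def by auto

lemma mod_hom_zero:
  assumes "left_module R M" "left_module R N" "h \<in> mod_hom R M N"
  shows "h \<zero>\<^bsub>M\<^esub> = \<zero>\<^bsub>N\<^esub>"
proof -
  interpret M: left_module R M by fact
  interpret N: left_module R N by fact
  have "h (\<zero>\<^bsub>R\<^esub> \<odot>\<^bsub>M\<^esub> \<zero>\<^bsub>M\<^esub>) = \<zero>\<^bsub>R\<^esub> \<odot>\<^bsub>N\<^esub> h \<zero>\<^bsub>M\<^esub>"
    using mod_homD(3)[OF assms(3)] by simp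
  then show ?thesis
    using M.smult_zero_l N.smult_zero_l mod_homD(1)[OF assms(3)] by simp
qed

lemma mod_hom_image_submodule:
  assumes "left_module R M" "left_module R N" "h \<in> mod_hom R M N"
  shows "submodule (h ` carrier M) R N"
proof -
  interpret M: left_module R M by fact
  interpret N: left_module R N by fact
  note h = mod_homD[OF assms(3)]
  show ?thesis
  proof (rule N.submoduleI)
    show "\<zero>\<^bsub>N\<^esub> \<in> h ` carrier M"
      by (metis M.M.zero_closed assms image_eqI mod_hom_zero)
    show "x \<oplus>\<^bsub>N\<^esub> y \<in> h ` carrier M" if "x \<in> h ` carrier M" "y \<in> h ` carrier M" for x y
      using that by (auto simp flip: h(2))
    show "r \<odot>\<^bsub>N\<^esub> x \<in> h ` carrier M" if "r \<in> carrier R" "x \<in> h ` carrier M" for r x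
      using that M.smult_closed by (auto simp flip: h(3))
  qed (use h in auto)
qed

lemma mod_hom_kernel_submodule:
  assumes "left_module R M" "left_module R N" "h \<in> mod_hom R M N"
  shows "submodule (a_kernel M N h) R M"
proof -
  interpret M: left_module R M by fact
  interpret N: left_module R N by fact
  note h = mod_homD[OF assms(3)]
  show ?thesis
    unfolding a_kernel_def'
    by (rule M.submoduleI)
       (use h mod_hom_zero[OF assms] M.smult_closed N.smult_zero_r in auto)
qed

lemma mod_hom_minus:
  assumes "left_module R M" "left_module R N" "h \<in> mod_hom R M N" "x \<in> carrier M"
  shows "h (\<ominus>\<^bsub>M\<^esub> x) = \<ominus>\<^bsub>N\<^esub> h x"
proof -
  interpret M: left_module R M by fact
  interpret N: left_module R N by fact
  note h = mod_homD[OF assms(3)]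
  have "h ((\<ominus>\<^bsub>R\<^esub> \<one>\<^bsub>R\<^esub>) \<odot>\<^bsub>M\<^esub> x) = (\<ominus>\<^bsub>R\<^esub> \<one>\<^bsub>R\<^esub>) \<odot>\<^bsub>N\<^esub> h x"
    using assms(4) h(3) by simp
  then show ?thesis
    using M.smult_minus_l[of "\<one>\<^bsub>R\<^esub>" x] N.smult_minus_l[of "\<one>\<^bsub>R\<^esub>" "h x"]
      M.smult_one N.smult_one assms(4) h(1) by simp
qed

lemma mod_hom_inj_onI:
  assumes "left_module R M" "left_module R N" "h \<in> mod_hom R M N"
    and ker: "\<And>x. x \<in> carrier M \<Longrightarrow> h x = \<zero>\<^bsub>N\<^esub> \<Longrightarrow> x = \<zero>\<^bsub>M\<^esub>"
  shows "inj_on h (carrier M)"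
proof (rule inj_onI)
  interpret M: left_module R M by fact
  interpret N: left_module R N by fact
  note h = mod_homD[OF assms(3)]
  fix x y assume xy: "x \<in> carrier M" "y \<in> carrier M" "h x = h y"
  have "h (x \<oplus>\<^bsub>M\<^esub> \<ominus>\<^bsub>M\<^esub> y) = \<zero>\<^bsub>N\<^esub>"
    using xy h mod_hom_minus[OF assms(1-3)] by (simp add: N.M.r_neg)
  then have "x \<oplus>\<^bsub>M\<^esub> \<ominus>\<^bsub>M\<^esub> y = \<zero>\<^bsub>M\<^esub>"
    using ker xy by simp
  then show "x = y"
    using xy by (metis M.M.minus_equality M.M.minus_minus M.M.a_inv_closed)
qed

text \<open>The image is a submodule containing the nonzero \<open>h x\<close>: the surjective half
  of Schur's lemma.\<close>

lemma simple_module_image: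
  assumes "left_module R P" "simple_module R T" "h \<in> mod_hom R P T"
    and "x \<in> carrier P" "h x \<noteq> \<zero>\<^bsub>T\<^esub>"
  shows "h ` carrier P = carrier T"
  using assms mod_hom_image_submodule[of R P T h] unfolding simple_module_def by auto

text \<open>The kernel is a submodule missing \<open>x\<close>: the injective half of Schur's
  lemma.\<close>

lemma simple_module_inj:
  assumes "simple_module R T" "left_module R P" "h \<in> mod_hom R T P"
    and "x \<in> carrier T" "h x \<noteq> \<zero>\<^bsub>P\<^esub>"
  shows "inj_on h (carrier T)"
proof -
  interpret T: left_module R T using assms(1) by (simp add: simple_module_def)
  have "submodule (a_kernel T P h) R T"
    using assms by (intro mod_hom_kernel_submodule) (auto simp: simple_module_def)
  then have "a_kernel T P h = {\<zero>\<^bsub>T\<^esub>}"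
    using assms unfolding simple_module_def by (auto simp: a_kernel_def')
  then show ?thesis
    using assms by (intro mod_hom_inj_onI) (auto simp: simple_module_def a_kernel_def')
qed

section \<open>Extension of linear functionals\<close>

text \<open>Zorn's lemma for graphs of partial functionals. Scaling is a parameter \<open>s\<close>
  because the test modules carry no vector space structure of their own: the field acts on them
  through central elements of the algebra.\<close>

lemma (in abelian_group) linear_functional_extension:
  fixes s :: "'k::field \<Rightarrow> 'a \<Rightarrow> 'a" and f :: "'a \<Rightarrow> 'k"
  assumes s_closed: "\<And>c x. x \<in> carrier G \<Longrightarrow> s c x \<in> carrier G"
    and s_add: "\<And>c d x. x \<in> carrier G \<Longrightarrow> s (c + d) x = s c x \<oplus> s d x"
    and s_distr: "\<And>c x y. x \<in> carrier G \<Longrightarrow> y \<in> carrier G \<Longrightarrow> s c (x \<oplus> y) = s c x \<oplus> s c y"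
    and s_mult: "\<And>c d x. x \<in> carrier G \<Longrightarrow> s (c * d) x = s c (s d x)"
    and s_one: "\<And>x. x \<in> carrier G \<Longrightarrow> s 1 x = x"
    and U: "U \<subseteq> carrier G" "\<zero> \<in> U"
    and U_add: "\<And>x y. x \<in> U \<Longrightarrow> y \<in> U \<Longrightarrow> x \<oplus> y \<in> U"
    and U_s: "\<And>c x. x \<in> U \<Longrightarrow> s c x \<in> U"
    and f_add: "\<And>x y. x \<in> U \<Longrightarrow> y \<in> U \<Longrightarrow> f (x \<oplus> y) = f x + f y"
    and f_s: "\<And>c x. x \<in> U \<Longrightarrow> f (s c x) = c * f x"
  shows "\<exists>\<mu>. (\<forall>x\<in>carrier G. \<forall>y\<in>carrier G. \<mu> (x \<oplus> y) = \<mu> x + \<mu> y) \<and>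
    (\<forall>c. \<forall>x\<in>carrier G. \<mu> (s c x) = c * \<mu> x) \<and> (\<forall>u\<in>U. \<mu> u = f u)"
proof -
  have s0: "s 0 x = \<zero>" if "x \<in> carrier G" for x
    using s_add[of x 0 0] s_closed[of x 0] that by (metis add.l_cancel_one' add.left_neutral)
  have sm1: "s (-1) x = \<ominus> x" if "x \<in> carrier G" for x
    using s_add[of x "-1" 1] s_closed[of x "-1"] s_one[of x] s0[of x] that
    by (simp add: minus_equality)
  \<comment> \<open>Linear subsets of G \<times> k. Such a set is single-valued as soon as it has no
    pair (0, c) with c \<noteq> 0, a condition that passes to unions of chains.\<close>
  define Gr where "Gr = {g. g \<subseteq> carrier G \<times> UNIV \<and> (\<lambda>u. (u, f u)) ` U \<subseteq> g \<and>
    (\<forall>x c y d. (x, c) \<in> g \<longrightarrow> (y, d) \<in> g \<longrightarrow> (x \<oplus> y, c + d) \<in> g) \<and>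
    (\<forall>x c b. (x, c) \<in> g \<longrightarrow> (s b x, b * c) \<in> g) \<and> (\<forall>c. (\<zero>, c) \<in> g \<longrightarrow> c = 0)}"
  have f0: "f \<zero> = 0"
    using f_add[of \<zero> \<zero>] U by (metis add.r_one add_cancel_right_right zero_closed)
  have "(\<lambda>u. (u, f u)) ` U \<in> Gr"
    using U U_add U_s f_add f_s f0 unfolding Gr_def by auto
  then have "Gr \<noteq> {}" by auto
  moreover have "\<Union>C \<in> Gr" if C: "C \<noteq> {}" "subset.chain Gr C" for C
  proof -
    have CG: "g \<in> C \<Longrightarrow> g \<in> Gr" for g
      using C(2) by (auto simp: subset.chain_def)
    have lin: "g \<subseteq> g' \<or> g' \<subseteq> g" if "g \<in> C" "g' \<in> C" for g g'
      using C(2) that by (auto simp: subset.chain_def)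
    have add: "(x \<oplus> y, c + d) \<in> \<Union>C" if xy: "(x, c) \<in> g" "(y, d) \<in> g'" "g \<in> C" "g' \<in> C"
      for x c y d g g'
    proof -
      obtain g'' where "g'' \<in> C" "(x, c) \<in> g''" "(y, d) \<in> g''"
        using lin[OF xy(3,4)] xy by blast
      with CG[of g''] show ?thesis unfolding Gr_def by blast
    qed
    show ?thesis
      unfolding Gr_def mem_Collect_eq
    proof (intro conjI allI impI)
      show "\<Union>C \<subseteq> carrier G \<times> UNIV" using CG unfolding Gr_def by blast
      show "(\<lambda>u. (u, f u)) ` U \<subseteq> \<Union>C"
        using CG C(1) unfolding Gr_def by blast
      show "(x \<oplus> y, c + d) \<in> \<Union>C" if "(x, c) \<in> \<Union>C" "(y, d) \<in> \<Union>C" for x c y d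
        using that add by blast
      show "(s b x, b * c) \<in> \<Union>C" if "(x, c) \<in> \<Union>C" for x c b
        using that CG unfolding Gr_def by blast
      show "c = 0" if "(\<zero>, c) \<in> \<Union>C" for c
        using that CG unfolding Gr_def by blast
    qed
  qed
  ultimately obtain g where g: "g \<in> Gr" and max: "\<And>g'. g' \<in> Gr \<Longrightarrow> g \<subseteq> g' \<Longrightarrow> g' = g"
    using subset_Zorn_nonempty[of Gr] by blast
  have gc: "(x, c) \<in> g \<Longrightarrow> x \<in> carrier G" for x c
    using g unfolding Gr_def by auto
  have gU: "u \<in> U \<Longrightarrow> (u, f u) \<in> g" for u
    using g unfolding Gr_def by auto
  have ga: "(x, c) \<in> g \<Longrightarrow> (y, d) \<in> g \<Longrightarrow> (x \<oplus> y, c + d) \<in> g" for x c y d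
    using g unfolding Gr_def by auto
  have gs: "(x, c) \<in> g \<Longrightarrow> (s b x, b * c) \<in> g" for x c b
    using g unfolding Gr_def by auto
  have g0: "(\<zero>, c) \<in> g \<Longrightarrow> c = 0" for c
    using g unfolding Gr_def by auto
  have g00: "(\<zero>, 0) \<in> g"
    using gU[of \<zero>] U f0 by simp
  have uniq: "c = d" if "(x, c) \<in> g" "(x, d) \<in> g" for x c d
  proof -
    have "(x \<oplus> s (-1) x, c + (-1) * d) \<in> g"
      using ga[OF that(1) gs[OF that(2)]] .
    then show ?thesis
      using g0 sm1[OF gc[OF that(1)]] gc[OF that(1)] by (fastforce simp: r_neg)
  qed
  have total: "\<exists>c. (x, c) \<in> g" if x: "x \<in> carrier G" for x
  proof (rule ccontr)
    assume nx: "\<nexists>c. (x, c) \<in> g"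
    \<comment> \<open>The functional extended to the span of its domain and \<open>x\<close>, with
      the value 0 at \<open>x\<close>.\<close>
    define g' where "g' = {(y \<oplus> s b x, c) | y b c. (y, c) \<in> g}"
    have sub: "g \<subseteq> g'"
    proof
      fix q assume "q \<in> g"
      obtain y c where q: "q = (y, c)" by (cases q)
      then have "(y, c) \<in> g" using \<open>q \<in> g\<close> by simp
      then have "(y \<oplus> s 0 x, c) \<in> g'" unfolding g'_def by blast
      then show "q \<in> g'" using \<open>(y, c) \<in> g\<close> q gc s0 x by auto
    qed
    have "g' \<in> Gr"
      unfolding Gr_def mem_Collect_eq
    proof (intro conjI allI impI)
      show "g' \<subseteq> carrier G \<times> UNIV"
        using gc s_closed x unfolding g'_def by auto
      show "(\<lambda>u. (u, f u)) ` U \<subseteq> g'"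
        using gU sub by auto
      show "(y \<oplus> z, c + d) \<in> g'" if yz: "(y, c) \<in> g'" "(z, d) \<in> g'" for y c z d
      proof -
        obtain y' b z' b' where *: "y = y' \<oplus> s b x" "(y', c) \<in> g" "z = z' \<oplus> s b' x" "(z', d) \<in> g"
          using yz unfolding g'_def by auto
        have "y \<oplus> z = (y' \<oplus> z') \<oplus> s (b + b') x"
          using * gc[OF *(2)] gc[OF *(4)] s_closed[OF x]
          by (simp add: s_add x a_assoc a_lcomm)
        then show ?thesis
          using ga[OF *(2,4)] unfolding g'_def by auto
      qed
      show "(s b y, b * c) \<in> g'" if y: "(y, c) \<in> g'" for y c b
      proof -
        obtain y' b' where *: "y = y' \<oplus> s b' x" "(y', c) \<in> g"
          using y unfolding g'_def by auto
        have "s b y = s b y' \<oplus> s (b * b') x"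
          using * gc[OF *(2)] s_closed[OF x] by (simp add: s_distr s_mult x)
        then show ?thesis
          using gs[OF *(2)] unfolding g'_def by auto
      qed
      show "c = 0" if zc: "(\<zero>, c) \<in> g'" for c
      proof -
        obtain y b where *: "\<zero> = y \<oplus> s b x" "(y, c) \<in> g"
          using zc unfolding g'_def by blast
        have y: "y \<in> carrier G" by (rule gc[OF *(2)])
        \<comment> \<open>Otherwise \<open>x\<close> would be a multiple of \<open>y\<close> and
          already lie in the domain.\<close>
        have b: "b = 0"
        proof (rule ccontr)
          assume "b \<noteq> 0"
          have "s (- 1) y = s b x"
            using * y s_closed[OF x, of b] sm1[OF y] by (metis minus_equality minus_minus)
          then have "s (inverse b) (s (-1) y) = x"
            using \<open>b \<noteq> 0\<close> x by (simp flip: s_mult add: s_one)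
          then show False
            using gs[OF gs[OF *(2)]] nx by metis
        qed
        then have "y = \<zero>" using *(1) y s0[OF x] by simp
        then show ?thesis using *(2) g0 by simp
      qed
    qed
    then have "g' = g" using max sub by blast
    moreover have "(x, 0) \<in> g'"
      using g00 x unfolding g'_def by (auto simp: s_one intro!: exI[of _ \<zero>] exI[of _ 1])
    ultimately show False using nx by auto
  qed
  define \<mu> where "\<mu> x = (THE c. (x, c) \<in> g)" for x
  have \<mu>: "(x, \<mu> x) \<in> g" if "x \<in> carrier G" for x
    unfolding \<mu>_def by (rule theI') (use total[OF that] uniq in blast)
  show ?thesis
  proof (intro exI[of _ \<mu>] conjI ballI allI)
    show "\<mu> (x \<oplus> y) = \<mu> x + \<mu> y" if "x \<in> carrier G" "y \<in> carrier G" for x y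
      using uniq[OF \<mu>[of "x \<oplus> y"] ga[OF \<mu> \<mu>]] that by auto
    show "\<mu> (s c x) = c * \<mu> x" if "x \<in> carrier G" for x c
      using uniq[OF \<mu>[of "s c x"] gs[OF \<mu>]] that s_closed by auto
    show "\<mu> u = f u" if "u \<in> U" for u
      using uniq[OF \<mu> gU] that U by auto
  qed
qed

text \<open>Elements with the same image under \<open>p\<close> differ by an element of its kernel,
  so \<open>q\<close> descends along the surjection. Used to push right multiplication by \<nu> down
  to the top, and to compare a simple module with the top.\<close>

lemma mod_hom_factor:
  assumes "left_module R P" "left_module R T" "left_module R N"
    and p: "p \<in> mod_hom R P T" "p ` carrier P = carrier T" and q: "q \<in> mod_hom R P N"
    and ker: "\<And>x. x \<in> carrier P \<Longrightarrow> p x = \<zero>\<^bsub>T\<^esub> \<Longrightarrow> q x = \<zero>\<^bsub>N\<^esub>"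
  shows "\<exists>h\<in>mod_hom R T N. \<forall>x\<in>carrier P. h (p x) = q x"
proof -
  interpret P: left_module R P by fact
  interpret T: left_module R T by fact
  interpret N: left_module R N by fact
  note hp = mod_homD[OF p(1)] and hq = mod_homD[OF q]
  have eq: "q x = q y" if xy: "x \<in> carrier P" "y \<in> carrier P" "p x = p y" for x y
  proof -
    have "p (x \<oplus>\<^bsub>P\<^esub> \<ominus>\<^bsub>P\<^esub> y) = \<zero>\<^bsub>T\<^esub>"
      using xy hp mod_hom_minus[OF assms(1,2) p(1)] by (simp add: T.M.r_neg)
    then have "q x \<oplus>\<^bsub>N\<^esub> \<ominus>\<^bsub>N\<^esub> q y = \<zero>\<^bsub>N\<^esub>"
      using xy ker[of "x \<oplus>\<^bsub>P\<^esub> \<ominus>\<^bsub>P\<^esub> y"] hq mod_hom_minus[OF assms(1,3) q] by simp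
    then show ?thesis
      using xy hq by (metis N.M.minus_equality N.M.minus_minus N.M.a_inv_closed)
  qed
  define h where "h t = q (inv_into (carrier P) p t)" for t
  have h: "h (p x) = q x" if "x \<in> carrier P" for x
    unfolding h_def using that by (intro eq) (auto intro: inv_into_into f_inv_into_f)
  have "h \<in> mod_hom R T N"
  proof (rule mod_homI, goal_cases)
    case (1 t)
    then obtain x where "x \<in> carrier P" "t = p x"
      using p(2) by blast
    then show ?case using h hq by auto
  next
    case (2 t t')
    then obtain x y where "x \<in> carrier P" "y \<in> carrier P" "t = p x" "t' = p y"
      using p(2) by blast
    then show ?case using h[of x] h[of y] h[of "x \<oplus>\<^bsub>P\<^esub> y"] hp hq by auto
  next
    case (3 r t)
    then obtain x where "x \<in> carrier P" "t = p x"
      using p(2) by blast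
    then show ?case using h[of x] h[of "r \<odot>\<^bsub>P\<^esub> x"] 3 hp hq P.smult_closed by auto
  qed
  with h show ?thesis by blast
qed

section \<open>Cyclic modules generated by an idempotent\<close>

text \<open>The last assumption says that \<open>M\<close> is isomorphic to the left ideal generated by \<open>\<epsilon>\<close>.\<close>

locale idempotent_module = left_module R M
  for R :: "('r, 'x) ring_scheme" and M :: "('r, 'm) module" (structure) +
  fixes \<epsilon> :: 'r and m :: 'm
  assumes eps_closed: "\<epsilon> \<in> carrier R" and m_in: "m \<in> carrier M"
    and eps_m: "\<epsilon> \<odot> m = m"
    and generated: "x \<in> carrier M \<Longrightarrow> \<exists>r\<in>carrier R. x = r \<odot> m"
    and annihilator: "r \<in> carrier R \<Longrightarrow> r \<odot> m = \<zero> \<Longrightarrow> r \<otimes>\<^bsub>R\<^esub> \<epsilon> = \<zero>\<^bsub>R\<^esub>"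
begin

text \<open>Hom(A\<epsilon>, N) is \<epsilon>N: if \<open>r\<close> and \<open>s\<close> agree on
  \<open>m\<close>, their difference \<open>d\<close> satisfies d\<epsilon> = 0 and hence kills
  \<open>n\<close>, which equals \<epsilon>n.\<close>

lemma hom_from:
  assumes "left_module R N" "n \<in> carrier N" "\<epsilon> \<odot>\<^bsub>N\<^esub> n = n"
  shows "\<exists>h\<in>mod_hom R M N. \<forall>r\<in>carrier R. h (r \<odot> m) = r \<odot>\<^bsub>N\<^esub> n"
proof -
  interpret N: left_module R N by fact
  have eq: "r \<odot>\<^bsub>N\<^esub> n = s \<odot>\<^bsub>N\<^esub> n" if rs: "r \<in> carrier R" "s \<in> carrier R" "r \<odot> m = s \<odot> m" for r s
  proof -
    define d where "d = r \<oplus>\<^bsub>R\<^esub> \<ominus>\<^bsub>R\<^esub> s"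
    have d: "d \<in> carrier R" "r = d \<oplus>\<^bsub>R\<^esub> s"
      using rs unfolding d_def by (auto simp: R.a_assoc R.l_neg)
    have "d \<odot> m = \<zero>"
      using rs m_in unfolding d_def
      by (simp add: smult_l_distr smult_minus_l smult_closed M.r_neg)
    then have "d \<otimes>\<^bsub>R\<^esub> \<epsilon> = \<zero>\<^bsub>R\<^esub>" using annihilator d by simp
    then have "d \<odot>\<^bsub>N\<^esub> n = \<zero>\<^bsub>N\<^esub>"
      using N.smult_assoc[of d \<epsilon> n] assms eps_closed d N.smult_zero_l by simp
    then show ?thesis
      using d rs assms by (simp add: N.smult_l_distr N.smult_closed)
  qed
  define h where "h x = (SOME r. r \<in> carrier R \<and> x = r \<odot> m) \<odot>\<^bsub>N\<^esub> n" for x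
  have h: "h (r \<odot> m) = r \<odot>\<^bsub>N\<^esub> n" if "r \<in> carrier R" for r
  proof -
    define s where "s = (SOME s. s \<in> carrier R \<and> r \<odot> m = s \<odot> m)"
    have "s \<in> carrier R \<and> r \<odot> m = s \<odot> m"
      unfolding s_def by (rule someI[of _ r]) (simp add: that)
    then show ?thesis
      using eq[of s r] that unfolding h_def s_def by auto
  qed
  have "h \<in> mod_hom R M N"
  proof (rule mod_homI, goal_cases)
    case (1 x)
    then show ?case using generated[of x] h assms(2) N.smult_closed by auto
  next
    case (2 x y)
    then obtain r s where rs: "r \<in> carrier R" "s \<in> carrier R" "x = r \<odot> m" "y = s \<odot> m"
      using generated[of x] generated[of y] by auto
    then have "x \<oplus> y = (r \<oplus>\<^bsub>R\<^esub> s) \<odot> m" using m_in smult_l_distr by simp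
    then show ?case using rs h[of r] h[of s] h[of "r \<oplus>\<^bsub>R\<^esub> s"] assms(2) N.smult_l_distr by simp
  next
    case (3 r x)
    then obtain s where s: "s \<in> carrier R" "x = s \<odot> m"
      using generated[of x] by auto
    then have "r \<odot> x = (r \<otimes>\<^bsub>R\<^esub> s) \<odot> m" using 3 m_in smult_assoc by simp
    then show ?case using s 3 h[of s] h[of "r \<otimes>\<^bsub>R\<^esub> s"] assms(2) N.smult_assoc by simp
  qed
  with h show ?thesis by blast
qed

lemma hom_from_gen:
  assumes "h \<in> mod_hom R M N" "r \<in> carrier R"
  shows "h (r \<odot> m) = r \<odot>\<^bsub>N\<^esub> h m"
  using assms m_in mod_homD(3) by metis

lemma projective: "projective_module TYPE('p) TYPE('q) R M"
  unfolding projective_module_def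
proof (intro conjI allI impI; (elim conjE)?)
  show "left_module R M" by (rule left_module_axioms)
next
  fix N :: "('r, 'p) module" and N' :: "('r, 'q) module" and g h
  assume N: "left_module R N" "left_module R N'" and g: "g \<in> mod_hom R N N'"
    "g ` carrier N = carrier N'" and h: "h \<in> mod_hom R M N'"
  interpret N: left_module R N by fact
  interpret N': left_module R N' by fact
  have "h m \<in> carrier N'" using h m_in mod_homD(1) by metis
  then obtain n where n: "n \<in> carrier N" "g n = h m" using g(2) by (metis imageE)
  \<comment> \<open>The preimage is moved into \<epsilon>N; its image \<open>h m\<close> does not
    change, being fixed by \<epsilon>.\<close>
  have en: "\<epsilon> \<odot>\<^bsub>N\<^esub> n \<in> carrier N" using n eps_closed N.smult_closed by simp
  have hm: "\<epsilon> \<odot>\<^bsub>N'\<^esub> h m = h m"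
    using mod_homD(3)[OF h eps_closed m_in] eps_m by simp
  \<comment> \<open>Idempotency comes from \<open>annihilator\<close>, because \<epsilon> - 1 kills
    \<open>m\<close>.\<close>
  have idem: "\<epsilon> \<otimes>\<^bsub>R\<^esub> \<epsilon> = \<epsilon>"
  proof -
    have "(\<epsilon> \<oplus>\<^bsub>R\<^esub> \<ominus>\<^bsub>R\<^esub> \<one>\<^bsub>R\<^esub>) \<odot> m = \<zero>"
      using m_in eps_closed eps_m by (simp add: smult_l_distr smult_minus_l smult_one M.r_neg)
    then have "(\<epsilon> \<oplus>\<^bsub>R\<^esub> \<ominus>\<^bsub>R\<^esub> \<one>\<^bsub>R\<^esub>) \<otimes>\<^bsub>R\<^esub> \<epsilon> = \<zero>\<^bsub>R\<^esub>"
      using annihilator eps_closed by simp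
    then have "\<epsilon> \<otimes>\<^bsub>R\<^esub> \<epsilon> \<oplus>\<^bsub>R\<^esub> \<ominus>\<^bsub>R\<^esub> \<epsilon> = \<zero>\<^bsub>R\<^esub>"
      using eps_closed by (simp add: R.l_distr R.l_minus)
    then show ?thesis
      using eps_closed by (metis R.minus_equality R.minus_minus R.a_inv_closed R.m_closed)
  qed
  then have "\<epsilon> \<odot>\<^bsub>N\<^esub> (\<epsilon> \<odot>\<^bsub>N\<^esub> n) = \<epsilon> \<odot>\<^bsub>N\<^esub> n"
    using N.smult_assoc[of \<epsilon> \<epsilon> n] n eps_closed by simp
  from hom_from[OF N(1) en this] obtain k where k: "k \<in> mod_hom R M N"
    "\<And>r. r \<in> carrier R \<Longrightarrow> k (r \<odot> m) = r \<odot>\<^bsub>N\<^esub> (\<epsilon> \<odot>\<^bsub>N\<^esub> n)" by blast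
  have "g (k x) = h x" if x: "x \<in> carrier M" for x
  proof -
    obtain r where r: "r \<in> carrier R" "x = r \<odot> m" using generated[OF x] by blast
    have "g (k x) = r \<odot>\<^bsub>N'\<^esub> (\<epsilon> \<odot>\<^bsub>N'\<^esub> g n)"
      using r k(2) mod_homD(3)[OF g(1)] en n eps_closed by simp
    then show ?thesis using n(2) hm hom_from_gen[OF h r(1)] r by simp
  qed
  with k(1) show "\<exists>k\<in>mod_hom R M N. \<forall>x\<in>carrier M. g (k x) = h x" by blast
qed

end

section \<open>Algebras over a field and Frobenius corners\<close>

text \<open>A ring with a field mapped to its centre. Every module over the ring is then a vector
  space through \<open>sc\<close>, without further structure.\<close>

locale k_algebra = ring R for R (structure) +
  fixes sc :: "'k::field \<Rightarrow> 'a"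
  assumes sc_closed [simp]: "sc c \<in> carrier R"
    and sc_add: "sc (c + d) = sc c \<oplus> sc d"
    and sc_mult: "sc (c * d) = sc c \<otimes> sc d"
    and sc_one: "sc 1 = \<one>"
    and sc_central: "x \<in> carrier R \<Longrightarrow> x \<otimes> sc c = sc c \<otimes> x"
begin

lemma sc_zero: "sc 0 = \<zero>"
  using sc_add[of 0 0] by (metis add.l_cancel_one' add.left_neutral sc_closed)

lemma sc_minus: "sc (- c) = \<ominus> sc c"
  using sc_add[of "- c" c] by (simp add: sc_zero minus_equality)

lemma sc_left_commute:
  "x \<in> carrier R \<Longrightarrow> y \<in> carrier R \<Longrightarrow> x \<otimes> (sc c \<otimes> y) = sc c \<otimes> (x \<otimes> y)"
  by (metis m_assoc sc_central sc_closed)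

lemma sc_sc: "x \<in> carrier R \<Longrightarrow> sc c \<otimes> (sc d \<otimes> x) = sc (c * d) \<otimes> x"
  by (simp add: sc_mult m_assoc)

lemma sc_eq_zero:
  assumes "x \<in> carrier R" "sc c \<otimes> x = \<zero>" "x \<noteq> \<zero>"
  shows "c = 0"
proof (rule ccontr)
  assume "c \<noteq> 0"
  then have "sc (inverse c) \<otimes> (sc c \<otimes> x) = x"
    using assms(1) by (simp add: sc_sc sc_one)
  then show False using assms(2,3) by simp
qed

end

text \<open>The corner \<epsilon>R\<epsilon> is the algebra of dual numbers, spanned by \<epsilon>
  and \<nu>. The families \<open>c\<close> and \<open>p\<close> express all elements of \<epsilon>R
  and R\<epsilon> and are dual for the form that reads off the coefficient of \<nu>; multiples of
  \<epsilon> in the products are allowed because the form ignores them.\<close>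

locale frobenius_module = k_algebra R sc + idempotent_module R M \<epsilon> m
  for R :: "('r, 'x) ring_scheme" and sc :: "'k::field \<Rightarrow> 'r"
    and M :: "('r, 'm) module" (structure) and \<epsilon> :: 'r and m :: 'm +
  fixes \<nu> :: 'r and J :: "'j set" and c p :: "'j \<Rightarrow> 'r"
  assumes nu_closed: "\<nu> \<in> carrier R" and nu_nz: "\<nu> \<noteq> \<zero>\<^bsub>R\<^esub>"
    and eps_nu: "\<epsilon> \<otimes>\<^bsub>R\<^esub> \<nu> = \<nu>" and nu_eps: "\<nu> \<otimes>\<^bsub>R\<^esub> \<epsilon> = \<nu>"
    and nu_nu: "\<nu> \<otimes>\<^bsub>R\<^esub> \<nu> = \<zero>\<^bsub>R\<^esub>"
    and corner: "r \<in> carrier R \<Longrightarrow>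
      \<exists>a b. \<epsilon> \<otimes>\<^bsub>R\<^esub> r \<otimes>\<^bsub>R\<^esub> \<epsilon> = sc a \<otimes>\<^bsub>R\<^esub> \<epsilon> \<oplus>\<^bsub>R\<^esub> sc b \<otimes>\<^bsub>R\<^esub> \<nu>"
    and finite_J: "finite J"
    and c_closed: "j \<in> J \<Longrightarrow> c j \<in> carrier R"
    and p_closed: "j \<in> J \<Longrightarrow> p j \<in> carrier R"
    and c_span: "r \<in> carrier R \<Longrightarrow> \<exists>\<theta>. \<epsilon> \<otimes>\<^bsub>R\<^esub> r = finsum R (\<lambda>j. sc (\<theta> j) \<otimes>\<^bsub>R\<^esub> c j) J"
    and p_span: "r \<in> carrier R \<Longrightarrow> \<exists>\<theta>. r \<otimes>\<^bsub>R\<^esub> \<epsilon> = finsum R (\<lambda>j. sc (\<theta> j) \<otimes>\<^bsub>R\<^esub> p j) J"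
    and dual: "i \<in> J \<Longrightarrow> j \<in> J \<Longrightarrow> \<exists>\<kappa>. c i \<otimes>\<^bsub>R\<^esub> p j =
      sc (if i = j then 1 else 0) \<otimes>\<^bsub>R\<^esub> \<nu> \<oplus>\<^bsub>R\<^esub> sc \<kappa> \<otimes>\<^bsub>R\<^esub> \<epsilon>"
begin

abbreviation act (infixr "\<bullet>" 75) where "r \<bullet> x \<equiv> r \<odot> x"

lemmas act_simps = smult_assoc smult_closed eps_closed nu_closed m_in

lemma sc_act_commute: "r \<in> carrier R \<Longrightarrow> x \<in> carrier M \<Longrightarrow> r \<bullet> sc a \<bullet> x = sc a \<bullet> r \<bullet> x"
  by (metis sc_central sc_closed smult_assoc)

lemma sc_act_sc: "x \<in> carrier M \<Longrightarrow> sc a \<bullet> sc b \<bullet> x = sc (a * b) \<bullet> x"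
  by (simp add: sc_mult smult_assoc)

lemma nu_nu_m: "\<nu> \<bullet> \<nu> \<bullet> m = \<zero>"
  using smult_assoc[of \<nu> \<nu> m] nu_closed m_in nu_nu smult_zero_l by simp

lemma eps_nu_m: "\<epsilon> \<bullet> \<nu> \<bullet> m = \<nu> \<bullet> m"
  using smult_assoc[of \<epsilon> \<nu> m] nu_closed m_in eps_closed eps_nu by simp

lemma nu_m_closed: "\<nu> \<bullet> m \<in> carrier M"
  by (simp add: act_simps)

lemma nu_m_nz: "\<nu> \<bullet> m \<noteq> \<zero>"
  using annihilator[of \<nu>] nu_closed nu_eps nu_nz by auto

text \<open>Since \<nu> squares to zero, applying it leaves a multiple of the nonzero vector
  \<open>\<nu> \<bullet> m\<close>; so the first coefficient vanishes, and then the second.\<close>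

lemma indep:
  assumes "sc a \<bullet> m \<oplus> sc b \<bullet> \<nu> \<bullet> m = \<zero>"
  shows "a = 0" "b = 0"
proof -
  have "\<nu> \<bullet> (sc a \<bullet> m \<oplus> sc b \<bullet> \<nu> \<bullet> m) = sc a \<bullet> \<nu> \<bullet> m"
    using nu_nu_m nu_m_closed m_in nu_closed
    by (simp add: smult_r_distr smult_closed sc_act_commute smult_zero_r)
  then have a: "(sc a \<otimes>\<^bsub>R\<^esub> \<nu>) \<bullet> m = \<zero>"
    using assms nu_closed m_in by (simp add: smult_assoc smult_zero_r)
  show "a = 0"
    using annihilator[OF _ a] nu_closed nu_eps nu_nz eps_closed sc_eq_zero by (simp add: m_assoc)
  then have b: "(sc b \<otimes>\<^bsub>R\<^esub> \<nu>) \<bullet> m = \<zero>"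
    using assms nu_closed m_in nu_m_closed by (simp add: smult_assoc smult_zero_l sc_zero smult_closed)
  show "b = 0"
    using annihilator[OF _ b] nu_closed nu_eps nu_nz eps_closed sc_eq_zero by (simp add: m_assoc)
qed

text \<open>Stated for any module, since it is applied to \<open>m\<close>, to the vector
  \<open>\<nu> \<bullet> m\<close> and to the generator of the simple top.\<close>

lemma corner_m:
  assumes "r \<in> carrier R" "\<epsilon> \<otimes>\<^bsub>R\<^esub> r \<otimes>\<^bsub>R\<^esub> \<epsilon> = sc a \<otimes>\<^bsub>R\<^esub> \<epsilon> \<oplus>\<^bsub>R\<^esub> sc b \<otimes>\<^bsub>R\<^esub> \<nu>"
    and "left_module R N" "n \<in> carrier N" "\<epsilon> \<odot>\<^bsub>N\<^esub> n = n"
  shows "\<epsilon> \<odot>\<^bsub>N\<^esub> (r \<odot>\<^bsub>N\<^esub> n) = sc a \<odot>\<^bsub>N\<^esub> n \<oplus>\<^bsub>N\<^esub> sc b \<odot>\<^bsub>N\<^esub> (\<nu> \<odot>\<^bsub>N\<^esub> n)"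
proof -
  interpret N: left_module R N by fact
  have "(\<epsilon> \<otimes>\<^bsub>R\<^esub> r \<otimes>\<^bsub>R\<^esub> \<epsilon>) \<odot>\<^bsub>N\<^esub> n = \<epsilon> \<odot>\<^bsub>N\<^esub> (r \<odot>\<^bsub>N\<^esub> n)"
    using assms(1,3-5) eps_closed by (simp add: N.smult_assoc N.smult_closed)
  moreover have "(sc a \<otimes>\<^bsub>R\<^esub> \<epsilon> \<oplus>\<^bsub>R\<^esub> sc b \<otimes>\<^bsub>R\<^esub> \<nu>) \<odot>\<^bsub>N\<^esub> n =
      sc a \<odot>\<^bsub>N\<^esub> n \<oplus>\<^bsub>N\<^esub> sc b \<odot>\<^bsub>N\<^esub> (\<nu> \<odot>\<^bsub>N\<^esub> n)"
    using assms eps_closed nu_closed by (simp add: N.smult_l_distr N.smult_assoc)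
  ultimately show ?thesis using assms(2) by simp
qed

lemma eps_act_ex:
  assumes "x \<in> carrier M"
  shows "\<exists>a b. \<epsilon> \<bullet> x = sc a \<bullet> m \<oplus> sc b \<bullet> \<nu> \<bullet> m"
proof -
  obtain r where r: "r \<in> carrier R" "x = r \<bullet> m" using generated[OF assms] by blast
  show ?thesis
    using corner[OF r(1)] corner_m[OF r(1) _ left_module_axioms m_in eps_m] r(2) by metis
qed

text \<open>The Frobenius form on R\<epsilon>, defined on all of \<open>M\<close> by projecting with
  \<epsilon>. Uniqueness of the value is \<open>indep\<close>.\<close>

definition coef :: "'m \<Rightarrow> 'k" where
  "coef x = (THE b. \<exists>a. \<epsilon> \<bullet> x = sc a \<bullet> m \<oplus> sc b \<bullet> \<nu> \<bullet> m)"

lemma coefI: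
  assumes "\<epsilon> \<bullet> x = sc a \<bullet> m \<oplus> sc b \<bullet> \<nu> \<bullet> m"
  shows "coef x = b"
  unfolding coef_def
proof (rule the_equality)
  fix d assume "\<exists>a. \<epsilon> \<bullet> x = sc a \<bullet> m \<oplus> sc d \<bullet> \<nu> \<bullet> m"
  then obtain e where e: "\<epsilon> \<bullet> x = sc e \<bullet> m \<oplus> sc d \<bullet> \<nu> \<bullet> m" ..
  have cl: "sc q \<bullet> m \<in> carrier M" "sc q \<bullet> \<nu> \<bullet> m \<in> carrier M" for q
    using m_in nu_m_closed by (simp_all add: smult_closed)
  have "sc (a - e) \<bullet> m \<oplus> sc (b - d) \<bullet> \<nu> \<bullet> m =
      (sc a \<bullet> m \<oplus> sc b \<bullet> \<nu> \<bullet> m) \<oplus> \<ominus> (sc e \<bullet> m \<oplus> sc d \<bullet> \<nu> \<bullet> m)"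
    using cl m_in nu_m_closed
    by (simp add: diff_conv_add_uminus sc_add sc_minus smult_l_distr smult_minus_l M.minus_add
        M.a_assoc M.a_lcomm del: add_uminus_conv_diff)
  also have "\<dots> = \<zero>"
    using e assms cl by (simp add: M.r_neg)
  finally show "d = b" using indep(2) by fastforce
qed (use assms in blast)

lemma coef_closed_form:
  assumes "x \<in> carrier M"
  shows "\<exists>a. \<epsilon> \<bullet> x = sc a \<bullet> m \<oplus> sc (coef x) \<bullet> \<nu> \<bullet> m"
  using eps_act_ex[OF assms] coefI by metis

lemma coef_add:
  assumes "x \<in> carrier M" "y \<in> carrier M"
  shows "coef (x \<oplus> y) = coef x + coef y"
proof -
  obtain a b where ab: "\<epsilon> \<bullet> x = sc a \<bullet> m \<oplus> sc (coef x) \<bullet> \<nu> \<bullet> m"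
    "\<epsilon> \<bullet> y = sc b \<bullet> m \<oplus> sc (coef y) \<bullet> \<nu> \<bullet> m"
    using coef_closed_form assms by meson
  have "\<epsilon> \<bullet> (x \<oplus> y) = sc (a + b) \<bullet> m \<oplus> sc (coef x + coef y) \<bullet> \<nu> \<bullet> m"
    using assms m_in nu_m_closed
    by (simp add: smult_r_distr eps_closed ab sc_add smult_l_distr smult_closed M.a_ac)
  then show ?thesis by (rule coefI)
qed

lemma coef_sc:
  assumes "x \<in> carrier M"
  shows "coef (sc d \<bullet> x) = d * coef x"
proof -
  obtain a where a: "\<epsilon> \<bullet> x = sc a \<bullet> m \<oplus> sc (coef x) \<bullet> \<nu> \<bullet> m"
    using coef_closed_form assms by meson
  have "\<epsilon> \<bullet> sc d \<bullet> x = sc (d * a) \<bullet> m \<oplus> sc (d * coef x) \<bullet> \<nu> \<bullet> m"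
    using assms m_in nu_m_closed
    by (simp add: sc_act_commute[OF eps_closed] a smult_r_distr smult_closed sc_act_sc)
  then show ?thesis by (rule coefI)
qed

lemma coef_zero: "coef \<zero> = 0"
  using coef_sc[of "\<zero>" 0] smult_zero_r by simp

lemma coef_finsum: "finite A \<Longrightarrow> f \<in> A \<rightarrow> carrier M \<Longrightarrow> coef (finsum M f A) = (\<Sum>j\<in>A. coef (f j))"
  by (induction A rule: finite_induct) (auto simp: coef_zero coef_add Pi_iff)

lemma coef_eps:
  assumes "x \<in> carrier M"
  shows "coef (\<epsilon> \<bullet> x) = coef x"
proof -
  obtain a where a: "\<epsilon> \<bullet> x = sc a \<bullet> m \<oplus> sc (coef x) \<bullet> \<nu> \<bullet> m"
    using coef_closed_form assms by meson
  have "\<epsilon> \<bullet> \<epsilon> \<bullet> x = sc a \<bullet> m \<oplus> sc (coef x) \<bullet> \<nu> \<bullet> m"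
    using m_in nu_m_closed unfolding a
    by (simp add: sc_act_commute eps_closed smult_r_distr smult_closed eps_m eps_nu_m)
  then show ?thesis by (rule coefI)
qed

lemma coef_dual:
  assumes "i \<in> J" "j \<in> J"
  shows "coef (c i \<bullet> p j \<bullet> m) = (if i = j then 1 else 0)"
proof -
  obtain \<kappa> where \<kappa>: "c i \<otimes>\<^bsub>R\<^esub> p j = sc (if i = j then 1 else 0) \<otimes>\<^bsub>R\<^esub> \<nu> \<oplus>\<^bsub>R\<^esub> sc \<kappa> \<otimes>\<^bsub>R\<^esub> \<epsilon>"
    using dual[OF assms] by blast
  have "c i \<bullet> p j \<bullet> m = (c i \<otimes>\<^bsub>R\<^esub> p j) \<bullet> m"
    using assms c_closed p_closed m_in by (simp add: smult_assoc)
  also have "\<dots> = sc \<kappa> \<bullet> m \<oplus> sc (if i = j then 1 else 0) \<bullet> \<nu> \<bullet> m"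
    unfolding \<kappa> using m_in nu_closed eps_closed
    by (simp add: smult_l_distr smult_assoc eps_m smult_closed M.a_comm)
  finally have *: "c i \<bullet> p j \<bullet> m = sc \<kappa> \<bullet> m \<oplus> sc (if i = j then 1 else 0) \<bullet> \<nu> \<bullet> m" .
  have "\<epsilon> \<bullet> c i \<bullet> p j \<bullet> m = sc \<kappa> \<bullet> m \<oplus> sc (if i = j then 1 else 0) \<bullet> \<nu> \<bullet> m"
    unfolding * using m_in nu_m_closed
    by (simp only: smult_r_distr sc_act_commute eps_closed smult_closed sc_closed eps_m eps_nu_m)
  then show ?thesis by (rule coefI)
qed

lemma p_m_closed: "j \<in> J \<Longrightarrow> p j \<bullet> m \<in> carrier M"
  using p_closed m_in smult_closed by simp

lemma coef_combination:
  assumes i: "i \<in> J"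
  shows "coef (c i \<bullet> finsum M (\<lambda>j. sc (\<theta> j) \<bullet> p j \<bullet> m) J) = \<theta> i"
proof -
  have "c i \<bullet> finsum M (\<lambda>j. sc (\<theta> j) \<bullet> p j \<bullet> m) J = finsum M (\<lambda>j. c i \<bullet> sc (\<theta> j) \<bullet> p j \<bullet> m) J"
    using p_m_closed i c_closed finite_J by (intro smult_finsum) (auto simp: smult_closed)
  then have "coef (c i \<bullet> finsum M (\<lambda>j. sc (\<theta> j) \<bullet> p j \<bullet> m) J) =
      (\<Sum>j\<in>J. coef (c i \<bullet> sc (\<theta> j) \<bullet> p j \<bullet> m))"
    using coef_finsum[OF finite_J] p_m_closed i c_closed by (simp add: smult_closed Pi_iff)
  also have "\<dots> = (\<Sum>j\<in>J. if j = i then \<theta> j else 0)"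
    using p_m_closed i c_closed
    by (intro sum.cong) (auto simp: sc_act_commute coef_sc smult_closed coef_dual)
  finally show ?thesis using i finite_J by simp
qed

text \<open>When \<open>x\<close> is expanded along the vectors \<open>p j \<bullet> m\<close>,
  duality makes the coefficient at \<open>i\<close> equal to
  \<open>coef (c i \<bullet> x)\<close>.\<close>

lemma nondegenerate:
  assumes "x \<in> carrier M" and zero: "\<And>r. r \<in> carrier R \<Longrightarrow> coef (r \<bullet> x) = 0"
  shows "x = \<zero>"
proof -
  obtain r where r: "r \<in> carrier R" "x = r \<bullet> m" using generated[OF assms(1)] by blast
  obtain \<theta> where \<theta>: "r \<otimes>\<^bsub>R\<^esub> \<epsilon> = finsum R (\<lambda>j. sc (\<theta> j) \<otimes>\<^bsub>R\<^esub> p j) J"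
    using p_span[OF r(1)] by blast
  have "x = (r \<otimes>\<^bsub>R\<^esub> \<epsilon>) \<bullet> m"
    using r m_in eps_closed by (simp add: smult_assoc eps_m)
  also have "\<dots> = finsum M (\<lambda>j. sc (\<theta> j) \<bullet> p j \<bullet> m) J"
    unfolding \<theta> using p_closed m_in finite_J by (intro finsum_mult_smult) auto
  finally have x: "x = finsum M (\<lambda>j. sc (\<theta> j) \<bullet> p j \<bullet> m) J" .
  have "\<theta> i = 0" if "i \<in> J" for i
    using coef_combination[OF that, of \<theta>] zero[of "c i"] that c_closed by (simp flip: x)
  then have "x = finsum M (\<lambda>j. \<zero>) J"
    unfolding x using p_m_closed by (intro M.finsum_cong') (auto simp: sc_zero smult_zero_l)
  then show ?thesis by simp
qed

text \<open>Composition with \<open>coef\<close> identifies homomorphisms from N' to M with linear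
  functionals on \<epsilon>N', because \<open>M\<close> is the dual of \<epsilon>R. Extending a
  homomorphism thus becomes extending a functional.\<close>

theorem injective: "injective_module TYPE('p) TYPE('q) R M"
  unfolding injective_module_def
proof (intro conjI allI impI; (elim conjE)?)
  show "left_module R M" by (rule left_module_axioms)
next
  fix N :: "('r, 'p) module" and N' :: "('r, 'q) module" and g h
  assume N: "left_module R N" "left_module R N'" and g: "g \<in> mod_hom R N N'"
    "inj_on g (carrier N)" and h: "h \<in> mod_hom R N M"
  interpret N: left_module R N by fact
  interpret N': left_module R N' by fact
  note hg = mod_homD[OF g(1)] and hh = mod_homD[OF h]
  \<comment> \<open>The functional of \<open>h\<close>, transported to the image of the injection
    \<open>g\<close>.\<close>
  define f where "f u = coef (h (inv_into (carrier N) g u))" for u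
  have f: "f (g x) = coef (h x)" if "x \<in> carrier N" for x
    using that g(2) unfolding f_def by simp
  have sub: "submodule (g ` carrier N) R N'"
    by (rule mod_hom_image_submodule[OF N g(1)])
  have "\<exists>\<mu>. (\<forall>x\<in>carrier N'. \<forall>y\<in>carrier N'. \<mu> (x \<oplus>\<^bsub>N'\<^esub> y) = \<mu> x + \<mu> y) \<and>
    (\<forall>d. \<forall>x\<in>carrier N'. \<mu> (sc d \<odot>\<^bsub>N'\<^esub> x) = d * \<mu> x) \<and> (\<forall>u\<in>g ` carrier N. \<mu> u = f u)"
  proof (rule N'.M.linear_functional_extension, goal_cases)
    case (10 x y)
    then show ?case using f hh hg coef_add by (auto simp flip: hg(2))
  next
    case (11 d x)
    then show ?case using f hh hg coef_sc N.smult_closed by (auto simp flip: hg(3))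
  qed (use N'.submoduleD[OF sub] in \<open>simp_all add: N'.smult_closed N'.smult_l_distr
      N'.smult_r_distr N'.smult_assoc N'.smult_one sc_add sc_mult sc_one\<close>)
  then obtain \<mu> where
    mu_add: "\<And>x y. x \<in> carrier N' \<Longrightarrow> y \<in> carrier N' \<Longrightarrow> \<mu> (x \<oplus>\<^bsub>N'\<^esub> y) = \<mu> x + \<mu> y"
    and mu_sc: "\<And>d x. x \<in> carrier N' \<Longrightarrow> \<mu> (sc d \<odot>\<^bsub>N'\<^esub> x) = d * \<mu> x"
    and mu_f: "\<And>x. x \<in> carrier N \<Longrightarrow> \<mu> (g x) = coef (h x)"
    using f by (metis (no_types, lifting) imageI)
  have mu_zero: "\<mu> \<zero>\<^bsub>N'\<^esub> = 0"
    using mu_sc[of "\<zero>\<^bsub>N'\<^esub>" 0] N'.smult_zero_r by simp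
  have mu_finsum: "\<mu> (finsum N' F A) = (\<Sum>j\<in>A. \<mu> (F j))" if "finite A" "F \<in> A \<rightarrow> carrier N'" for F and A :: "'j set"
    using that by (induction A rule: finite_induct) (auto simp: mu_zero mu_add Pi_iff)
  \<comment> \<open>The dual bases force this formula: the coefficient at
    \<open>p j \<bullet> m\<close> must be the value of the functional at \<open>c j\<close> applied
    to \<open>y\<close>.\<close>
  define k where "k y = finsum M (\<lambda>j. sc (\<mu> (c j \<odot>\<^bsub>N'\<^esub> y)) \<bullet> p j \<bullet> m) J" for y
  have k_closed: "k y \<in> carrier M" for y
    unfolding k_def using p_m_closed by (intro M.finsum_closed) (auto simp: smult_closed)
  have ck: "coef (c i \<bullet> k y) = \<mu> (c i \<odot>\<^bsub>N'\<^esub> y)" if "i \<in> J" for i y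
    unfolding k_def using that by (rule coef_combination)
  \<comment> \<open>The \<epsilon> appears because \<mu> is an arbitrary extension, under no
    condition outside the image of \<open>g\<close> except linearity, whereas \<open>coef\<close>
    sees only the \<epsilon>-part.\<close>
  have key: "coef (r \<bullet> k y) = \<mu> (\<epsilon> \<odot>\<^bsub>N'\<^esub> (r \<odot>\<^bsub>N'\<^esub> y))" if r: "r \<in> carrier R" and y: "y \<in> carrier N'" for r y
  proof -
    obtain \<theta> where \<theta>: "\<epsilon> \<otimes>\<^bsub>R\<^esub> r = finsum R (\<lambda>j. sc (\<theta> j) \<otimes>\<^bsub>R\<^esub> c j) J"
      using c_span[OF r(1)] by blast
    have "\<epsilon> \<bullet> r \<bullet> k y = (\<epsilon> \<otimes>\<^bsub>R\<^esub> r) \<bullet> k y"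
      using r k_closed eps_closed by (simp add: smult_assoc)
    also have "\<dots> = finsum M (\<lambda>j. sc (\<theta> j) \<bullet> c j \<bullet> k y) J"
      unfolding \<theta> using c_closed k_closed finite_J by (intro finsum_mult_smult) auto
    finally have M: "\<epsilon> \<bullet> r \<bullet> k y = finsum M (\<lambda>j. sc (\<theta> j) \<bullet> c j \<bullet> k y) J" .
    have "\<epsilon> \<odot>\<^bsub>N'\<^esub> (r \<odot>\<^bsub>N'\<^esub> y) = (\<epsilon> \<otimes>\<^bsub>R\<^esub> r) \<odot>\<^bsub>N'\<^esub> y"
      using r y eps_closed by (simp add: N'.smult_assoc)
    also have "\<dots> = finsum N' (\<lambda>j. sc (\<theta> j) \<odot>\<^bsub>N'\<^esub> (c j \<odot>\<^bsub>N'\<^esub> y)) J"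
      unfolding \<theta> using c_closed y finite_J by (intro N'.finsum_mult_smult) auto
    finally have N': "\<epsilon> \<odot>\<^bsub>N'\<^esub> (r \<odot>\<^bsub>N'\<^esub> y) = finsum N' (\<lambda>j. sc (\<theta> j) \<odot>\<^bsub>N'\<^esub> (c j \<odot>\<^bsub>N'\<^esub> y)) J" .
    have "coef (r \<bullet> k y) = coef (\<epsilon> \<bullet> r \<bullet> k y)"
      using r k_closed by (simp add: coef_eps smult_closed)
    also have "\<dots> = (\<Sum>j\<in>J. \<theta> j * coef (c j \<bullet> k y))"
      unfolding M using c_closed k_closed finite_J
      by (simp add: coef_finsum coef_sc smult_closed Pi_iff)
    also have "\<dots> = (\<Sum>j\<in>J. \<theta> j * \<mu> (c j \<odot>\<^bsub>N'\<^esub> y))"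
      by (intro sum.cong) (auto simp: ck)
    also have "\<dots> = \<mu> (\<epsilon> \<odot>\<^bsub>N'\<^esub> (r \<odot>\<^bsub>N'\<^esub> y))"
      unfolding N' using c_closed y finite_J
      by (simp add: mu_finsum mu_sc N'.smult_closed Pi_iff)
    finally show ?thesis .
  qed
  \<comment> \<open>By nondegeneracy an element \<open>x\<close> of \<open>M\<close> is known from
    the values \<open>coef (r \<bullet> x)\<close>; every remaining identity is checked on
    them.\<close>
  have unique: "x = x'" if "x \<in> carrier M" "x' \<in> carrier M"
    and eq: "\<And>r. r \<in> carrier R \<Longrightarrow> coef (r \<bullet> x) = coef (r \<bullet> x')" for x x'
  proof -
    have "x \<oplus> sc (-1) \<bullet> x' = \<zero>"
    proof (rule nondegenerate)
      fix r assume r: "r \<in> carrier R"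
      show "coef (r \<bullet> (x \<oplus> sc (-1) \<bullet> x')) = 0"
        using that r by (simp add: smult_r_distr smult_closed coef_add sc_act_commute coef_sc)
    qed (use that in \<open>simp add: smult_closed\<close>)
    then show ?thesis
      using that by (simp add: sc_minus sc_one smult_minus_l smult_one)
        (metis M.minus_equality M.minus_minus M.a_inv_closed)
  qed
  have "k \<in> mod_hom R N' M"
  proof (rule mod_homI, goal_cases)
    case (1 x)
    show ?case by (rule k_closed)
  next
    case (2 x y)
    show ?case
    proof (rule unique)
      fix r assume r: "r \<in> carrier R"
      show "coef (r \<bullet> k (x \<oplus>\<^bsub>N'\<^esub> y)) = coef (r \<bullet> (k x \<oplus> k y))"
        using 2 r k_closed eps_closed
        by (simp add: key smult_r_distr N'.smult_r_distr N'.smult_closed smult_closed coef_add mu_add)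
    qed (use k_closed in auto)
  next
    case (3 s x)
    show ?case
    proof (rule unique)
      fix r assume r: "r \<in> carrier R"
      have "coef (r \<bullet> s \<bullet> k x) = coef ((r \<otimes>\<^bsub>R\<^esub> s) \<bullet> k x)"
        using 3 r k_closed by (simp add: smult_assoc)
      then show "coef (r \<bullet> k (s \<odot>\<^bsub>N'\<^esub> x)) = coef (r \<bullet> s \<bullet> k x)"
        using 3 r by (simp add: key N'.smult_assoc N'.smult_closed)
    qed (use k_closed 3 in \<open>auto simp: smult_closed\<close>)
  qed
  moreover have "k (g x) = h x" if x: "x \<in> carrier N" for x
  proof (rule unique)
    fix r assume r: "r \<in> carrier R"
    have "coef (r \<bullet> k (g x)) = \<mu> (g (\<epsilon> \<odot>\<^bsub>N\<^esub> (r \<odot>\<^bsub>N\<^esub> x)))"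
      using x r hg eps_closed by (simp add: key N.smult_closed)
    also have "\<dots> = coef (r \<bullet> h x)"
      using x r hh eps_closed by (simp add: mu_f N.smult_closed coef_eps smult_closed)
    finally show "coef (r \<bullet> k (g x)) = coef (r \<bullet> h x)" .
  qed (use k_closed hh x in auto)
  ultimately show "\<exists>k\<in>mod_hom R N' M. \<forall>x\<in>carrier N. k (g x) = h x" by blast
qed

end

section \<open>Top and socle of a Frobenius module\<close>

locale frobenius_module_top = frobenius_module R sc M \<epsilon> m \<nu> J c p
  for R :: "('r, 'x) ring_scheme" and sc :: "'k::field \<Rightarrow> 'r"
    and M :: "('r, 'm) module" (structure) and \<epsilon> :: 'r and m :: 'm and \<nu> :: 'r
    and J :: "'j set" and c p :: "'j \<Rightarrow> 'r" +
  fixes T :: "('r, 't) module" and t :: 't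
  assumes simple_T: "simple_module R T" and t_in: "t \<in> carrier T"
    and eps_t: "\<epsilon> \<odot>\<^bsub>T\<^esub> t = t" and t_nz: "t \<noteq> \<zero>\<^bsub>T\<^esub>" and nu_t: "\<nu> \<odot>\<^bsub>T\<^esub> t = \<zero>\<^bsub>T\<^esub>"
begin

interpretation T: left_module R T
  using simple_T by (simp add: simple_module_def)

definition top where
  "top = (SOME h. h \<in> mod_hom R M T \<and> (\<forall>r\<in>carrier R. h (r \<bullet> m) = r \<odot>\<^bsub>T\<^esub> t))"

lemma top: "top \<in> mod_hom R M T" "r \<in> carrier R \<Longrightarrow> top (r \<bullet> m) = r \<odot>\<^bsub>T\<^esub> t"
proof -
  have "\<exists>h. h \<in> mod_hom R M T \<and> (\<forall>r\<in>carrier R. h (r \<bullet> m) = r \<odot>\<^bsub>T\<^esub> t)"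
    using hom_from[OF T.left_module_axioms t_in eps_t] by blast
  from someI_ex[OF this] show "top \<in> mod_hom R M T" "r \<in> carrier R \<Longrightarrow> top (r \<bullet> m) = r \<odot>\<^bsub>T\<^esub> t"
    unfolding top_def by blast+
qed

lemma top_m: "top m = t"
  using top(2)[of "\<one>\<^bsub>R\<^esub>"] smult_one[OF m_in] T.smult_one[OF t_in] by simp

lemma top_surj: "top ` carrier M = carrier T"
  using simple_module_image[OF left_module_axioms simple_T top(1) m_in] top_m t_nz by simp

lemma eps_act_T:
  assumes "r \<in> carrier R" "\<epsilon> \<otimes>\<^bsub>R\<^esub> r \<otimes>\<^bsub>R\<^esub> \<epsilon> = sc a \<otimes>\<^bsub>R\<^esub> \<epsilon> \<oplus>\<^bsub>R\<^esub> sc b \<otimes>\<^bsub>R\<^esub> \<nu>"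
  shows "\<epsilon> \<odot>\<^bsub>T\<^esub> (r \<odot>\<^bsub>T\<^esub> t) = sc a \<odot>\<^bsub>T\<^esub> t"
  using corner_m[OF assms T.left_module_axioms t_in eps_t] t_in
  by (simp add: nu_t T.smult_zero_r T.smult_closed)

text \<open>A submodule containing a vector \<open>a m + b \<nu> m\<close> with \<open>a \<noteq> 0\<close> contains \<open>m\<close>, because
  \<open>\<nu>\<close> is nilpotent.\<close>

lemma superfluous_kernel: "superfluous R M (a_kernel M T top)"
  unfolding superfluous_def
proof (intro conjI allI impI; (elim conjE)?)
  show K: "submodule (a_kernel M T top) R M"
    by (rule mod_hom_kernel_submodule[OF left_module_axioms T.left_module_axioms top(1)])
  fix H assume H: "submodule H R M" and HK: "H <+>\<^bsub>M\<^esub> a_kernel M T top = carrier M"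
  note HD = submoduleD[OF H]
  obtain h k where hk: "h \<in> H" "k \<in> carrier M" "top k = \<zero>\<^bsub>T\<^esub>" "m = h \<oplus> k"
    using m_in HK unfolding set_add_def' a_kernel_def' by blast
  have hM: "h \<in> carrier M" using hk HD by auto
  obtain a b where ab: "\<epsilon> \<bullet> h = sc a \<bullet> m \<oplus> sc b \<bullet> \<nu> \<bullet> m"
    using eps_act_ex[OF hM] by blast
  define y where "y = sc a \<bullet> m \<oplus> sc b \<bullet> \<nu> \<bullet> m"
  have yH: "y \<in> H" unfolding y_def ab[symmetric] using HD(4)[OF eps_closed hk(1)] .
  \<comment> \<open>Applying \<open>top\<close> to \<open>m = h \<oplus> k\<close> removes
    \<open>k\<close>, so the \<epsilon>-part of \<open>h\<close> must have a nonzero coefficient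
    \<open>a\<close> at \<open>m\<close>.\<close>
  have "t = top (\<epsilon> \<bullet> m)" by (simp add: eps_m top_m)
  also have "\<dots> = \<epsilon> \<odot>\<^bsub>T\<^esub> top m" by (rule mod_homD(3)[OF top(1) eps_closed m_in])
  also have "\<dots> = \<epsilon> \<odot>\<^bsub>T\<^esub> top h"
    using hk hM mod_homD(1,2)[OF top(1)] by simp
  also have "\<dots> = top y"
    unfolding y_def ab[symmetric] by (rule mod_homD(3)[OF top(1) eps_closed hM, symmetric])
  also have "\<dots> = sc a \<odot>\<^bsub>T\<^esub> t"
    unfolding y_def using m_in nu_m_closed nu_closed t_in
    by (simp add: mod_homD[OF top(1)] smult_closed top_m nu_t T.smult_zero_r T.smult_closed)
  finally have "t = sc a \<odot>\<^bsub>T\<^esub> t" .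
  then have a: "a \<noteq> 0" using t_nz t_in by (metis T.smult_zero_l sc_zero)
  have "\<nu> \<bullet> y = sc a \<bullet> \<nu> \<bullet> m"
    unfolding y_def using m_in nu_m_closed nu_closed nu_nu_m
    by (simp add: smult_r_distr smult_closed sc_act_commute[OF nu_closed] smult_zero_r)
  then have "sc (inverse a) \<bullet> \<nu> \<bullet> y = \<nu> \<bullet> m"
    using a nu_m_closed by (simp add: sc_act_sc sc_one smult_one)
  then have nmH: "\<nu> \<bullet> m \<in> H"
    using HD(4)[OF sc_closed HD(4)[OF nu_closed yH], of "inverse a"] by simp
  have "y \<oplus> sc (- b) \<bullet> \<nu> \<bullet> m = sc a \<bullet> m"
    unfolding y_def using m_in nu_m_closed
    by (simp add: sc_minus smult_minus_l smult_closed M.a_assoc M.r_neg)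
  then have "sc (inverse a) \<bullet> (y \<oplus> sc (- b) \<bullet> \<nu> \<bullet> m) = m"
    using a m_in by (simp add: sc_act_sc sc_one smult_one)
  then have "m \<in> H"
    using HD(4)[OF sc_closed HD(3)[OF yH HD(4)[OF sc_closed nmH]], of "inverse a" "- b"] by simp
  then show "H = carrier M"
    using HD(1,4) generated by blast
qed

theorem projective_cover: "is_projective_cover TYPE('p) TYPE('q) R M T"
  unfolding is_projective_cover_def
  using projective T.left_module_axioms top(1) top_surj superfluous_kernel by blast

text \<open>Nondegeneracy supplies \<open>r\<close> such that the \<epsilon>-part of
  \<open>r \<bullet> x\<close> is am + b\<nu>m with b \<noteq> 0. If a = 0 this is a multiple of
  \<nu>m, otherwise applying \<nu> gives one. So \<open>M\<close> has a smallest nonzero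
  submodule.\<close>

lemma nu_m_in_submodule:
  assumes "submodule H R M" "x \<in> H" "x \<noteq> \<zero>"
  shows "\<nu> \<bullet> m \<in> H"
proof -
  note HD = submoduleD[OF assms(1)]
  have xM: "x \<in> carrier M" using assms HD by auto
  obtain r where r: "r \<in> carrier R" "coef (r \<bullet> x) \<noteq> 0"
    using nondegenerate[OF xM] assms by blast
  obtain a where a: "\<epsilon> \<bullet> r \<bullet> x = sc a \<bullet> m \<oplus> sc (coef (r \<bullet> x)) \<bullet> \<nu> \<bullet> m"
    using coef_closed_form r xM by (meson smult_closed)
  define y b where "y = sc a \<bullet> m \<oplus> sc (coef (r \<bullet> x)) \<bullet> \<nu> \<bullet> m" and "b = coef (r \<bullet> x)"
  have yH: "y \<in> H"
    unfolding y_def a[symmetric] using HD(4) r eps_closed assms(2) by simp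
  show ?thesis
  proof (cases "a = 0")
    case True
    then have "sc (inverse b) \<bullet> y = \<nu> \<bullet> m"
      using m_in nu_m_closed r(2) unfolding y_def b_def
      by (simp add: sc_zero smult_zero_l smult_closed sc_act_sc sc_one smult_one)
    then show ?thesis using HD(4)[OF sc_closed yH, of "inverse b"] by simp
  next
    case False
    have "\<nu> \<bullet> y = sc a \<bullet> \<nu> \<bullet> m"
      unfolding y_def using m_in nu_m_closed nu_closed nu_nu_m
      by (simp add: smult_r_distr smult_closed sc_act_commute[OF nu_closed] smult_zero_r)
    then have "sc (inverse a) \<bullet> \<nu> \<bullet> y = \<nu> \<bullet> m"
      using False nu_m_closed by (simp add: sc_act_sc sc_one smult_one)
    then show ?thesis
      using HD(4)[OF sc_closed HD(4)[OF nu_closed yH], of "inverse a"] by simp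
  qed
qed

text \<open>The endomorphism that sends rm to r\<nu>m kills the kernel of \<open>top\<close> and so
  factors through \<open>T\<close>.\<close>

lemma socle_embedding: "\<exists>h\<in>mod_hom R T M. h t = \<nu> \<bullet> m"
proof -
  from hom_from[OF left_module_axioms nu_m_closed eps_nu_m]
  obtain \<rho> where \<rho>: "\<rho> \<in> mod_hom R M M" "\<And>r. r \<in> carrier R \<Longrightarrow> \<rho> (r \<bullet> m) = r \<bullet> \<nu> \<bullet> m"
    by blast
  \<comment> \<open>If rt = 0, then for every \<open>s\<close> the coefficient of \<epsilon> in
    \<epsilon>sr\<epsilon> is zero; what remains is a multiple of \<nu>, which kills \<nu>m.\<close>
  have ker: "\<rho> x = \<zero>" if x: "x \<in> carrier M" "top x = \<zero>\<^bsub>T\<^esub>" for x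
  proof -
    obtain r where r: "r \<in> carrier R" "x = r \<bullet> m" using generated[OF x(1)] by blast
    have rt: "r \<odot>\<^bsub>T\<^esub> t = \<zero>\<^bsub>T\<^esub>" using x r top(2) by simp
    show ?thesis
    proof (rule nondegenerate)
      fix s assume s: "s \<in> carrier R"
      then have sr: "s \<otimes>\<^bsub>R\<^esub> r \<in> carrier R" using r by simp
      obtain a b where ab: "\<epsilon> \<otimes>\<^bsub>R\<^esub> (s \<otimes>\<^bsub>R\<^esub> r) \<otimes>\<^bsub>R\<^esub> \<epsilon> = sc a \<otimes>\<^bsub>R\<^esub> \<epsilon> \<oplus>\<^bsub>R\<^esub> sc b \<otimes>\<^bsub>R\<^esub> \<nu>"
        using corner[OF sr] by blast
      have "sc a \<odot>\<^bsub>T\<^esub> t = \<zero>\<^bsub>T\<^esub>"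
        using eps_act_T[OF sr ab] s r rt t_in eps_closed by (simp add: T.smult_assoc T.smult_zero_r)
      then have "sc (inverse a) \<odot>\<^bsub>T\<^esub> (sc a \<odot>\<^bsub>T\<^esub> t) = \<zero>\<^bsub>T\<^esub>" by (simp add: T.smult_zero_r)
      then have a: "a = 0"
        using t_in t_nz by (cases "a = 0") (simp_all add: T.smult_one sc_one flip: T.smult_assoc sc_mult)
      have "\<epsilon> \<bullet> (s \<otimes>\<^bsub>R\<^esub> r) \<bullet> \<nu> \<bullet> m = sc a \<bullet> \<nu> \<bullet> m \<oplus> sc b \<bullet> \<nu> \<bullet> \<nu> \<bullet> m"
        by (rule corner_m[OF sr ab left_module_axioms nu_m_closed eps_nu_m])
      then have "\<epsilon> \<bullet> s \<bullet> \<rho> x = sc 0 \<bullet> m \<oplus> sc 0 \<bullet> \<nu> \<bullet> m"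
        using r s \<rho>(2) nu_m_closed nu_nu_m m_in
        by (simp add: smult_assoc a sc_zero smult_zero_l smult_zero_r)
      then show "coef (s \<bullet> \<rho> x) = 0" by (rule coefI)
    qed (use \<rho> x mod_homD in metis)
  qed
  from mod_hom_factor[OF left_module_axioms T.left_module_axioms left_module_axioms top(1) top_surj
      \<rho>(1) ker]
  obtain h where h: "h \<in> mod_hom R T M" "\<And>x. x \<in> carrier M \<Longrightarrow> h (top x) = \<rho> x" by blast
  have "h t = \<nu> \<bullet> m"
    using h(2)[OF m_in] \<rho>(2)[of "\<one>\<^bsub>R\<^esub>"] m_in nu_m_closed by (simp add: top_m smult_one)
  with h(1) show ?thesis by blast
qed

theorem injective_hull: "is_injective_hull TYPE('p) TYPE('q) R M T"
proof -
  obtain h where h: "h \<in> mod_hom R T M" "h t = \<nu> \<bullet> m" using socle_embedding by blast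
  have "inj_on h (carrier T)"
    using simple_module_inj[OF simple_T left_module_axioms h(1) t_in] h(2) nu_m_nz by simp
  moreover have "essential R M (h ` carrier T)"
    unfolding essential_def
  proof (intro conjI allI impI; (elim conjE)?)
    show "submodule (h ` carrier T) R M"
      by (rule mod_hom_image_submodule[OF T.left_module_axioms left_module_axioms h(1)])
    fix H assume H: "submodule H R M" "H \<inter> h ` carrier T = {\<zero>}"
    show "H = {\<zero>}"
    proof (rule ccontr)
      assume "H \<noteq> {\<zero>}"
      then obtain x where "x \<in> H" "x \<noteq> \<zero>" using submoduleD(2)[OF H(1)] by blast
      then have "\<nu> \<bullet> m \<in> H \<inter> h ` carrier T"
        using nu_m_in_submodule[OF H(1)] h(2) t_in by (metis IntI imageI)
      then show False using H(2) nu_m_nz by simp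
    qed
  qed
  ultimately show ?thesis
    unfolding is_injective_hull_def using injective T.left_module_axioms h(1) by blast
qed

theorem simple_isomorphic_top:
  assumes S: "simple_module R S" and x: "x \<in> carrier S" "\<epsilon> \<odot>\<^bsub>S\<^esub> x \<noteq> \<zero>\<^bsub>S\<^esub>"
    and idem: "\<epsilon> \<otimes>\<^bsub>R\<^esub> \<epsilon> = \<epsilon>"
  shows "mod_isomorphic R S T"
proof -
  interpret S: left_module R S using S by (simp add: simple_module_def)
  define s where "s = \<epsilon> \<odot>\<^bsub>S\<^esub> x"
  have s: "s \<in> carrier S" "\<epsilon> \<odot>\<^bsub>S\<^esub> s = s"
    unfolding s_def using x eps_closed idem by (simp_all add: S.smult_closed flip: S.smult_assoc)
  from hom_from[OF S.left_module_axioms s] obtain \<phi> where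
    \<phi>: "\<phi> \<in> mod_hom R M S" "\<And>r. r \<in> carrier R \<Longrightarrow> \<phi> (r \<bullet> m) = r \<odot>\<^bsub>S\<^esub> s" by blast
  have \<phi>m: "\<phi> m = s"
    using \<phi>(2)[of "\<one>\<^bsub>R\<^esub>"] m_in s by (simp add: smult_one S.smult_one)
  have surj: "\<phi> ` carrier M = carrier S"
    using simple_module_image[OF left_module_axioms S \<phi>(1) m_in] \<phi>m x s_def by simp
  define H where "H = a_kernel M S \<phi>"
  have H: "submodule H R M"
    unfolding H_def by (rule mod_hom_kernel_submodule[OF left_module_axioms S.left_module_axioms \<phi>(1)])
  note HD = submoduleD[OF H]
  have ker: "top y = \<zero>\<^bsub>T\<^esub>" if y: "y \<in> carrier M" "\<phi> y = \<zero>\<^bsub>S\<^esub>" for y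
  proof (rule ccontr)
    assume nz: "top y \<noteq> \<zero>\<^bsub>T\<^esub>"
    have yH: "y \<in> H" using y unfolding H_def a_kernel_def' by simp
    have "submodule (top ` H) R T"
    proof (rule T.submoduleI)
      show "\<zero>\<^bsub>T\<^esub> \<in> top ` H"
        using mod_hom_zero[OF left_module_axioms T.left_module_axioms top(1)] HD(2) by force
      show "u \<oplus>\<^bsub>T\<^esub> v \<in> top ` H" if "u \<in> top ` H" "v \<in> top ` H" for u v
        using that HD(1,3) by (auto simp: subset_iff simp flip: mod_homD(2)[OF top(1)])
      show "r \<odot>\<^bsub>T\<^esub> v \<in> top ` H" if "r \<in> carrier R" "v \<in> top ` H" for r v
        using that HD(1,4) by (auto simp: subset_iff simp flip: mod_homD(3)[OF top(1)])
    qed (use HD(1) mod_homD(1)[OF top(1)] in auto)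
    then have img: "top ` H = carrier T"
      using simple_T nz yH unfolding simple_module_def by auto
    have "H <+>\<^bsub>M\<^esub> a_kernel M T top = carrier M"
    proof (intro equalityI subsetI)
      fix v assume "v \<in> H <+>\<^bsub>M\<^esub> a_kernel M T top"
      then show "v \<in> carrier M" using HD(1) unfolding set_add_def' a_kernel_def' by auto
    next
      fix v assume v: "v \<in> carrier M"
      then obtain h where h: "h \<in> H" "top v = top h"
        using img mod_homD(1)[OF top(1)] by (metis imageE)
      have hM: "h \<in> carrier M" using h HD(1) by auto
      have "top (\<ominus> h \<oplus> v) = \<zero>\<^bsub>T\<^esub>"
        using v hM h(2) mod_homD(1,2)[OF top(1)]
          mod_hom_minus[OF left_module_axioms T.left_module_axioms top(1)]
        by (simp add: T.M.l_neg)
      then have "\<ominus> h \<oplus> v \<in> a_kernel M T top"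
        using v hM unfolding a_kernel_def' by simp
      moreover have "v = h \<oplus> (\<ominus> h \<oplus> v)"
        using v hM by (simp add: M.r_neg2)
      ultimately show "v \<in> H <+>\<^bsub>M\<^esub> a_kernel M T top"
        using h(1) unfolding set_add_def' by blast
    qed
    then have "H = carrier M"
      using superfluous_kernel H unfolding superfluous_def by blast
    then have "\<phi> m = \<zero>\<^bsub>S\<^esub>"
      using m_in unfolding H_def a_kernel_def' by blast
    then show False using \<phi>m x s_def by simp
  qed
  from mod_hom_factor[OF left_module_axioms S.left_module_axioms T.left_module_axioms \<phi>(1) surj
      top(1) ker]
  obtain h where h: "h \<in> mod_hom R S T" "\<And>x. x \<in> carrier M \<Longrightarrow> h (\<phi> x) = top x" by blast
  have hs: "h s = t" using h(2)[OF m_in] \<phi>m top_m by simp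
  have "inj_on h (carrier S)"
    using simple_module_inj[OF S T.left_module_axioms h(1) s(1)] hs t_nz by simp
  moreover have "h ` carrier S = carrier T"
    using simple_module_image[OF S.left_module_axioms simple_T h(1) s(1)] hs t_nz by simp
  ultimately show ?thesis
    unfolding mod_isomorphic_def bij_betw_def using h(1) by blast
qed

end

section \<open>Algebras Morita equivalent to a basic algebra with two vertices\<close>

lemma (in ring) finsum_Times_bool:
  assumes "finite W" "f \<in> W \<times> (UNIV :: bool set) \<rightarrow> carrier R"
  shows "finsum R f (W \<times> UNIV) = finsum R (\<lambda>w. f (w, False) \<oplus> f (w, True)) W"
  using assms
proof (induction W)
  case (insert w W)
  have eq: "insert w W \<times> (UNIV :: bool set) = insert (w, False) (insert (w, True) (W \<times> UNIV))"
    by (auto simp: UNIV_bool)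
  have f: "f \<in> W \<times> UNIV \<rightarrow> carrier R" "f (w, b) \<in> carrier R"
    "(\<lambda>w. f (w, False) \<oplus> f (w, True)) \<in> W \<rightarrow> carrier R" for b
    using insert.prems by auto
  have "finsum R f (insert w W \<times> UNIV) = f (w, False) \<oplus> (f (w, True) \<oplus> finsum R f (W \<times> UNIV))"
    unfolding eq using insert.hyps f by (subst finsum_insert; simp)+
  then show ?case
    using insert f by (simp add: a_assoc)
qed simp

text \<open>The elements \<open>a\<^sub>0\<close>, \<open>a\<^sub>1\<close> are arrows from vertex 1
  to vertex 2 and \<open>b\<^sub>0\<close>, \<open>b\<^sub>1\<close> arrows back, with the relations
  of an exterior algebra in two variables, split by parity. The families \<open>u\<close> and
  \<open>u'\<close> encode the Morita equivalence: each \<open>u w \<otimes> u' w\<close> is an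
  idempotent isomorphic to the vertex chosen by \<open>kind w\<close>, and these idempotents add up
  to one.\<close>

locale two_vertex_algebra = k_algebra R sc for R (structure) and sc :: "'k::field \<Rightarrow> 'a" +
  fixes e\<^sub>1 e\<^sub>2 a\<^sub>0 a\<^sub>1 b\<^sub>0 b\<^sub>1 :: 'a and W :: "'w set" and u u' :: "'w \<Rightarrow> 'a" and kind :: "'w \<Rightarrow> bool"
  assumes closed [simp]: "e\<^sub>1 \<in> carrier R" "e\<^sub>2 \<in> carrier R" "a\<^sub>0 \<in> carrier R" "a\<^sub>1 \<in> carrier R"
      "b\<^sub>0 \<in> carrier R" "b\<^sub>1 \<in> carrier R" "u w \<in> carrier R" "u' w \<in> carrier R"
    and e_e: "e\<^sub>1 \<otimes> e\<^sub>1 = e\<^sub>1" "e\<^sub>2 \<otimes> e\<^sub>2 = e\<^sub>2"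
    and e_a: "e\<^sub>2 \<otimes> a\<^sub>0 = a\<^sub>0" "e\<^sub>2 \<otimes> a\<^sub>1 = a\<^sub>1" "a\<^sub>0 \<otimes> e\<^sub>1 = a\<^sub>0" "a\<^sub>1 \<otimes> e\<^sub>1 = a\<^sub>1"
    and e_b: "e\<^sub>1 \<otimes> b\<^sub>0 = b\<^sub>0" "e\<^sub>1 \<otimes> b\<^sub>1 = b\<^sub>1" "b\<^sub>0 \<otimes> e\<^sub>2 = b\<^sub>0" "b\<^sub>1 \<otimes> e\<^sub>2 = b\<^sub>1"
    and a_b: "a\<^sub>0 \<otimes> b\<^sub>0 = \<zero>" "a\<^sub>1 \<otimes> b\<^sub>1 = \<zero>" "a\<^sub>1 \<otimes> b\<^sub>0 = \<ominus> (a\<^sub>0 \<otimes> b\<^sub>1)"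
    and b_a: "b\<^sub>0 \<otimes> a\<^sub>0 = \<zero>" "b\<^sub>1 \<otimes> a\<^sub>1 = \<zero>" "b\<^sub>1 \<otimes> a\<^sub>0 = \<ominus> (b\<^sub>0 \<otimes> a\<^sub>1)"
    and nz: "b\<^sub>0 \<otimes> a\<^sub>1 \<noteq> \<zero>" "a\<^sub>0 \<otimes> b\<^sub>1 \<noteq> \<zero>"
    and span_11: "r \<in> carrier R \<Longrightarrow> \<exists>x y. e\<^sub>1 \<otimes> r \<otimes> e\<^sub>1 = sc x \<otimes> e\<^sub>1 \<oplus> sc y \<otimes> (b\<^sub>0 \<otimes> a\<^sub>1)"
    and span_22: "r \<in> carrier R \<Longrightarrow> \<exists>x y. e\<^sub>2 \<otimes> r \<otimes> e\<^sub>2 = sc x \<otimes> e\<^sub>2 \<oplus> sc y \<otimes> (a\<^sub>0 \<otimes> b\<^sub>1)"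
    and span_21: "r \<in> carrier R \<Longrightarrow> \<exists>x y. e\<^sub>2 \<otimes> r \<otimes> e\<^sub>1 = sc x \<otimes> a\<^sub>0 \<oplus> sc y \<otimes> a\<^sub>1"
    and span_12: "r \<in> carrier R \<Longrightarrow> \<exists>x y. e\<^sub>1 \<otimes> r \<otimes> e\<^sub>2 = sc x \<otimes> b\<^sub>0 \<oplus> sc y \<otimes> b\<^sub>1"
    and finite_W: "finite W"
    and u'_u: "v \<in> W \<Longrightarrow> w \<in> W \<Longrightarrow> u' v \<otimes> u w = (if v = w then if kind w then e\<^sub>1 else e\<^sub>2 else \<zero>)"
    and sum_u_u': "finsum R (\<lambda>w. u w \<otimes> u' w) W = \<one>"
    and u_e: "w \<in> W \<Longrightarrow> u w \<otimes> (if kind w then e\<^sub>1 else e\<^sub>2) = u w"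
    and e_u': "w \<in> W \<Longrightarrow> (if kind w then e\<^sub>1 else e\<^sub>2) \<otimes> u' w = u' w"

text \<open>The axioms are symmetric in the two vertices, so every statement at
  \<open>e\<^sub>1\<close> also serves \<open>e\<^sub>2\<close>, with
  \<open>b\<^sub>0 \<otimes> a\<^sub>1\<close> replaced by
  \<open>a\<^sub>0 \<otimes> b\<^sub>1\<close>.\<close>

lemma (in two_vertex_algebra) swap:
  "two_vertex_algebra R sc e\<^sub>2 e\<^sub>1 b\<^sub>0 b\<^sub>1 a\<^sub>0 a\<^sub>1 W u u' (\<lambda>w. \<not> kind w)"
proof (intro two_vertex_algebra.intro two_vertex_algebra_axioms.intro)
  show "k_algebra R sc" by (rule k_algebra_axioms)
  show "u w \<otimes> (if \<not> kind w then e\<^sub>2 else e\<^sub>1) = u w" if "w \<in> W" for w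
    using u_e[OF that] by (auto split: if_splits)
  show "(if \<not> kind w then e\<^sub>2 else e\<^sub>1) \<otimes> u' w = u' w" if "w \<in> W" for w
    using e_u'[OF that] by (auto split: if_splits)
qed (use e_e e_a e_b a_b b_a nz span_11 span_22 span_21 span_12 finite_W u'_u sum_u_u' in auto)

context two_vertex_algebra
begin

definition nu where "nu = b\<^sub>0 \<otimes> a\<^sub>1"

lemma nu_closed [simp]: "nu \<in> carrier R"
  by (simp add: nu_def)

lemma e1_nu: "e\<^sub>1 \<otimes> nu = nu" "nu \<otimes> e\<^sub>1 = nu"
  unfolding nu_def by (metis closed(1,4,5) e_b(1) m_assoc, metis closed(1,4,5) e_a(4) m_assoc)

lemma nu_nu: "nu \<otimes> nu = \<zero>"
proof -
  have "nu \<otimes> nu = b\<^sub>0 \<otimes> (a\<^sub>1 \<otimes> b\<^sub>0) \<otimes> a\<^sub>1"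
    by (simp add: nu_def m_assoc)
  also have "\<dots> = \<ominus> (b\<^sub>0 \<otimes> a\<^sub>0 \<otimes> (b\<^sub>1 \<otimes> a\<^sub>1))"
    by (simp add: a_b m_assoc l_minus r_minus)
  finally show ?thesis by (simp add: b_a)
qed

definition coeff_basis :: "'w \<times> bool \<Rightarrow> 'a" where
  "coeff_basis = (\<lambda>(w, i). (if kind w then if i then e\<^sub>1 else nu else if i then b\<^sub>1 else b\<^sub>0) \<otimes> u' w)"

text \<open>Dual to \<open>coeff_basis\<close> under the coefficient of \<open>nu\<close>. The pairs
  are \<open>nu\<close> with \<open>e\<^sub>1\<close>, \<open>e\<^sub>1\<close> with
  \<open>nu\<close>, \<open>b\<^sub>0\<close> with \<open>a\<^sub>1\<close>, and
  \<open>b\<^sub>1\<close> with \<open>\<ominus> a\<^sub>0\<close>; the last sign comes from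
  \<open>b\<^sub>1 \<otimes> a\<^sub>0 = \<ominus> nu\<close>.\<close>

definition dual_basis :: "'w \<times> bool \<Rightarrow> 'a" where
  "dual_basis = (\<lambda>(w, i). u w \<otimes> (if kind w then if i then nu else e\<^sub>1 else if i then \<ominus> a\<^sub>0 else a\<^sub>1))"

lemma basis_closed: "coeff_basis j \<in> carrier R" "dual_basis j \<in> carrier R"
  by (auto simp: coeff_basis_def dual_basis_def split: prod.split)

lemma basis_dual:
  assumes "i \<in> W \<times> UNIV" "j \<in> W \<times> UNIV"
  shows "\<exists>\<kappa>. coeff_basis i \<otimes> dual_basis j = sc (if i = j then 1 else 0) \<otimes> nu \<oplus> sc \<kappa> \<otimes> e\<^sub>1"
proof -
  obtain w s v t where ij: "i = (w, s)" "j = (v, t)" "w \<in> W" "v \<in> W"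
    using assms by auto
  define x where "x = (if kind w then if s then e\<^sub>1 else nu else if s then b\<^sub>1 else b\<^sub>0)"
  define y where "y = (if kind v then if t then nu else e\<^sub>1 else if t then \<ominus> a\<^sub>0 else a\<^sub>1)"
  have xy: "x \<in> carrier R" "y \<in> carrier R"
    by (auto simp: x_def y_def)
  have "coeff_basis i \<otimes> dual_basis j = x \<otimes> (u' w \<otimes> u v) \<otimes> y"
    unfolding ij coeff_basis_def dual_basis_def prod.case x_def[symmetric] y_def[symmetric]
    using xy by (simp add: m_assoc)
  \<comment> \<open>Of all these products only \<open>e\<^sub>1 \<otimes> e\<^sub>1\<close> is not a
    multiple of \<open>nu\<close>.\<close>
  also have "\<dots> = sc (if i = j then 1 else 0) \<otimes> nu \<oplus> sc (if w = v \<and> kind w \<and> s \<and> \<not> t then 1 else 0) \<otimes> e\<^sub>1"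
    using ij xy unfolding u'_u[OF ij(3,4)] x_def y_def
    by (auto simp: sc_one sc_zero e1_nu e_e e_b nu_nu b_a r_minus simp flip: nu_def)
  finally show ?thesis by blast
qed

text \<open>Writing 1 as the sum of the \<open>u w \<otimes> u' w\<close> on the right splits the
  element into pieces whose left factors lie between \<open>e\<^sub>1\<close> and a single vertex,
  where spanning sets are given.\<close>

lemma basis_spans_right_ideal:
  assumes r: "r \<in> carrier R"
  shows "\<exists>\<theta>. e\<^sub>1 \<otimes> r = finsum R (\<lambda>j. sc (\<theta> j) \<otimes> coeff_basis j) (W \<times> UNIV)"
proof -
  have "\<exists>x y. e\<^sub>1 \<otimes> r \<otimes> u w \<otimes> u' w = sc x \<otimes> coeff_basis (w, False) \<oplus> sc y \<otimes> coeff_basis (w, True)"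
    if w: "w \<in> W" for w
  proof (cases "kind w")
    case True
    obtain x y where "e\<^sub>1 \<otimes> (r \<otimes> u w) \<otimes> e\<^sub>1 = sc x \<otimes> e\<^sub>1 \<oplus> sc y \<otimes> nu"
      using span_11[of "r \<otimes> u w"] r unfolding nu_def by auto
    then have "e\<^sub>1 \<otimes> r \<otimes> u w = sc y \<otimes> nu \<oplus> sc x \<otimes> e\<^sub>1"
      using r u_e[OF w] True by (simp add: m_assoc a_comm)
    then have "e\<^sub>1 \<otimes> r \<otimes> u w \<otimes> u' w = sc y \<otimes> coeff_basis (w, False) \<oplus> sc x \<otimes> coeff_basis (w, True)"
      unfolding coeff_basis_def using True by (simp add: l_distr m_assoc)
    then show ?thesis by blast
  next
    case False
    obtain x y where "e\<^sub>1 \<otimes> (r \<otimes> u w) \<otimes> e\<^sub>2 = sc x \<otimes> b\<^sub>0 \<oplus> sc y \<otimes> b\<^sub>1"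
      using span_12[of "r \<otimes> u w"] r by auto
    then have "e\<^sub>1 \<otimes> r \<otimes> u w = sc x \<otimes> b\<^sub>0 \<oplus> sc y \<otimes> b\<^sub>1"
      using r u_e[OF w] False by (simp add: m_assoc)
    then have "e\<^sub>1 \<otimes> r \<otimes> u w \<otimes> u' w = sc x \<otimes> coeff_basis (w, False) \<oplus> sc y \<otimes> coeff_basis (w, True)"
      unfolding coeff_basis_def using False by (simp add: l_distr m_assoc)
    then show ?thesis by blast
  qed
  then obtain x y where xy: "\<And>w. w \<in> W \<Longrightarrow>
      e\<^sub>1 \<otimes> r \<otimes> u w \<otimes> u' w = sc (x w) \<otimes> coeff_basis (w, False) \<oplus> sc (y w) \<otimes> coeff_basis (w, True)"
    by metis
  define \<theta> where "\<theta> = (\<lambda>(w, i). if i then y w else x w)"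
  have "e\<^sub>1 \<otimes> r = (e\<^sub>1 \<otimes> r) \<otimes> finsum R (\<lambda>w. u w \<otimes> u' w) W"
    using r by (simp add: sum_u_u')
  also have "\<dots> = finsum R (\<lambda>w. (e\<^sub>1 \<otimes> r) \<otimes> (u w \<otimes> u' w)) W"
    using r finite_W by (intro finsum_rdistr) auto
  also have "\<dots> = finsum R (\<lambda>w. sc (\<theta> (w, False)) \<otimes> coeff_basis (w, False) \<oplus>
      sc (\<theta> (w, True)) \<otimes> coeff_basis (w, True)) W"
    using r xy by (intro finsum_cong') (auto simp: \<theta>_def basis_closed m_assoc)
  also have "\<dots> = finsum R (\<lambda>j. sc (\<theta> j) \<otimes> coeff_basis j) (W \<times> UNIV)"
    by (subst finsum_Times_bool) (auto simp: finite_W basis_closed)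
  finally show ?thesis by blast
qed

lemma basis_spans_left_ideal:
  assumes r: "r \<in> carrier R"
  shows "\<exists>\<theta>. r \<otimes> e\<^sub>1 = finsum R (\<lambda>j. sc (\<theta> j) \<otimes> dual_basis j) (W \<times> UNIV)"
proof -
  have "\<exists>x y. u w \<otimes> (u' w \<otimes> r \<otimes> e\<^sub>1) = sc x \<otimes> dual_basis (w, False) \<oplus> sc y \<otimes> dual_basis (w, True)"
    if w: "w \<in> W" for w
  proof (cases "kind w")
    case True
    obtain x y where xy: "e\<^sub>1 \<otimes> (u' w \<otimes> r) \<otimes> e\<^sub>1 = sc x \<otimes> e\<^sub>1 \<oplus> sc y \<otimes> nu"
      using span_11[of "u' w \<otimes> r"] r unfolding nu_def by auto
    have "e\<^sub>1 \<otimes> (u' w \<otimes> r) \<otimes> e\<^sub>1 = (e\<^sub>1 \<otimes> u' w) \<otimes> r \<otimes> e\<^sub>1"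
      using r by (simp add: m_assoc)
    then have "u' w \<otimes> r \<otimes> e\<^sub>1 = sc x \<otimes> e\<^sub>1 \<oplus> sc y \<otimes> nu"
      using e_u'[OF w] True xy by simp
    then have "u w \<otimes> (u' w \<otimes> r \<otimes> e\<^sub>1) = sc x \<otimes> dual_basis (w, False) \<oplus> sc y \<otimes> dual_basis (w, True)"
      unfolding dual_basis_def using True by (simp add: r_distr sc_left_commute)
    then show ?thesis by blast
  next
    case False
    obtain x y where xy: "e\<^sub>2 \<otimes> (u' w \<otimes> r) \<otimes> e\<^sub>1 = sc x \<otimes> a\<^sub>0 \<oplus> sc y \<otimes> a\<^sub>1"
      using span_21[of "u' w \<otimes> r"] r by auto
    have "e\<^sub>2 \<otimes> (u' w \<otimes> r) \<otimes> e\<^sub>1 = (e\<^sub>2 \<otimes> u' w) \<otimes> r \<otimes> e\<^sub>1"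
      using r by (simp add: m_assoc)
    then have "u' w \<otimes> r \<otimes> e\<^sub>1 = sc y \<otimes> a\<^sub>1 \<oplus> sc (- x) \<otimes> \<ominus> a\<^sub>0"
      using e_u'[OF w] False xy by (simp add: sc_minus l_minus r_minus a_comm)
    then have "u w \<otimes> (u' w \<otimes> r \<otimes> e\<^sub>1) = sc y \<otimes> dual_basis (w, False) \<oplus> sc (- x) \<otimes> dual_basis (w, True)"
      unfolding dual_basis_def using False by (simp add: r_distr sc_left_commute)
    then show ?thesis by blast
  qed
  then obtain x y where xy: "\<And>w. w \<in> W \<Longrightarrow>
      u w \<otimes> (u' w \<otimes> r \<otimes> e\<^sub>1) = sc (x w) \<otimes> dual_basis (w, False) \<oplus> sc (y w) \<otimes> dual_basis (w, True)"
    by metis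
  define \<theta> where "\<theta> = (\<lambda>(w, i). if i then y w else x w)"
  have "r \<otimes> e\<^sub>1 = finsum R (\<lambda>w. u w \<otimes> u' w) W \<otimes> (r \<otimes> e\<^sub>1)"
    using r by (simp add: sum_u_u')
  also have "\<dots> = finsum R (\<lambda>w. u w \<otimes> u' w \<otimes> (r \<otimes> e\<^sub>1)) W"
    using r finite_W by (intro finsum_ldistr) auto
  also have "\<dots> = finsum R (\<lambda>w. sc (\<theta> (w, False)) \<otimes> dual_basis (w, False) \<oplus>
      sc (\<theta> (w, True)) \<otimes> dual_basis (w, True)) W"
    using r xy by (intro finsum_cong') (auto simp: \<theta>_def basis_closed m_assoc)
  also have "\<dots> = finsum R (\<lambda>j. sc (\<theta> j) \<otimes> dual_basis j) (W \<times> UNIV)"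
    by (subst finsum_Times_bool) (auto simp: finite_W basis_closed)
  finally show ?thesis by blast
qed

theorem frobenius:
  assumes "idempotent_module R M e\<^sub>1 m"
  shows "frobenius_module R sc M e\<^sub>1 m nu (W \<times> UNIV) coeff_basis dual_basis"
proof (intro frobenius_module.intro frobenius_module_axioms.intro)
  show "\<exists>x y. e\<^sub>1 \<otimes> r \<otimes> e\<^sub>1 = sc x \<otimes> e\<^sub>1 \<oplus> sc y \<otimes> nu" if "r \<in> carrier R" for r
    using span_11[OF that] unfolding nu_def .
qed (use assms k_algebra_axioms nz e1_nu nu_nu finite_W basis_closed basis_spans_right_ideal
    basis_spans_left_ideal basis_dual in \<open>auto simp: nu_def[symmetric]\<close>)

end

section \<open>Double arrows between three hubs and three tips\<close>

datatype hub = HE | HC | HD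
datatype tip = T0 | T1 | T2
datatype vertex = Hub hub | Tip tip

lemma UNIV_vertex: "UNIV = {Hub HE, Hub HC, Hub HD, Tip T0, Tip T1, Tip T2}"
proof (rule UNIV_eq_I)
  fix v
  show "v \<in> {Hub HE, Hub HC, Hub HD, Tip T0, Tip T1, Tip T2}"
  proof (cases v)
    case (Hub h)
    then show ?thesis by (cases h) simp_all
  next
    case (Tip j)
    then show ?thesis by (cases j) simp_all
  qed
qed

text \<open>The scalar of the round trip along the two arrows between a hub and a tip, which will be
  a value of f. It is zero for e and opposite for c and d.\<close>

fun hub_weight :: "(tip \<Rightarrow> 'k::field) \<Rightarrow> hub \<Rightarrow> tip \<Rightarrow> 'k" where
  "hub_weight p HE j = 0"
| "hub_weight p HC j = p j"
| "hub_weight p HD j = - p j"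

lemma (in ring) eq_minusI:
  assumes "x \<oplus> y = \<zero>" "x \<in> carrier R" "y \<in> carrier R"
  shows "y = \<ominus> x"
  using minus_equality[of x y] assms by (metis minus_minus)

text \<open>\<open>up\<close> goes from hub to tip, \<open>dn\<close> back. The sums are the
  quadratic relations cut by a vertex idempotent: two relations and three hubs give the six ordered
  pairs of distinct hubs, and likewise for tips. The assumption \<open>generated\<close> is
  induction over the generators.\<close>

locale double_arrows = k_algebra R sc for R (structure) and sc :: "'k::field \<Rightarrow> 'a" +
  fixes p :: "tip \<Rightarrow> 'k" and d :: "vertex \<Rightarrow> 'a" and up dn :: "hub \<Rightarrow> tip \<Rightarrow> 'a"
  assumes closed [simp]: "d v \<in> carrier R" "up h j \<in> carrier R" "dn h j \<in> carrier R"
    and p_nz: "p j \<noteq> 0"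
    and d_d: "d v \<otimes> d w = (if v = w then d v else \<zero>)"
    and sum_d: "finsum R d UNIV = \<one>"
    and up_d: "up h j \<otimes> d (Hub h) = up h j" and d_up: "d (Tip j) \<otimes> up h j = up h j"
    and dn_d: "dn h j \<otimes> d (Tip j) = dn h j" and d_dn: "d (Hub h) \<otimes> dn h j = dn h j"
    and dn_up: "dn h j \<otimes> up h j = sc (hub_weight p h j) \<otimes> d (Hub h)"
    and up_dn: "up h j \<otimes> dn h j = sc (hub_weight p h j) \<otimes> d (Tip j)"
    and sum_dn_up: "h \<noteq> h' \<Longrightarrow>
      dn h T0 \<otimes> up h' T0 \<oplus> dn h T1 \<otimes> up h' T1 \<oplus> dn h T2 \<otimes> up h' T2 = \<zero>"
    and sum_up_dn: "i \<noteq> j \<Longrightarrow>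
      up HE i \<otimes> dn HE j \<oplus> up HC i \<otimes> dn HC j \<oplus> up HD i \<otimes> dn HD j = \<zero>"
    and generated: "\<lbrakk>r \<in> carrier R; \<And>c. P (sc c); \<And>v. P (d v); \<And>h j. P (up h j); \<And>h j. P (dn h j);
      \<And>x y. x \<in> carrier R \<Longrightarrow> y \<in> carrier R \<Longrightarrow> P x \<Longrightarrow> P y \<Longrightarrow> P (x \<oplus> y);
      \<And>x y. x \<in> carrier R \<Longrightarrow> y \<in> carrier R \<Longrightarrow> P x \<Longrightarrow> P y \<Longrightarrow> P (x \<otimes> y)\<rbrakk> \<Longrightarrow> P r"
begin

definition "al j = dn HC j \<otimes> up HE j"
definition "be j = dn HE j \<otimes> up HC j"

text \<open>\<open>u v\<close> leads from hub c to \<open>v\<close>, or from e if \<open>v\<close>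
  is e, and \<open>u' v\<close> leads back. Hub d is reached through \<open>T0\<close>, though any
  tip would serve. The scalars cancel the round trip weights; the sign is there because the trip c,
  T0, d, T0, c has weight \<open>- (p T0 * p T0)\<close>.\<close>

fun u :: "vertex \<Rightarrow> 'a" where
  "u (Hub HE) = d (Hub HE)"
| "u (Hub HC) = d (Hub HC)"
| "u (Hub HD) = sc (- inverse (p T0)) \<otimes> (dn HD T0 \<otimes> up HC T0)"
| "u (Tip j) = up HC j"

fun u' :: "vertex \<Rightarrow> 'a" where
  "u' (Hub HE) = d (Hub HE)"
| "u' (Hub HC) = d (Hub HC)"
| "u' (Hub HD) = sc (inverse (p T0)) \<otimes> (dn HC T0 \<otimes> up HD T0)"
| "u' (Tip j) = sc (inverse (p j)) \<otimes> dn HC j"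

definition src :: "vertex \<Rightarrow> hub" where "src v = (if v = Hub HE then HE else HC)"

lemma u_closed [simp]: "u v \<in> carrier R" "u' v \<in> carrier R"
  by (cases v rule: u.cases; simp)+

lemma al_be_closed [simp]: "al j \<in> carrier R" "be j \<in> carrier R"
  by (simp_all add: al_def be_def)

lemma d_up_any: "d v \<otimes> up h i = (if v = Tip i then up h i else \<zero>)"
  and d_dn_any: "d v \<otimes> dn h i = (if v = Hub h then dn h i else \<zero>)"
  and up_d_any: "up h i \<otimes> d v = (if v = Hub h then up h i else \<zero>)"
  and dn_d_any: "dn h i \<otimes> d v = (if v = Tip i then dn h i else \<zero>)"
proof -
  have "d v \<otimes> up h i = d v \<otimes> d (Tip i) \<otimes> up h i" by (simp add: d_up m_assoc)
  then show "d v \<otimes> up h i = (if v = Tip i then up h i else \<zero>)" by (simp add: d_d d_up)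
  have "d v \<otimes> dn h i = d v \<otimes> d (Hub h) \<otimes> dn h i" by (simp add: d_dn m_assoc)
  then show "d v \<otimes> dn h i = (if v = Hub h then dn h i else \<zero>)" by (simp add: d_d d_dn)
  have "up h i \<otimes> d v = up h i \<otimes> (d (Hub h) \<otimes> d v)" by (simp add: up_d flip: m_assoc)
  then show "up h i \<otimes> d v = (if v = Hub h then up h i else \<zero>)" by (simp add: d_d up_d)
  have "dn h i \<otimes> d v = dn h i \<otimes> (d (Tip i) \<otimes> d v)" by (simp add: dn_d flip: m_assoc)
  then show "dn h i \<otimes> d v = (if v = Tip i then dn h i else \<zero>)" by (simp add: d_d dn_d)
qed

lemma d_u: "d v \<otimes> u w = (if v = w then u w else \<zero>)"
proof (cases w rule: u.cases)
  case 3
  have "d v \<otimes> u w = sc (- inverse (p T0)) \<otimes> (d v \<otimes> dn HD T0 \<otimes> up HC T0)"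
    using 3 by (simp add: sc_left_commute m_assoc)
  then show ?thesis using 3 by (simp add: d_dn_any)
qed (simp_all add: d_d d_up_any)

lemma u'_d: "u' w \<otimes> d v = (if v = w then u' w else \<zero>)"
proof (cases w rule: u.cases)
  case 3
  then show ?thesis by (simp add: m_assoc up_d_any)
qed (auto simp: d_d dn_d_any m_assoc)

lemma u_d: "u w \<otimes> d (Hub (src w)) = u w"
  by (cases w rule: u.cases) (simp_all add: d_d up_d m_assoc src_def)

lemma d_u': "d (Hub (src w)) \<otimes> u' w = u' w"
proof (cases w rule: u.cases)
  case 3
  have "d (Hub HC) \<otimes> u' w = sc (inverse (p T0)) \<otimes> (d (Hub HC) \<otimes> dn HC T0 \<otimes> up HD T0)"
    using 3 by (simp add: sc_left_commute m_assoc)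
  then show ?thesis using 3 by (simp add: d_dn_any src_def)
next
  case (4 j)
  then show ?thesis by (simp add: src_def sc_left_commute d_dn_any)
qed (simp_all add: d_d src_def)

text \<open>The inner round trip at the tip contributes \<open>- p j\<close>, the outer one
  \<open>p j\<close>.\<close>

lemma psi_phi: "dn HC j \<otimes> (up HD j \<otimes> (dn HD j \<otimes> up HC j)) = sc (- (p j * p j)) \<otimes> d (Hub HC)"
proof -
  have "dn HC j \<otimes> (up HD j \<otimes> (dn HD j \<otimes> up HC j)) = dn HC j \<otimes> (up HD j \<otimes> dn HD j) \<otimes> up HC j"
    by (simp add: m_assoc)
  also have "\<dots> = sc (- p j) \<otimes> (dn HC j \<otimes> up HC j)"
    by (simp add: up_dn sc_left_commute m_assoc d_up)
  finally show ?thesis by (simp add: dn_up sc_sc)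
qed

lemma phi_psi: "dn HD j \<otimes> (up HC j \<otimes> (dn HC j \<otimes> up HD j)) = sc (- (p j * p j)) \<otimes> d (Hub HD)"
proof -
  have "dn HD j \<otimes> (up HC j \<otimes> (dn HC j \<otimes> up HD j)) = dn HD j \<otimes> (up HC j \<otimes> dn HC j) \<otimes> up HD j"
    by (simp add: m_assoc)
  also have "\<dots> = sc (p j) \<otimes> (dn HD j \<otimes> up HD j)"
    by (simp add: up_dn sc_left_commute m_assoc d_up)
  finally show ?thesis by (simp add: dn_up sc_sc)
qed

lemma u'_u_same: "u' v \<otimes> u v = d (Hub (src v))"
proof (cases v rule: u.cases)
  case 3
  have "u' v \<otimes> u v = sc (inverse (p T0)) \<otimes> (sc (- inverse (p T0)) \<otimes>
      (dn HC T0 \<otimes> (up HD T0 \<otimes> (dn HD T0 \<otimes> up HC T0))))"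
    using 3 by (simp add: m_assoc sc_left_commute[of "up HD T0"] sc_left_commute[of "dn HC T0"])
  moreover have "inverse (p T0) * (inverse (p T0) * (p T0 * p T0)) = 1"
    using p_nz[of T0] by (simp add: field_simps)
  ultimately show ?thesis
    using 3 by (simp add: psi_phi sc_sc sc_one src_def)
next
  case (4 j)
  then show ?thesis
    using p_nz by (simp add: m_assoc dn_up sc_sc sc_one src_def)
qed (simp_all add: d_d src_def)

lemma u_u'_same: "u v \<otimes> u' v = d v"
proof (cases v rule: u.cases)
  case 3
  have "u v \<otimes> u' v = sc (- inverse (p T0)) \<otimes> (sc (inverse (p T0)) \<otimes>
      (dn HD T0 \<otimes> (up HC T0 \<otimes> (dn HC T0 \<otimes> up HD T0))))"
    using 3 by (simp add: m_assoc sc_left_commute[of "up HC T0"] sc_left_commute[of "dn HD T0"])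
  moreover have "inverse (p T0) * (inverse (p T0) * (p T0 * p T0)) = 1"
    using p_nz[of T0] by (simp add: field_simps)
  ultimately show ?thesis
    using 3 by (simp add: phi_psi sc_sc sc_one)
next
  case (4 j)
  then show ?thesis
    using p_nz by (simp add: sc_left_commute[of "up HC j"] up_dn sc_sc sc_one)
qed (simp_all add: d_d)

lemma u'_u: "u' v \<otimes> u w = (if v = w then d (Hub (src v)) else \<zero>)"
proof -
  have "u' v \<otimes> u w = u' v \<otimes> d w \<otimes> u w" by (simp add: d_u m_assoc)
  then show ?thesis by (cases "v = w") (simp_all add: u'_d u'_u_same)
qed

lemma sum_u_u': "finsum R (\<lambda>v. u v \<otimes> u' v) UNIV = \<one>"
  by (simp add: u_u'_same sum_d)

text \<open>Multiply the relation \<open>sum_up_dn\<close>, which for \<open>i = j\<close> holds because the weights of the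
  three hubs add up to zero, by \<open>dn HC i\<close> from the left and by \<open>up HC j\<close> from the right.\<close>

lemma al_be: "dn HC i \<otimes> (up HD i \<otimes> (dn HD j \<otimes> up HC j)) =
    \<ominus> (sc (p i * p j) \<otimes> d (Hub HC)) \<oplus> \<ominus> (al i \<otimes> be j)"
proof -
  have "up HE i \<otimes> dn HE j \<oplus> up HC i \<otimes> dn HC j \<oplus> up HD i \<otimes> dn HD j = \<zero>"
  proof (cases "i = j")
    case True
    then show ?thesis by (simp add: up_dn sc_zero sc_minus l_minus r_neg)
  qed (rule sum_up_dn)
  then have "dn HC i \<otimes> (up HE i \<otimes> dn HE j \<oplus> up HC i \<otimes> dn HC j \<oplus> up HD i \<otimes> dn HD j) \<otimes> up HC j = \<zero>"
    by simp
  then have "al i \<otimes> be j \<oplus> (dn HC i \<otimes> up HC i) \<otimes> (dn HC j \<otimes> up HC j) \<oplus>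
      dn HC i \<otimes> (up HD i \<otimes> (dn HD j \<otimes> up HC j)) = \<zero>"
    by (simp add: al_def be_def l_distr r_distr m_assoc)
  then have "(sc (p i * p j) \<otimes> d (Hub HC) \<oplus> al i \<otimes> be j) \<oplus>
      dn HC i \<otimes> (up HD i \<otimes> (dn HD j \<otimes> up HC j)) = \<zero>"
    by (simp add: dn_up m_assoc sc_left_commute[of "d (Hub HC)"] sc_sc d_d a_comm)
  then have "dn HC i \<otimes> (up HD i \<otimes> (dn HD j \<otimes> up HC j)) =
      \<ominus> (sc (p i * p j) \<otimes> d (Hub HC) \<oplus> al i \<otimes> be j)"
    by (intro eq_minusI) simp_all
  then show ?thesis by (simp add: minus_add)
qed

lemma d_al: "d (Hub HC) \<otimes> al j = al j" "al j \<otimes> d (Hub HE) = al j"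
  and d_be: "d (Hub HE) \<otimes> be j = be j" "be j \<otimes> d (Hub HC) = be j"
  by (simp_all add: al_def be_def up_d m_assoc) (simp_all add: d_dn flip: m_assoc)

text \<open>The middle of the path is a round trip from tip \<open>j\<close> through e, of weight
  zero.\<close>

lemma al_be_same: "al j \<otimes> be j = \<zero>"
proof -
  have "al j \<otimes> be j = dn HC j \<otimes> (up HE j \<otimes> dn HE j) \<otimes> up HC j"
    by (simp add: al_def be_def m_assoc)
  then show ?thesis by (simp add: up_dn sc_zero)
qed

text \<open>The middle round trip through c gives the scalar \<open>p j\<close>, and what remains is
  a round trip at e, of weight zero.\<close>

lemma be_al_same: "be j \<otimes> al j = \<zero>"
proof -
  have "be j \<otimes> al j = dn HE j \<otimes> (up HC j \<otimes> dn HC j) \<otimes> up HE j"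
    by (simp add: al_def be_def m_assoc)
  also have "\<dots> = sc (p j) \<otimes> (dn HE j \<otimes> up HE j)"
    by (simp add: up_dn sc_left_commute m_assoc d_up)
  finally show ?thesis by (simp add: dn_up sc_zero)
qed

lemma al_T2: "al T2 = \<ominus> al T0 \<oplus> \<ominus> al T1"
proof -
  have "al T0 \<oplus> al T1 \<oplus> al T2 = \<zero>" using sum_dn_up[of HC HE] by (simp add: al_def)
  then have "al T2 = \<ominus> (al T0 \<oplus> al T1)" by (intro eq_minusI) simp_all
  then show ?thesis by (simp add: minus_add)
qed

lemma be_T2: "be T2 = \<ominus> be T0 \<oplus> \<ominus> be T1"
proof -
  have "be T0 \<oplus> be T1 \<oplus> be T2 = \<zero>" using sum_dn_up[of HE HC] by (simp add: be_def)
  then have "be T2 = \<ominus> (be T0 \<oplus> be T1)" by (intro eq_minusI) simp_all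
  then show ?thesis by (simp add: minus_add)
qed

text \<open>Polarisation: over the three tips the \<open>al j\<close> add up to zero, and so do the
  \<open>be j\<close>; hence \<open>al T2 \<otimes> be T2\<close>, which is zero, is the sum of the
  two mixed products.\<close>

lemma al_be_antisym: "al T1 \<otimes> be T0 = \<ominus> (al T0 \<otimes> be T1)"
proof -
  have "al T2 \<otimes> be T2 = al T0 \<otimes> be T1 \<oplus> al T1 \<otimes> be T0"
    unfolding al_T2 be_T2 by (simp add: l_distr r_distr l_minus r_minus al_be_same a_comm)
  then show ?thesis by (intro eq_minusI) (simp_all add: al_be_same)
qed

lemma be_al_antisym: "be T1 \<otimes> al T0 = \<ominus> (be T0 \<otimes> al T1)"
proof -
  have "be T2 \<otimes> al T2 = be T0 \<otimes> al T1 \<oplus> be T1 \<otimes> al T0"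
    unfolding al_T2 be_T2 by (simp add: l_distr r_distr l_minus r_minus be_al_same a_comm)
  then show ?thesis by (intro eq_minusI) (simp_all add: be_al_same)
qed

end

section \<open>Spans of two elements over the field\<close>

context k_algebra
begin

definition lin :: "'a \<Rightarrow> 'a \<Rightarrow> 'a set" where
  "lin s t = {sc x \<otimes> s \<oplus> sc y \<otimes> t | x y. True}"

lemma lin_closed: "s \<in> carrier R \<Longrightarrow> t \<in> carrier R \<Longrightarrow> x \<in> lin s t \<Longrightarrow> x \<in> carrier R"
  by (auto simp: lin_def)

lemma lin_zero: "s \<in> carrier R \<Longrightarrow> t \<in> carrier R \<Longrightarrow> \<zero> \<in> lin s t"
  unfolding lin_def by (force simp: sc_zero intro: exI[of _ 0])

lemma lin_fst: "s \<in> carrier R \<Longrightarrow> t \<in> carrier R \<Longrightarrow> s \<in> lin s t"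
  unfolding lin_def mem_Collect_eq by (intro exI[of _ 1] exI[of _ 0]) (simp add: sc_zero sc_one)

lemma lin_snd: "s \<in> carrier R \<Longrightarrow> t \<in> carrier R \<Longrightarrow> t \<in> lin s t"
  unfolding lin_def mem_Collect_eq by (intro exI[of _ 0] exI[of _ 1]) (simp add: sc_zero sc_one)

lemma lin_add:
  assumes "s \<in> carrier R" "t \<in> carrier R" "x \<in> lin s t" "y \<in> lin s t"
  shows "x \<oplus> y \<in> lin s t"
proof -
  obtain a b c d where "x = sc a \<otimes> s \<oplus> sc b \<otimes> t" "y = sc c \<otimes> s \<oplus> sc d \<otimes> t"
    using assms(3,4) unfolding lin_def by blast
  then have "x \<oplus> y = sc (a + c) \<otimes> s \<oplus> sc (b + d) \<otimes> t"
    using assms(1,2) by (simp add: sc_add l_distr a_ac)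
  then show ?thesis unfolding lin_def by blast
qed

lemma lin_sc:
  assumes "s \<in> carrier R" "t \<in> carrier R" "x \<in> lin s t"
  shows "sc c \<otimes> x \<in> lin s t"
proof -
  obtain a b where "x = sc a \<otimes> s \<oplus> sc b \<otimes> t"
    using assms(3) unfolding lin_def by blast
  then have "sc c \<otimes> x = sc (c * a) \<otimes> s \<oplus> sc (c * b) \<otimes> t"
    using assms(1,2) by (simp add: r_distr sc_sc)
  then show ?thesis unfolding lin_def by blast
qed

lemma lin_minus:
  assumes "s \<in> carrier R" "t \<in> carrier R" "x \<in> lin s t"
  shows "\<ominus> x \<in> lin s t"
  using lin_sc[OF assms, of "-1"] lin_closed[OF assms] by (simp add: sc_minus sc_one l_minus)

lemma lin_mult:
  assumes cl: "s \<in> carrier R" "t \<in> carrier R" "s' \<in> carrier R" "t' \<in> carrier R" "v \<in> carrier R" "w \<in> carrier R"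
    and "x \<in> lin s t" "y \<in> lin s' t'"
    and m: "s \<otimes> s' \<in> lin v w" "s \<otimes> t' \<in> lin v w" "t \<otimes> s' \<in> lin v w" "t \<otimes> t' \<in> lin v w"
  shows "x \<otimes> y \<in> lin v w"
proof -
  obtain a b c d where "x = sc a \<otimes> s \<oplus> sc b \<otimes> t" "y = sc c \<otimes> s' \<oplus> sc d \<otimes> t'"
    using assms(7,8) unfolding lin_def by blast
  moreover have "(sc q \<otimes> g) \<otimes> (sc r \<otimes> h) = sc (q * r) \<otimes> (g \<otimes> h)"
    if "g \<in> carrier R" "h \<in> carrier R" for q r g h
    using that by (simp add: m_assoc sc_left_commute[of g] sc_sc)
  ultimately have "x \<otimes> y = sc (a * c) \<otimes> (s \<otimes> s') \<oplus> sc (a * d) \<otimes> (s \<otimes> t') \<oplus>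
      (sc (b * c) \<otimes> (t \<otimes> s') \<oplus> sc (b * d) \<otimes> (t \<otimes> t'))"
    using cl by (simp add: l_distr r_distr a_ac)
  then show ?thesis using cl m by (simp add: lin_add lin_sc)
qed

lemma lin_finsum:
  assumes "s \<in> carrier R" "t \<in> carrier R" "finite A" "\<And>i. i \<in> A \<Longrightarrow> f i \<in> lin s t"
  shows "finsum R f A \<in> lin s t"
  using assms(3,4)
proof (induction A)
  case (insert i A)
  then have "f \<in> A \<rightarrow> carrier R" "f i \<in> carrier R"
    using lin_closed[OF assms(1,2)] by auto
  then show ?case using insert assms(1,2) by (simp add: lin_add)
qed (use assms in \<open>simp add: lin_zero\<close>)

end

lemma finite_vertex: "finite (UNIV :: vertex set)"
  by (simp add: UNIV_vertex)

section \<open>The four blocks of the corner at e and c\<close>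

context double_arrows
begin

text \<open>The span that is to contain all paths with target \<open>k\<close> and source
  \<open>l\<close>. Any index other than \<open>HE\<close> counts as \<open>HC\<close>.\<close>

definition blk :: "hub \<Rightarrow> hub \<Rightarrow> 'a set" where
  "blk k l = (if k = HE
    then if l = HE then lin (d (Hub HE)) (be T0 \<otimes> al T1) else lin (be T0) (be T1)
    else if l = HE then lin (al T0) (al T1) else lin (d (Hub HC)) (al T0 \<otimes> be T1))"

lemma blk_closed: "x \<in> blk k l \<Longrightarrow> x \<in> carrier R"
  unfolding blk_def by (auto split: if_splits elim: lin_closed[rotated 2])

lemma blk_zero: "\<zero> \<in> blk k l"
  unfolding blk_def by (auto intro!: lin_zero)

lemma blk_add: "x \<in> blk k l \<Longrightarrow> y \<in> blk k l \<Longrightarrow> x \<oplus> y \<in> blk k l"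
  unfolding blk_def by (auto intro!: lin_add split: if_splits)

lemma blk_sc: "x \<in> blk k l \<Longrightarrow> sc c \<otimes> x \<in> blk k l"
  unfolding blk_def by (auto intro!: lin_sc split: if_splits)

lemma blk_minus: "x \<in> blk k l \<Longrightarrow> \<ominus> x \<in> blk k l"
  unfolding blk_def by (auto intro!: lin_minus split: if_splits)

lemma blk_finsum: "finite A \<Longrightarrow> (\<And>i. i \<in> A \<Longrightarrow> f i \<in> blk k l) \<Longrightarrow> finsum R f A \<in> blk k l"
  unfolding blk_def by (auto intro!: lin_finsum split: if_splits)

text \<open>Paths of length three in the \<open>al\<close> and \<open>be\<close> vanish: the sign
  rules bring two equal indices together.\<close>

lemma radical_mult:
  "al T0 \<otimes> be T1 \<otimes> al T0 = \<zero>" "al T0 \<otimes> be T1 \<otimes> al T1 = \<zero>"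
  "al T0 \<otimes> (be T0 \<otimes> al T1) = \<zero>" "al T1 \<otimes> (be T0 \<otimes> al T1) = \<zero>"
  "be T0 \<otimes> al T1 \<otimes> be T0 = \<zero>" "be T0 \<otimes> al T1 \<otimes> be T1 = \<zero>"
  "be T0 \<otimes> (al T0 \<otimes> be T1) = \<zero>" "be T1 \<otimes> (al T0 \<otimes> be T1) = \<zero>"
proof -
  have "al T0 \<otimes> be T1 \<otimes> al T0 = \<ominus> (al T0 \<otimes> be T0 \<otimes> al T1)"
    by (simp add: m_assoc be_al_antisym r_minus)
  then show 1: "al T0 \<otimes> be T1 \<otimes> al T0 = \<zero>" by (simp add: al_be_same)
  show "al T0 \<otimes> be T1 \<otimes> al T1 = \<zero>" by (simp add: m_assoc be_al_same)
  show "al T0 \<otimes> (be T0 \<otimes> al T1) = \<zero>" by (simp add: al_be_same flip: m_assoc)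
  have "al T1 \<otimes> (be T0 \<otimes> al T1) = \<ominus> (al T0 \<otimes> (be T1 \<otimes> al T1))"
    by (simp add: al_be_antisym l_minus flip: m_assoc)
  then show "al T1 \<otimes> (be T0 \<otimes> al T1) = \<zero>" by (simp add: be_al_same)
  have "be T0 \<otimes> al T1 \<otimes> be T0 = \<ominus> (be T0 \<otimes> al T0 \<otimes> be T1)"
    by (simp add: m_assoc al_be_antisym r_minus)
  then show "be T0 \<otimes> al T1 \<otimes> be T0 = \<zero>" by (simp add: be_al_same)
  show "be T0 \<otimes> al T1 \<otimes> be T1 = \<zero>" by (simp add: m_assoc al_be_same)
  show "be T0 \<otimes> (al T0 \<otimes> be T1) = \<zero>" by (simp add: be_al_same flip: m_assoc)
  have "be T1 \<otimes> (al T0 \<otimes> be T1) = \<ominus> (be T0 \<otimes> (al T1 \<otimes> be T1))"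
    by (simp add: be_al_antisym l_minus flip: m_assoc)
  then show "be T1 \<otimes> (al T0 \<otimes> be T1) = \<zero>" by (simp add: al_be_same)
qed

lemma square_zero:
  "al T0 \<otimes> be T1 \<otimes> (al T0 \<otimes> be T1) = \<zero>" "be T0 \<otimes> al T1 \<otimes> (be T0 \<otimes> al T1) = \<zero>"
  using radical_mult(1,5) by (simp_all flip: m_assoc)

lemma d_mult:
  "d (Hub HC) \<otimes> (al i \<otimes> be j) = al i \<otimes> be j" "al i \<otimes> be j \<otimes> d (Hub HC) = al i \<otimes> be j"
  "d (Hub HE) \<otimes> (be j \<otimes> al i) = be j \<otimes> al i" "be j \<otimes> al i \<otimes> d (Hub HE) = be j \<otimes> al i"
proof -
  show "d (Hub HC) \<otimes> (al i \<otimes> be j) = al i \<otimes> be j" "d (Hub HE) \<otimes> (be j \<otimes> al i) = be j \<otimes> al i"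
    by (simp_all add: d_al d_be flip: m_assoc)
  show "al i \<otimes> be j \<otimes> d (Hub HC) = al i \<otimes> be j" "be j \<otimes> al i \<otimes> d (Hub HE) = be j \<otimes> al i"
    by (simp_all add: d_al d_be m_assoc)
qed

text \<open>Products of the listed spanning elements are again listed elements, up to sign, or zero,
  so the four spans are closed under composition.\<close>

lemma blk_mult:
  assumes "x \<in> blk (src g) (src h)" "y \<in> blk (src h) (src k)"
  shows "x \<otimes> y \<in> blk (src g) (src k)"
proof -
  show ?thesis
    using assms unfolding blk_def src_def
    by (auto split: if_splits elim!: lin_mult[rotated 6]
        simp: d_d d_al d_be d_mult radical_mult square_zero al_be_same be_al_same
          al_be_antisym be_al_antisym)
       (simp_all add: lin_zero lin_fst lin_snd lin_minus)
qed

lemma al_blk: "al j \<in> blk HC HE"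
  unfolding blk_def by (cases j) (auto simp: al_T2 intro!: lin_fst lin_snd lin_minus lin_add)

lemma be_blk: "be j \<in> blk HE HC"
  unfolding blk_def by (cases j) (auto simp: be_T2 intro!: lin_fst lin_snd lin_minus lin_add)

lemma d_blk: "d (Hub (src v)) \<in> blk (src v) (src v)"
  unfolding blk_def src_def by (auto intro!: lin_fst)

text \<open>Trips from c to d and back are not of the listed form; \<open>al_be\<close> trades hub d
  for hub e.\<close>

lemma psi_phi_blk: "dn HC i \<otimes> (up HD i \<otimes> (dn HD j \<otimes> up HC j)) \<in> blk HC HC"
proof -
  have "al i \<otimes> be j \<in> blk HC HC"
    using blk_mult[of "al i" "Hub HC" "Hub HE" "be j" "Hub HC"] al_blk be_blk by (simp add: src_def)
  moreover have "d (Hub HC) \<in> blk HC HC"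
    using d_blk[of "Hub HC"] by (simp add: src_def)
  ultimately show ?thesis
    unfolding al_be by (intro blk_add blk_minus blk_sc)
qed

lemma up_u: "up h j \<otimes> u w = (if w = Hub h then up h j \<otimes> u w else \<zero>)"
proof -
  have "up h j \<otimes> u w = up h j \<otimes> (d (Hub h) \<otimes> u w)"
    by (simp add: up_d flip: m_assoc)
  then show ?thesis by (simp add: d_u)
qed

lemma dn_u: "dn h j \<otimes> u w = (if w = Tip j then dn h j \<otimes> u w else \<zero>)"
proof -
  have "dn h j \<otimes> u w = dn h j \<otimes> (d (Tip j) \<otimes> u w)"
    by (simp add: dn_d flip: m_assoc)
  then show ?thesis by (simp add: d_u)
qed

lemma u'_up: "u' g \<otimes> up h j = (if g = Tip j then u' g \<otimes> up h j else \<zero>)"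
proof -
  have "u' g \<otimes> up h j = u' g \<otimes> d (Tip j) \<otimes> up h j"
    by (simp add: d_up m_assoc)
  then show ?thesis by (simp add: u'_d)
qed

lemma u'_dn: "u' g \<otimes> dn h j = (if g = Hub h then u' g \<otimes> dn h j else \<zero>)"
proof -
  have "u' g \<otimes> dn h j = u' g \<otimes> d (Hub h) \<otimes> dn h j"
    by (simp add: d_dn m_assoc)
  then show ?thesis by (simp add: u'_d)
qed

text \<open>An arrow has at most one nonzero entry between the \<open>u' g\<close> and the
  \<open>u w\<close>, namely at its own two ends, and the hub decides the shape of this
  entry.\<close>

lemma up_blk: "u' g \<otimes> up h j \<otimes> u w \<in> blk (src g) (src w)"
proof (cases "g = Tip j \<and> w = Hub h")
  case False
  then have "u' g \<otimes> up h j \<otimes> u w = \<zero>"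
    using up_u[of h j w] u'_up[of g h j] by (cases "g = Tip j") (simp_all add: m_assoc)
  then show ?thesis by (simp add: blk_zero)
next
  case True
  show ?thesis
  proof (cases h)
    case HE
    then have "u' g \<otimes> up h j \<otimes> u w = sc (inverse (p j)) \<otimes> al j"
      using True by (simp add: m_assoc up_d al_def)
    then show ?thesis using True HE al_blk by (simp add: src_def blk_sc)
  next
    case HC
    then have "u' g \<otimes> up h j \<otimes> u w = sc (inverse (p j)) \<otimes> (sc (p j) \<otimes> d (Hub HC))"
      using True by (simp add: m_assoc up_d dn_up d_d)
    then show ?thesis using True HC d_blk[of w] by (simp add: src_def blk_sc)
  next
    case HD
    then have "u' g \<otimes> up h j \<otimes> u w = sc (inverse (p j)) \<otimes> (sc (- inverse (p T0)) \<otimes>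
        (dn HC j \<otimes> (up HD j \<otimes> (dn HD T0 \<otimes> up HC T0))))"
      using True by (simp add: m_assoc sc_left_commute[of "up HD j"] sc_left_commute[of "dn HC j"])
    then show ?thesis using True HD psi_phi_blk by (simp add: src_def blk_sc)
  qed
qed

lemma dn_blk: "u' g \<otimes> dn h j \<otimes> u w \<in> blk (src g) (src w)"
proof (cases "g = Hub h \<and> w = Tip j")
  case False
  then have "u' g \<otimes> dn h j \<otimes> u w = \<zero>"
    using dn_u[of h j w] u'_dn[of g h j] by (cases "g = Hub h") (simp_all add: m_assoc)
  then show ?thesis by (simp add: blk_zero)
next
  case True
  show ?thesis
  proof (cases h)
    case HE
    then have "u' g \<otimes> dn h j \<otimes> u w = be j"
      using True by (simp add: d_dn be_def)
    then show ?thesis using True HE be_blk by (simp add: src_def)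
  next
    case HC
    then have "u' g \<otimes> dn h j \<otimes> u w = sc (p j) \<otimes> d (Hub HC)"
      using True by (simp add: d_dn dn_up)
    then show ?thesis using True HC d_blk[of g] by (simp add: src_def blk_sc)
  next
    case HD
    then have "u' g \<otimes> dn h j \<otimes> u w = sc (inverse (p T0)) \<otimes>
        (dn HC T0 \<otimes> (up HD T0 \<otimes> (dn HD j \<otimes> up HC j)))"
      using True by (simp add: m_assoc)
    then show ?thesis using True HD psi_phi_blk by (simp add: src_def blk_sc)
  qed
qed

text \<open>The elements \<open>u' g \<otimes> r \<otimes> u h\<close> are the entries of a matrix
  attached to \<open>r\<close>. As the \<open>u v \<otimes> u' v\<close> add up to one, products go
  to matrix products, so generators suffice. The entries at e and c are those of the corner
  itself.\<close>

lemma all_blk: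
  assumes "r \<in> carrier R"
  shows "u' g \<otimes> r \<otimes> u h \<in> blk (src g) (src h)"
proof -
  have uu: "u' g \<otimes> u h \<in> blk (src g) (src h)" for g h
    using d_blk[of g] blk_zero by (cases "g = h") (simp_all add: u'_u)
  have "\<forall>g h. u' g \<otimes> r \<otimes> u h \<in> blk (src g) (src h)"
  proof (rule generated[OF assms], goal_cases)
    case (1 c)
    show ?case
    proof (intro allI)
      fix g h
      have "u' g \<otimes> sc c \<otimes> u h = sc c \<otimes> (u' g \<otimes> u h)"
        by (simp add: sc_central m_assoc)
      then show "u' g \<otimes> sc c \<otimes> u h \<in> blk (src g) (src h)" using uu by (simp add: blk_sc)
    qed
  next
    case (2 v)
    then show ?case using uu blk_zero by (auto simp: u'_d)
  next
    case (5 x y)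
    then show ?case by (simp add: l_distr r_distr blk_add)
  next
    case (6 x y)
    show ?case
    proof (intro allI)
      fix g h
      have "u' g \<otimes> (x \<otimes> y) \<otimes> u h = u' g \<otimes> x \<otimes> finsum R (\<lambda>v. u v \<otimes> u' v) UNIV \<otimes> (y \<otimes> u h)"
        using 6 by (simp add: sum_u_u' m_assoc)
      also have "\<dots> = finsum R (\<lambda>v. u' g \<otimes> x \<otimes> (u v \<otimes> u' v)) UNIV \<otimes> (y \<otimes> u h)"
        using 6 by (subst finsum_rdistr) (auto simp: finite_vertex)
      also have "\<dots> = finsum R (\<lambda>v. u' g \<otimes> x \<otimes> (u v \<otimes> u' v) \<otimes> (y \<otimes> u h)) UNIV"
        using 6 by (subst finsum_ldistr) (auto simp: finite_vertex)
      also have "\<dots> = finsum R (\<lambda>v. (u' g \<otimes> x \<otimes> u v) \<otimes> (u' v \<otimes> y \<otimes> u h)) UNIV"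
        using 6 by (intro finsum_cong') (auto simp: m_assoc)
      also have "\<dots> \<in> blk (src g) (src h)"
        using 6 by (intro blk_finsum finite_vertex) (rule blk_mult, auto)
      finally show "u' g \<otimes> (x \<otimes> y) \<otimes> u h \<in> blk (src g) (src h)" .
    qed
  qed (use up_blk dn_blk in auto)
  then show ?thesis by blast
qed

theorem two_vertex_algebra:
  assumes "be T0 \<otimes> al T1 \<noteq> \<zero>" "al T0 \<otimes> be T1 \<noteq> \<zero>"
  shows "two_vertex_algebra R sc (d (Hub HE)) (d (Hub HC)) (al T0) (al T1) (be T0) (be T1)
    UNIV u u' (\<lambda>v. v = Hub HE)"
proof (intro two_vertex_algebra.intro two_vertex_algebra_axioms.intro, goal_cases)
  case (28 r)
  then show ?case using all_blk[of r "Hub HE" "Hub HE"] by (auto simp: src_def blk_def lin_def)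
next
  case (29 r)
  then show ?case using all_blk[of r "Hub HC" "Hub HC"] by (auto simp: src_def blk_def lin_def)
next
  case (30 r)
  then show ?case using all_blk[of r "Hub HC" "Hub HE"] by (auto simp: src_def blk_def lin_def)
next
  case (31 r)
  then show ?case using all_blk[of r "Hub HE" "Hub HC"] by (auto simp: src_def blk_def lin_def)
next
  case (35 w)
  show ?case using u_d[of w] by (simp add: src_def split: if_splits)
next
  case (36 w)
  show ?case using d_u'[of w] by (simp add: src_def split: if_splits)
qed (use assms k_algebra_axioms in \<open>auto simp: d_d d_al d_be al_be_same be_al_same al_be_antisym
    be_al_antisym finite_vertex u'_u src_def sum_u_u'\<close>)

end

section \<open>The free algebra and its quotient\<close>

lemma poly_mapping_sum_single: "p = (\<Sum>w\<in>Poly_Mapping.keys p. Poly_Mapping.single w (Poly_Mapping.lookup p w))"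
proof (rule poly_mapping_eqI)
  fix v
  have "(\<Sum>w\<in>Poly_Mapping.keys p. Poly_Mapping.lookup (Poly_Mapping.single w (Poly_Mapping.lookup p w)) v) =
      (\<Sum>w\<in>Poly_Mapping.keys p. if v = w then Poly_Mapping.lookup p w else 0)"
    by (intro sum.cong) (auto simp: lookup_single when_def)
  also have "\<dots> = Poly_Mapping.lookup p v"
    by (simp add: in_keys_iff)
  finally show "Poly_Mapping.lookup p v = Poly_Mapping.lookup
      (\<Sum>w\<in>Poly_Mapping.keys p. Poly_Mapping.single w (Poly_Mapping.lookup p w)) v"
    by (simp add: lookup_sum)
qed

lemma free_algebra_simps [simp]:
  "monoid.mult (free_algebra G) = (*)" "monoid.one (free_algebra G) = 1"
  "ring.zero (free_algebra G) = 0" "ring.add (free_algebra G) = (+)"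
  by (simp_all add: free_algebra_def)

lemma free_algebra_carrier:
  "p \<in> carrier (free_algebra G) \<longleftrightarrow> (\<forall>w\<in>Poly_Mapping.keys p. set (letters w) \<subseteq> G)"
  by (simp add: free_algebra_def)

lemma letters_plus [simp]: "letters (v + w) = letters v @ letters w"
  by (simp add: plus_word_def)

lemma letters_zero [simp]: "letters 0 = []"
  by (simp add: zero_word_def)

lemma free_algebra_closed:
  shows free_algebra_zero: "0 \<in> carrier (free_algebra G)"
    and free_algebra_one: "1 \<in> carrier (free_algebra G)"
    and free_algebra_add: "p \<in> carrier (free_algebra G) \<Longrightarrow> q \<in> carrier (free_algebra G) \<Longrightarrow>
      p + q \<in> carrier (free_algebra G)"
    and free_algebra_minus: "p \<in> carrier (free_algebra G) \<Longrightarrow> - p \<in> carrier (free_algebra G)"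
    and free_algebra_diff: "p \<in> carrier (free_algebra G) \<Longrightarrow> q \<in> carrier (free_algebra G) \<Longrightarrow>
      p - q \<in> carrier (free_algebra G)"
    and free_algebra_mult: "p \<in> carrier (free_algebra G) \<Longrightarrow> q \<in> carrier (free_algebra G) \<Longrightarrow>
      p * q \<in> carrier (free_algebra G)"
    and free_algebra_gen: "s \<in> G \<Longrightarrow> gen s \<in> carrier (free_algebra G)"
    and free_algebra_scal: "scal c \<in> carrier (free_algebra G)"
proof -
  show add: "p + q \<in> carrier (free_algebra G)"
    if "p \<in> carrier (free_algebra G)" "q \<in> carrier (free_algebra G)" for p q
    using that keys_add[of p q] unfolding free_algebra_carrier by blast
  show minus: "- p \<in> carrier (free_algebra G)" if "p \<in> carrier (free_algebra G)" for p
    using that unfolding free_algebra_carrier by (simp add: in_keys_iff)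
  show "p - q \<in> carrier (free_algebra G)"
    if "p \<in> carrier (free_algebra G)" "q \<in> carrier (free_algebra G)" for p q
    using add[OF that(1) minus[OF that(2)]] by simp
  show "p * q \<in> carrier (free_algebra G)"
    if "p \<in> carrier (free_algebra G)" "q \<in> carrier (free_algebra G)" for p q
    using that keys_mult[of p q] unfolding free_algebra_carrier by fastforce
qed (auto simp: free_algebra_carrier gen_def scal_def)

lemma free_algebra_sum:
  "(\<And>i. i \<in> A \<Longrightarrow> f i \<in> carrier (free_algebra G)) \<Longrightarrow> sum f A \<in> carrier (free_algebra G)"
  by (induction A rule: infinite_finite_induct) (auto intro: free_algebra_closed)

lemma ring_free_algebra: "ring (free_algebra G)"
proof (rule ringI)
  show "abelian_group (free_algebra G)"
  proof (rule abelian_groupI)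
    show "\<exists>y\<in>carrier (free_algebra G). y \<oplus>\<^bsub>free_algebra G\<^esub> x = \<zero>\<^bsub>free_algebra G\<^esub>"
      if "x \<in> carrier (free_algebra G)" for x
      using free_algebra_minus[OF that] by (intro bexI[of _ "- x"]) auto
  qed (auto intro: free_algebra_closed simp: add_ac)
  show "Group.monoid (free_algebra G)"
    by (rule monoidI) (auto intro: free_algebra_closed simp: mult.assoc)
qed (auto simp: distrib_left distrib_right)

lemma scal_central: "p * scal c = scal c * p"
proof -
  have "(\<Sum>w\<in>K. Poly_Mapping.single w (f w)) * scal c = scal c * (\<Sum>w\<in>K. Poly_Mapping.single w (f w))"
    for K and f :: "'a word \<Rightarrow> 'b"
    by (simp add: sum_distrib_left sum_distrib_right scal_def mult_single mult.commute)
  then show ?thesis using poly_mapping_sum_single[of p] by metis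
qed

lemma scal_simps: "scal (c + d) = scal c + scal d" "scal (c * d) = scal c * scal d"
  "scal 1 = 1" "scal 0 = 0"
  by (simp_all add: scal_def single_add mult_single)

lemma free_algebra_induct [consumes 1, case_names scal gen add mult]:
  fixes p :: "'s word \<Rightarrow>\<^sub>0 'k::field"
  assumes p: "p \<in> carrier (free_algebra G)"
    and scal: "\<And>c. P (scal c)" and gen: "\<And>s. s \<in> G \<Longrightarrow> P (gen s)"
    and add: "\<And>p q. p \<in> carrier (free_algebra G) \<Longrightarrow> q \<in> carrier (free_algebra G) \<Longrightarrow> P p \<Longrightarrow> P q \<Longrightarrow> P (p + q)"
    and mult: "\<And>p q. p \<in> carrier (free_algebra G) \<Longrightarrow> q \<in> carrier (free_algebra G) \<Longrightarrow> P p \<Longrightarrow> P q \<Longrightarrow> P (p * q)"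
  shows "P p"
proof -
  have word: "Poly_Mapping.single (Word xs) (1 :: 'k) \<in> carrier (free_algebra G) \<and>
      P (Poly_Mapping.single (Word xs) (1 :: 'k))" if "set xs \<subseteq> G" for xs
    using that
  proof (induction xs)
    case Nil
    then show ?case
      using scal[of 1] free_algebra_scal[of 1] by (simp add: scal_def zero_word_def)
  next
    case (Cons x xs)
    have "Poly_Mapping.single (Word (x # xs)) (1 :: 'k) = gen x * Poly_Mapping.single (Word xs) 1"
      by (simp add: gen_def mult_single plus_word_def)
    then show ?case
      using Cons gen[of x] mult[of "gen x" "Poly_Mapping.single (Word xs) 1"]
        free_algebra_gen[of x G] free_algebra_mult by auto
  qed
  have single: "Poly_Mapping.single w c \<in> carrier (free_algebra G) \<and> P (Poly_Mapping.single w c)"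
    if "set (letters w) \<subseteq> G" for w and c :: 'k
  proof -
    have "Poly_Mapping.single w c = scal c * Poly_Mapping.single (Word (letters w)) 1"
      by (simp add: scal_def mult_single)
    then show ?thesis
      using word[OF that] mult scal free_algebra_scal free_algebra_mult by metis
  qed
  have "(\<Sum>w\<in>K. Poly_Mapping.single w (f w)) \<in> carrier (free_algebra G) \<and>
      P (\<Sum>w\<in>K. Poly_Mapping.single w (f w))"
    if "finite K" "\<And>w. w \<in> K \<Longrightarrow> set (letters w) \<subseteq> G" for K and f :: "'s word \<Rightarrow> 'k"
    using that
  proof (induction K)
    case empty
    then show ?case using scal[of 0] free_algebra_zero by (simp add: scal_simps)
  next
    case (insert w K)
    then show ?case using single[of w] add by (simp add: free_algebra_add)
  qed
  from this[of "Poly_Mapping.keys p" "Poly_Mapping.lookup p"] show ?thesis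
    using p poly_mapping_sum_single[of p] by (simp add: free_algebra_carrier)
qed

section \<open>Classes modulo the defining relations\<close>

lemma relators_closed: "relators a \<subseteq> carrier (free_algebra generators)"
proof -
  have D: "g \<in> carrier S3 \<Longrightarrow> Delta g \<in> generators" for g
    by (simp add: generators_def)
  have X: "t \<in> O23 \<Longrightarrow> Xgen t \<in> generators" for t
    by (simp add: generators_def)
  have O: "t12 \<in> O23" "t13 \<in> O23" "t23 \<in> O23"
    by (auto simp: O23_def)
  have th: "t \<otimes>\<^bsub>S3\<^esub> h \<in> carrier S3" if "t \<in> O23" "h \<in> carrier S3" for t h
  proof -
    have "t permutes {1..3}"
      using that(1) by (auto simp: O23_def intro!: permutes_swap_id)
    then show ?thesis
      using that(2) permutes_compose[of h "{1..3}" t] by (simp add: sym_group_def)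
  qed
  show ?thesis
    unfolding relators_def free_fun_def
    by (auto intro!: free_algebra_closed free_algebra_sum intro: D X O th simp del: One_nat_def)
qed

interpretation free_alg: ring "free_algebra G"
  by (rule ring_free_algebra)

lemma ideal_rel_ideal: "ideal (rel_ideal a) (free_algebra generators)"
  unfolding rel_ideal_def by (rule free_alg.genideal_ideal[OF relators_closed])

definition cls :: "((nat \<Rightarrow> nat) \<Rightarrow> 'k::field) \<Rightarrow> (sgen word \<Rightarrow>\<^sub>0 'k) \<Rightarrow> 'k alg_elem" where
  "cls a p = rel_ideal a +>\<^bsub>free_algebra generators\<^esub> p"

lemma ring_algA: "ring (algA a)"
  unfolding algA_def by (rule ideal.quotient_is_ring[OF ideal_rel_ideal])

lemma cls_hom: "cls a \<in> ring_hom (free_algebra generators) (algA a)"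
  unfolding algA_def cls_def[abs_def] by (rule ideal.rcos_ring_hom[OF ideal_rel_ideal])

lemma carrier_algA: "carrier (algA a) = cls a ` carrier (free_algebra generators)"
  unfolding algA_def cls_def FactRing_def A_RCOSETS_def' by auto

lemma cls_closed: "p \<in> carrier (free_algebra generators) \<Longrightarrow> cls a p \<in> carrier (algA a)"
  by (simp add: carrier_algA)

lemma cls_add:
  assumes "p \<in> carrier (free_algebra generators)" "q \<in> carrier (free_algebra generators)"
  shows "cls a (p + q) = cls a p \<oplus>\<^bsub>algA a\<^esub> cls a q"
  using ring_hom_add[OF cls_hom assms] by simp

lemma cls_mult:
  assumes "p \<in> carrier (free_algebra generators)" "q \<in> carrier (free_algebra generators)"
  shows "cls a (p * q) = cls a p \<otimes>\<^bsub>algA a\<^esub> cls a q"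
  using ring_hom_mult[OF cls_hom assms] by simp

lemma cls_one: "cls a 1 = \<one>\<^bsub>algA a\<^esub>"
  using ring_hom_one[OF cls_hom] by simp

lemma cls_zero: "cls a 0 = \<zero>\<^bsub>algA a\<^esub>"
  using ring_hom_zero[OF cls_hom ring_free_algebra ring_algA] by simp

lemma cls_eq:
  assumes "p \<in> carrier (free_algebra generators)" "q \<in> carrier (free_algebra generators)"
    "p - q \<in> rel_ideal a"
  shows "cls a p = cls a q"
proof -
  interpret I: ideal "rel_ideal a" "free_algebra generators" by (rule ideal_rel_ideal)
  have "p \<in> rel_ideal a +>\<^bsub>free_algebra generators\<^esub> q"
    unfolding a_r_coset_def' using assms(3) by (auto intro: bexI[of _ "p - q"])
  then show ?thesis
    unfolding cls_def using assms(2) I.a_repr_independence' by metis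
qed

lemma cls_relator:
  assumes "p \<in> carrier (free_algebra generators)" "q \<in> carrier (free_algebra generators)"
    "p - q \<in> relators a"
  shows "cls a p = cls a q"
  using assms free_alg.genideal_self[OF relators_closed] by (intro cls_eq) (auto simp: rel_ideal_def)

lemma cls_sum:
  assumes "finite A" "\<And>i. i \<in> A \<Longrightarrow> f i \<in> carrier (free_algebra generators)"
  shows "cls a (sum f A) = finsum (algA a) (\<lambda>i. cls a (f i)) A"
  using assms
proof (induction A)
  case empty
  interpret A: ring "algA a" by (rule ring_algA)
  show ?case by (simp add: cls_zero)
next
  case (insert i A)
  interpret A: ring "algA a" by (rule ring_algA)
  have "(\<lambda>i. cls a (f i)) \<in> A \<rightarrow> carrier (algA a)" "cls a (f i) \<in> carrier (algA a)"
    using insert cls_closed by auto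
  then show ?case using insert by (simp add: cls_add free_algebra_sum)
qed

lemma k_algebra_algA: "k_algebra (algA a) (\<lambda>c. cls a (scal c))"
proof (intro k_algebra.intro k_algebra_axioms.intro ring_algA)
  show "x \<otimes>\<^bsub>algA a\<^esub> cls a (scal c) = cls a (scal c) \<otimes>\<^bsub>algA a\<^esub> x"
    if "x \<in> carrier (algA a)" for x c
    using that unfolding carrier_algA
    by (auto simp: free_algebra_scal scal_central simp flip: cls_mult)
qed (simp_all add: cls_closed free_algebra_scal scal_simps cls_add cls_mult cls_one)

lemma algA_induct [consumes 1, case_names scal gen add mult]:
  assumes r: "r \<in> carrier (algA a)"
    and "\<And>c. P (cls a (scal c))" and "\<And>s. s \<in> generators \<Longrightarrow> P (cls a (gen s))"
    and "\<And>x y. x \<in> carrier (algA a) \<Longrightarrow> y \<in> carrier (algA a) \<Longrightarrow> P x \<Longrightarrow> P y \<Longrightarrow> P (x \<oplus>\<^bsub>algA a\<^esub> y)"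
    and "\<And>x y. x \<in> carrier (algA a) \<Longrightarrow> y \<in> carrier (algA a) \<Longrightarrow> P x \<Longrightarrow> P y \<Longrightarrow> P (x \<otimes>\<^bsub>algA a\<^esub> y)"
  shows "P r"
proof -
  obtain p where p: "p \<in> carrier (free_algebra generators)" "r = cls a p"
    using r carrier_algA by blast
  have "P (cls a p)"
    using p(1) by (induction rule: free_algebra_induct) (auto simp: assms cls_add cls_mult cls_closed)
  then show ?thesis using p by simp
qed

section \<open>The symmetric group on three letters\<close>

fun nxt :: "tip \<Rightarrow> tip" where "nxt T0 = T1" | "nxt T1 = T2" | "nxt T2 = T0"
fun prv :: "tip \<Rightarrow> tip" where "prv T0 = T2" | "prv T1 = T0" | "prv T2 = T1"

text \<open>The numbering makes c = (13)(23) the product of the transpositions at \<open>T0\<close>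
  and \<open>T1\<close>, and makes the change from one hub to another a cyclic shift of
  labels.\<close>

fun tr :: "tip \<Rightarrow> nat \<Rightarrow> nat" where "tr T0 = t13" | "tr T1 = t23" | "tr T2 = t12"

text \<open>The hubs are the even permutations and the tips the odd ones. The arrow between \<open>Hub h\<close> and
  \<open>Tip j\<close>, in either direction, is multiplication by \<open>tr (lab h j)\<close>.\<close>

fun perm :: "vertex \<Rightarrow> nat \<Rightarrow> nat" where
  "perm (Hub HE) = id"
| "perm (Hub HC) = t13 \<circ> t23"
| "perm (Hub HD) = t23 \<circ> t13"
| "perm (Tip j) = tr j"

fun lab :: "hub \<Rightarrow> tip \<Rightarrow> tip" where "lab HE j = j" | "lab HC j = prv j" | "lab HD j = nxt j"

text \<open>If t is the label of an arrow and g one of its ends, this is the label of the conjugate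
  of t by g. Both ends give the same conjugate because they differ by left multiplication by t, so f
  has one value for both.\<close>

fun conj_lab :: "hub \<Rightarrow> tip \<Rightarrow> tip" where
  "conj_lab HE j = j" | "conj_lab HC j = nxt j" | "conj_lab HD j = prv j"

lemma S3_simps: "monoid.mult S3 = (\<circ>)" "\<one>\<^bsub>S3\<^esub> = id" "g \<in> carrier S3 \<longleftrightarrow> g permutes {1..3}"
  by (simp_all add: sym_group_def)

lemma group_S3: "group S3"
  by (rule sym_group_is_group)

lemma tr_perm_hub: "tr (lab h j) \<circ> perm (Hub h) = perm (Tip j)"
  by (cases h; cases j) (auto simp: fun_eq_iff transpose_def)

lemma tr_perm_tip: "tr (lab h j) \<circ> perm (Tip j) = perm (Hub h)"
  by (cases h; cases j) (auto simp: fun_eq_iff transpose_def)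

lemma tr_conj_hub: "tr (lab h j) \<circ> perm (Hub h) = perm (Hub h) \<circ> tr (conj_lab h j)"
  by (cases h; cases j) (auto simp: fun_eq_iff transpose_def)

lemma tr_conj_tip: "tr (lab h j) \<circ> perm (Tip j) = perm (Tip j) \<circ> tr (conj_lab h j)"
  by (cases h; cases j) (auto simp: fun_eq_iff transpose_def)

lemma perm_in_S3: "perm v \<in> carrier S3"
proof -
  have tr: "tr j permutes {1..3}" for j
    by (cases j) (auto intro!: permutes_swap_id)
  then have "tr T0 \<circ> tr T1 permutes {1..3}" "tr T1 \<circ> tr T0 permutes {1..3}"
    by (blast intro: permutes_compose)+
  then show ?thesis
    using tr by (cases v rule: perm.cases) (auto simp: S3_simps permutes_id simp del: One_nat_def)
qed

text \<open>The values at 1 and 2 tell the six permutations apart.\<close>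

lemma inj_perm: "inj perm"
proof -
  have "v = w" if "perm v 1 = perm w 1" "perm v 2 = perm w 2" for v w
  proof -
    have "v \<in> {Hub HE, Hub HC, Hub HD, Tip T0, Tip T1, Tip T2}"
      "w \<in> {Hub HE, Hub HC, Hub HD, Tip T0, Tip T1, Tip T2}"
      using UNIV_vertex by blast+
    then show ?thesis using that by (auto simp: transpose_def)
  qed
  then show ?thesis by (auto simp: inj_def)
qed

lemma range_perm: "range perm = carrier S3"
proof (rule card_subset_eq)
  have c: "card (carrier S3) = 6"
    by (simp add: sym_group_card_carrier fact_numeral)
  then show "finite (carrier S3)" using card.infinite by fastforce
  show "range perm \<subseteq> carrier S3" using perm_in_S3 by auto
  show "card (range perm) = card (carrier S3)"
    unfolding c card_image[OF inj_perm] by (simp add: UNIV_vertex)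
qed

lemma perm_eq_iff [simp]: "perm v = perm w \<longleftrightarrow> v = w"
  using inj_perm by (auto simp: inj_def)

lemma bij_betw_perm: "bij_betw perm UNIV (carrier S3)"
  by (simp add: bij_betw_def inj_perm range_perm)

lemma O23_eq: "O23 = range tr"
proof -
  have "(UNIV :: tip set) = {T0, T1, T2}" by (rule UNIV_eq_I) (metis insertCI tip.exhaust)
  then have "range tr = tr ` {T0, T1, T2}" by simp
  then show ?thesis by (auto simp: O23_def)
qed

text \<open>At hub c the label and its conjugate are the two neighbours of \<open>j\<close> in the
  cyclic order, at d they are exchanged, and at e they coincide. Hence f takes this value, its
  negative, and zero.\<close>

definition diff_weight :: "((nat \<Rightarrow> nat) \<Rightarrow> 'k::field) \<Rightarrow> tip \<Rightarrow> 'k" where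
  "diff_weight a j = a (tr (prv j)) - a (tr (nxt j))"

lemma f_val_conj:
  assumes "g \<in> carrier S3" "t \<in> carrier S3" "s \<in> carrier S3" "t \<circ> g = g \<circ> s"
  shows "f_val a t g = a t - a s"
proof -
  interpret group S3 by (rule group_S3)
  have "inv\<^bsub>S3\<^esub> g \<otimes>\<^bsub>S3\<^esub> t \<otimes>\<^bsub>S3\<^esub> g = inv\<^bsub>S3\<^esub> g \<otimes>\<^bsub>S3\<^esub> (g \<otimes>\<^bsub>S3\<^esub> s)"
    using assms by (subst m_assoc) (simp_all add: S3_simps(1) del: sym_group_inv_equality)
  also have "\<dots> = s"
    using assms by (simp add: m_assoc[symmetric] del: sym_group_inv_equality)
  finally show ?thesis by (simp add: f_val_def)
qed

lemma tr_in_S3: "tr j \<in> carrier S3"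
  using perm_in_S3[of "Tip j"] by simp

lemma f_val_hub: "f_val a (tr (lab h j)) (perm (Hub h)) = hub_weight (diff_weight a) h j"
  unfolding f_val_conj[OF perm_in_S3 tr_in_S3 tr_in_S3 tr_conj_hub]
  by (cases h) (simp_all add: diff_weight_def)

lemma f_val_tip: "f_val a (tr (lab h j)) (perm (Tip j)) = hub_weight (diff_weight a) h j"
  unfolding f_val_conj[OF perm_in_S3 tr_in_S3 tr_in_S3 tr_conj_tip]
  by (cases h) (simp_all add: diff_weight_def)

lemma diff_weight_nz: "generic a \<Longrightarrow> diff_weight a j \<noteq> 0"
  by (cases j) (auto simp: diff_weight_def generic_def)

section \<open>The algebra as an algebra of double arrows\<close>

definition scA :: "((nat \<Rightarrow> nat) \<Rightarrow> 'k::field) \<Rightarrow> 'k \<Rightarrow> 'k alg_elem" where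
  "scA a c = cls a (scal c)"
definition dA :: "((nat \<Rightarrow> nat) \<Rightarrow> 'k::field) \<Rightarrow> vertex \<Rightarrow> 'k alg_elem" where
  "dA a v = cls a (gen (Delta (perm v)))"
definition xA :: "((nat \<Rightarrow> nat) \<Rightarrow> 'k::field) \<Rightarrow> tip \<Rightarrow> 'k alg_elem" where
  "xA a j = cls a (gen (Xgen (tr j)))"
text \<open>The idempotent on the right selects the weight at which the arrow starts.\<close>

definition upA :: "((nat \<Rightarrow> nat) \<Rightarrow> 'k::field) \<Rightarrow> hub \<Rightarrow> tip \<Rightarrow> 'k alg_elem" where
  "upA a h j = xA a (lab h j) \<otimes>\<^bsub>algA a\<^esub> dA a (Hub h)"
definition dnA :: "((nat \<Rightarrow> nat) \<Rightarrow> 'k::field) \<Rightarrow> hub \<Rightarrow> tip \<Rightarrow> 'k alg_elem" where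
  "dnA a h j = xA a (lab h j) \<otimes>\<^bsub>algA a\<^esub> dA a (Tip j)"

lemma gen_closed:
  "gen (Delta (perm v)) \<in> carrier (free_algebra generators)"
  "gen (Xgen (tr j)) \<in> carrier (free_algebra generators)"
  by (auto intro!: free_algebra_gen simp: generators_def perm_in_S3 O23_eq)

lemmas fa_closed = gen_closed free_algebra_zero free_algebra_one free_algebra_add free_algebra_mult
  free_algebra_scal

lemma xA_dA_closed: "dA a v \<in> carrier (algA a)" "xA a j \<in> carrier (algA a)"
  by (simp_all add: dA_def xA_def cls_closed gen_closed)

lemma dA_dA: "dA a v \<otimes>\<^bsub>algA a\<^esub> dA a w = (if v = w then dA a v else \<zero>\<^bsub>algA a\<^esub>)"
proof -
  have "gen (Delta (perm v)) * gen (Delta (perm w)) -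
      (if perm v = perm w then gen (Delta (perm v)) else 0) \<in> relators a"
    unfolding relators_def using perm_in_S3 by blast
  then have "cls a (gen (Delta (perm v)) * gen (Delta (perm w))) =
      cls a (if v = w then gen (Delta (perm v)) else 0)"
    by (intro cls_relator) (auto simp: fa_closed)
  then show ?thesis by (auto simp: dA_def cls_mult fa_closed cls_zero)
qed

lemma sum_perm: "(\<Sum>g\<in>carrier S3. f g) = (\<Sum>v\<in>UNIV. f (perm v))"
  by (rule sum.reindex_bij_betw[OF bij_betw_perm, symmetric])

lemma sum_dA: "finsum (algA a) (dA a) UNIV = \<one>\<^bsub>algA a\<^esub>"
proof -
  have "cls a (\<Sum>v\<in>UNIV. gen (Delta (perm v))) = cls a 1"
    by (rule cls_relator) (auto simp: relators_def sum_perm intro!: free_algebra_sum fa_closed)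
  then show ?thesis
    by (simp add: cls_sum finite_vertex fa_closed cls_one dA_def[symmetric])
qed

lemma dA_xA_gen: "dA a v \<otimes>\<^bsub>algA a\<^esub> xA a i = xA a i \<otimes>\<^bsub>algA a\<^esub> dA a w" if "tr i \<circ> perm v = perm w"
proof -
  have "gen (Delta (perm v)) * gen (Xgen (tr i)) -
      gen (Xgen (tr i)) * gen (Delta (tr i \<otimes>\<^bsub>S3\<^esub> perm v)) \<in> relators a"
    unfolding relators_def using perm_in_S3 O23_eq by blast
  then have "gen (Delta (perm v)) * gen (Xgen (tr i)) - gen (Xgen (tr i)) * gen (Delta (perm w)) \<in> relators a"
    using that by (simp add: S3_simps)
  then have "cls a (gen (Delta (perm v)) * gen (Xgen (tr i))) = cls a (gen (Xgen (tr i)) * gen (Delta (perm w)))"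
    by (intro cls_relator) (auto simp: fa_closed)
  then show ?thesis by (simp add: dA_def xA_def cls_mult fa_closed)
qed

lemma cls_free_fun:
  "cls a (free_fun f) = finsum (algA a) (\<lambda>v. scA a (f (perm v)) \<otimes>\<^bsub>algA a\<^esub> dA a v) UNIV"
  unfolding free_fun_def sum_perm
  by (simp add: cls_sum finite_vertex fa_closed cls_mult dA_def scA_def)

lemma free_fun_closed: "free_fun f \<in> carrier (free_algebra generators)"
  unfolding free_fun_def sum_perm by (intro free_algebra_sum) (simp add: fa_closed)

lemma k_alg: "k_algebra (algA a) (scA a)"
  using k_algebra_algA by (simp add: scA_def[abs_def])

lemma free_fun_dA: "cls a (free_fun f) \<otimes>\<^bsub>algA a\<^esub> dA a v = scA a (f (perm v)) \<otimes>\<^bsub>algA a\<^esub> dA a v"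
proof -
  interpret k_algebra "algA a" "scA a" by (rule k_alg)
  note [simp] = xA_dA_closed
  have "cls a (free_fun f) \<otimes>\<^bsub>algA a\<^esub> dA a v =
      finsum (algA a) (\<lambda>w. (scA a (f (perm w)) \<otimes>\<^bsub>algA a\<^esub> dA a w) \<otimes>\<^bsub>algA a\<^esub> dA a v) UNIV"
    unfolding cls_free_fun by (rule finsum_ldistr) (auto simp: finite_vertex)
  also have "\<dots> = finsum (algA a) (\<lambda>w. if v = w then scA a (f (perm w)) \<otimes>\<^bsub>algA a\<^esub> dA a w
      else \<zero>\<^bsub>algA a\<^esub>) UNIV"
    by (intro finsum_cong') (auto simp: m_assoc dA_dA)
  also have "\<dots> = scA a (f (perm v)) \<otimes>\<^bsub>algA a\<^esub> dA a v"
    by (rule finsum_singleton) (auto simp: finite_vertex)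
  finally show ?thesis .
qed

lemma xA_xA: "xA a i \<otimes>\<^bsub>algA a\<^esub> xA a i \<otimes>\<^bsub>algA a\<^esub> dA a v =
    scA a (f_val a (tr i) (perm v)) \<otimes>\<^bsub>algA a\<^esub> dA a v"
proof -
  have "gen (Xgen (tr i)) * gen (Xgen (tr i)) - free_fun (f_val a (tr i)) \<in> relators a"
    unfolding relators_def using O23_eq by blast
  then have "cls a (gen (Xgen (tr i)) * gen (Xgen (tr i))) = cls a (free_fun (f_val a (tr i)))"
    by (intro cls_relator) (auto simp: fa_closed free_fun_closed)
  then show ?thesis by (simp add: xA_def cls_mult fa_closed flip: free_fun_dA)
qed

lemma xA_quadratic:
  "xA a T0 \<otimes>\<^bsub>algA a\<^esub> xA a T1 \<oplus>\<^bsub>algA a\<^esub> xA a T1 \<otimes>\<^bsub>algA a\<^esub> xA a T2 \<oplus>\<^bsub>algA a\<^esub>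
    xA a T2 \<otimes>\<^bsub>algA a\<^esub> xA a T0 = \<zero>\<^bsub>algA a\<^esub>"
  "xA a T1 \<otimes>\<^bsub>algA a\<^esub> xA a T0 \<oplus>\<^bsub>algA a\<^esub> xA a T0 \<otimes>\<^bsub>algA a\<^esub> xA a T2 \<oplus>\<^bsub>algA a\<^esub>
    xA a T2 \<otimes>\<^bsub>algA a\<^esub> xA a T1 = \<zero>\<^bsub>algA a\<^esub>"
proof -
  define y where "y i = (gen (Xgen (tr i)) :: sgen word \<Rightarrow>\<^sub>0 'a)" for i
  have y: "y i \<in> carrier (free_algebra generators)" for i
    by (simp add: y_def fa_closed)
  have "y T0 * y T1 + y T1 * y T2 + y T2 * y T0 \<in> relators a"
    "y T1 * y T0 + y T0 * y T2 + y T2 * y T1 \<in> relators a"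
    unfolding relators_def y_def tr.simps by blast+
  then have "cls a (y T0 * y T1 + y T1 * y T2 + y T2 * y T0) = cls a 0"
    "cls a (y T1 * y T0 + y T0 * y T2 + y T2 * y T1) = cls a 0"
    by (intro cls_relator; simp add: fa_closed y)+
  then show "xA a T0 \<otimes>\<^bsub>algA a\<^esub> xA a T1 \<oplus>\<^bsub>algA a\<^esub> xA a T1 \<otimes>\<^bsub>algA a\<^esub> xA a T2 \<oplus>\<^bsub>algA a\<^esub>
    xA a T2 \<otimes>\<^bsub>algA a\<^esub> xA a T0 = \<zero>\<^bsub>algA a\<^esub>"
  "xA a T1 \<otimes>\<^bsub>algA a\<^esub> xA a T0 \<oplus>\<^bsub>algA a\<^esub> xA a T0 \<otimes>\<^bsub>algA a\<^esub> xA a T2 \<oplus>\<^bsub>algA a\<^esub>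
    xA a T2 \<otimes>\<^bsub>algA a\<^esub> xA a T1 = \<zero>\<^bsub>algA a\<^esub>"
    by (simp_all add: cls_zero cls_add cls_mult fa_closed y xA_def y_def del: tr.simps)
qed

theorem double_arrows_algA:
  assumes "generic a"
  shows "double_arrows (algA a) (scA a) (diff_weight a) (dA a) (upA a) (dnA a)"
proof -
  interpret k_algebra "algA a" "scA a" by (rule k_alg)
  note [simp] = xA_dA_closed
  have d_x_hub: "dA a (Hub h) \<otimes>\<^bsub>algA a\<^esub> xA a (lab h j) = xA a (lab h j) \<otimes>\<^bsub>algA a\<^esub> dA a (Tip j)" for h j
    by (rule dA_xA_gen[OF tr_perm_hub])
  have d_x_tip: "dA a (Tip j) \<otimes>\<^bsub>algA a\<^esub> xA a (lab h j) = xA a (lab h j) \<otimes>\<^bsub>algA a\<^esub> dA a (Hub h)" for h j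
    by (rule dA_xA_gen[OF tr_perm_tip])
  \<comment> \<open>The idempotent in the middle slides through the generator to its right and
    merges with the last one.\<close>
  have dn_up: "dnA a h j \<otimes>\<^bsub>algA a\<^esub> upA a h' j =
      xA a (lab h j) \<otimes>\<^bsub>algA a\<^esub> xA a (lab h' j) \<otimes>\<^bsub>algA a\<^esub> dA a (Hub h')" for h h' j
  proof -
    have "dnA a h j \<otimes>\<^bsub>algA a\<^esub> upA a h' j =
        xA a (lab h j) \<otimes>\<^bsub>algA a\<^esub> (dA a (Tip j) \<otimes>\<^bsub>algA a\<^esub> xA a (lab h' j)) \<otimes>\<^bsub>algA a\<^esub> dA a (Hub h')"
      by (simp add: upA_def dnA_def m_assoc)
    then show ?thesis unfolding d_x_tip by (simp add: m_assoc dA_dA)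
  qed
  have up_dn: "upA a h i \<otimes>\<^bsub>algA a\<^esub> dnA a h j =
      xA a (lab h i) \<otimes>\<^bsub>algA a\<^esub> xA a (lab h j) \<otimes>\<^bsub>algA a\<^esub> dA a (Tip j)" for h i j
  proof -
    have "upA a h i \<otimes>\<^bsub>algA a\<^esub> dnA a h j =
        xA a (lab h i) \<otimes>\<^bsub>algA a\<^esub> (dA a (Hub h) \<otimes>\<^bsub>algA a\<^esub> xA a (lab h j)) \<otimes>\<^bsub>algA a\<^esub> dA a (Tip j)"
      by (simp add: upA_def dnA_def m_assoc)
    then show ?thesis unfolding d_x_hub by (simp add: m_assoc dA_dA)
  qed
  \<comment> \<open>The quadratic relations restricted to a single starting weight.\<close>
  have quad: "xA a T0 \<otimes>\<^bsub>algA a\<^esub> xA a T1 \<otimes>\<^bsub>algA a\<^esub> dA a v \<oplus>\<^bsub>algA a\<^esub>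
      (xA a T1 \<otimes>\<^bsub>algA a\<^esub> xA a T2 \<otimes>\<^bsub>algA a\<^esub> dA a v \<oplus>\<^bsub>algA a\<^esub>
       xA a T2 \<otimes>\<^bsub>algA a\<^esub> xA a T0 \<otimes>\<^bsub>algA a\<^esub> dA a v) = \<zero>\<^bsub>algA a\<^esub>"
    "xA a T1 \<otimes>\<^bsub>algA a\<^esub> xA a T0 \<otimes>\<^bsub>algA a\<^esub> dA a v \<oplus>\<^bsub>algA a\<^esub>
      (xA a T0 \<otimes>\<^bsub>algA a\<^esub> xA a T2 \<otimes>\<^bsub>algA a\<^esub> dA a v \<oplus>\<^bsub>algA a\<^esub>
       xA a T2 \<otimes>\<^bsub>algA a\<^esub> xA a T1 \<otimes>\<^bsub>algA a\<^esub> dA a v) = \<zero>\<^bsub>algA a\<^esub>" for v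
    using arg_cong[OF xA_quadratic(1)[of a], of "\<lambda>z. z \<otimes>\<^bsub>algA a\<^esub> dA a v"]
      arg_cong[OF xA_quadratic(2)[of a], of "\<lambda>z. z \<otimes>\<^bsub>algA a\<^esub> dA a v"]
    by (simp_all add: l_distr a_assoc)
  show ?thesis
  proof (intro double_arrows.intro double_arrows_axioms.intro, goal_cases)
    case 1
    show ?case by (rule k_alg)
  next
    case (5 j)
    show ?case using assms by (rule diff_weight_nz)
  next
    case (6 v w)
    show ?case by (rule dA_dA)
  next
    case 7
    show ?case by (rule sum_dA)
  next
    case (8 h j)
    show ?case by (simp add: upA_def m_assoc dA_dA)
  next
    case (9 j h)
    have "dA a (Tip j) \<otimes>\<^bsub>algA a\<^esub> upA a h j = (dA a (Tip j) \<otimes>\<^bsub>algA a\<^esub> xA a (lab h j)) \<otimes>\<^bsub>algA a\<^esub> dA a (Hub h)"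
      by (simp add: upA_def m_assoc)
    then show ?case unfolding d_x_tip by (simp add: upA_def m_assoc dA_dA)
  next
    case (10 h j)
    show ?case by (simp add: dnA_def m_assoc dA_dA)
  next
    case (11 h j)
    have "dA a (Hub h) \<otimes>\<^bsub>algA a\<^esub> dnA a h j = (dA a (Hub h) \<otimes>\<^bsub>algA a\<^esub> xA a (lab h j)) \<otimes>\<^bsub>algA a\<^esub> dA a (Tip j)"
      by (simp add: dnA_def m_assoc)
    then show ?case unfolding d_x_hub by (simp add: dnA_def m_assoc dA_dA)
  next
    case (12 h j)
    show ?case unfolding dn_up xA_xA f_val_hub by simp
  next
    case (13 h j)
    show ?case unfolding up_dn xA_xA f_val_tip by simp
  next
    \<comment> \<open>For distinct hubs the pairs of labels at the three tips run through the terms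
      of one of the two quadratic relations.\<close>
    case (14 h h')
    then show ?case
      unfolding dn_up using quad[of "Hub h'"] by (cases h; cases h') (simp_all add: a_ac)
  next
    case (15 i j)
    then show ?case
      unfolding up_dn using quad[of "Tip j"] by (cases i; cases j) (simp_all add: a_ac)
  next
    case (16 r P)
    \<comment> \<open>Each generator is the sum of its products with the six weight idempotents, and
      every such product is an arrow up or down.\<close>
    have x_d: "P (xA a i \<otimes>\<^bsub>algA a\<^esub> dA a v)" for i v
    proof (cases v)
      case (Hub h)
      obtain j where "lab h j = i" by (cases h; cases i) (metis lab.simps nxt.simps prv.simps)+
      then show ?thesis using Hub 16(4)[of h j] by (simp add: upA_def)
    next
      case (Tip j)
      obtain h where "lab h j = i" by (cases i; cases j) (metis lab.simps nxt.simps prv.simps)+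
      then show ?thesis using Tip 16(5)[of h j] by (simp add: dnA_def)
    qed
    have x: "P (xA a i)" for i
    proof -
      have "xA a i = xA a i \<otimes>\<^bsub>algA a\<^esub> finsum (algA a) (dA a) UNIV"
        by (simp add: sum_dA)
      also have "\<dots> = finsum (algA a) (\<lambda>v. xA a i \<otimes>\<^bsub>algA a\<^esub> dA a v) UNIV"
        by (rule finsum_rdistr) (auto simp: finite_vertex)
      finally have eq: "xA a i = \<dots>" .
      have "P (finsum (algA a) (\<lambda>v. xA a i \<otimes>\<^bsub>algA a\<^esub> dA a v) V)" for V
      proof (induction V rule: infinite_finite_induct)
        case (insert v V)
        then show ?case using 16(6) x_d by simp
      next
        case empty
        show ?case using 16(2)[of 0] sc_zero by simp
      next
        case (infinite V)
        then show ?case using finite_vertex finite_subset subset_UNIV by blast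
      qed
      then show ?thesis using eq by metis
    qed
    show ?case
      using 16(1)
    proof (induction rule: algA_induct)
      case (scal c)
      show ?case using 16(2) by (simp add: scA_def)
    next
      case (gen s)
      then consider g where "s = Delta g" "g \<in> carrier S3" | t where "s = Xgen t" "t \<in> O23"
        by (auto simp: generators_def)
      then show ?case
      proof cases
        case 1
        then obtain v where "g = perm v" using range_perm by blast
        then show ?thesis using 1 16(3)[of v] by (simp add: dA_def)
      next
        case 2
        then obtain i where "t = tr i" using O23_eq by blast
        then show ?thesis using 2 x[of i] by (simp add: xA_def)
      qed
    qed (use 16(6,7) in auto)
  qed (simp_all add: upA_def dnA_def)
qed

section \<open>Modules with a weight basis\<close>

lemma gen_act_sum:
  "gen_act I b s (\<lambda>j. \<Sum>k\<in>K. c k * f k j) = (\<lambda>j. \<Sum>k\<in>K. c k * gen_act I b s (f k) j)"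
proof
  fix j
  have "gen_act I b s (\<lambda>j. \<Sum>k\<in>K. c k * f k j) j = (\<Sum>i\<in>I. \<Sum>k\<in>K. c k * (f k i * b s i j))"
    by (simp add: gen_act_def sum_distrib_right mult.assoc)
  also have "\<dots> = (\<Sum>k\<in>K. c k * gen_act I b s (f k) j)"
    by (subst sum.swap) (simp add: gen_act_def sum_distrib_left)
  finally show "gen_act I b s (\<lambda>j. \<Sum>k\<in>K. c k * f k j) j = (\<Sum>k\<in>K. c k * gen_act I b s (f k) j)" .
qed

lemma foldr_gen_act_sum:
  "foldr (gen_act I b) ws (\<lambda>j. \<Sum>k\<in>K. c k * f k j) = (\<lambda>j. \<Sum>k\<in>K. c k * foldr (gen_act I b) ws (f k) j)"
  by (induction ws) (simp_all add: gen_act_sum)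

lemma free_act_superset:
  assumes "finite K" "Poly_Mapping.keys p \<subseteq> K"
  shows "free_act I b p v j = (\<Sum>w\<in>K. Poly_Mapping.lookup p w * foldr (gen_act I b) (letters w) v j)"
  unfolding free_act_def using assms
  by (intro sum.mono_neutral_left) (auto simp: in_keys_iff)

lemma free_act_add: "free_act I b (p + q) v = (\<lambda>j. free_act I b p v j + free_act I b q v j)"
proof
  fix j
  let ?K = "Poly_Mapping.keys p \<union> Poly_Mapping.keys q"
  have "Poly_Mapping.keys (p + q) \<subseteq> ?K" by (rule keys_add)
  then show "free_act I b (p + q) v j = free_act I b p v j + free_act I b q v j"
    using free_act_superset[of ?K "p + q" I b v j] free_act_superset[of ?K p I b v j]
      free_act_superset[of ?K q I b v j]
    by (simp add: lookup_add distrib_right sum.distrib)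
qed

lemma free_act_zero: "free_act I b 0 v = (\<lambda>_. 0)"
  by (simp add: free_act_def)

lemma free_act_sum: "free_act I b (sum f A) v = (\<lambda>j. \<Sum>k\<in>A. free_act I b (f k) v j)"
  by (induction A rule: infinite_finite_induct) (simp_all add: free_act_zero free_act_add)

lemma free_act_single:
  "free_act I b (Poly_Mapping.single w c) v = (\<lambda>j. c * foldr (gen_act I b) (letters w) v j)"
  by (rule ext, subst free_act_superset[of "{w}"]) simp_all

lemma free_act_scal: "free_act I b (scal c) v = (\<lambda>j. c * v j)"
  by (simp add: scal_def free_act_single)

lemma free_act_one: "free_act I b 1 v = v"
  using free_act_scal[of I b 1 v] by (simp add: scal_simps)

lemma free_act_gen: "free_act I b (gen s) v = gen_act I b s v"
  by (simp add: gen_def free_act_single)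

lemma free_act_minus: "free_act I b (- p) v = (\<lambda>j. - free_act I b p v j)"
  by (simp add: free_act_def sum_negf)

lemma free_act_diff: "free_act I b (p - q) v = (\<lambda>j. free_act I b p v j - free_act I b q v j)"
  using free_act_add[of I b p "- q" v] by (simp add: free_act_minus)

lemma free_act_mult: "free_act I b (p * q) v = free_act I b p (free_act I b q v)"
proof -
  let ?P = "Poly_Mapping.keys p" and ?Q = "Poly_Mapping.keys q"
  have "p * q = (\<Sum>w\<in>?P. Poly_Mapping.single w (Poly_Mapping.lookup p w)) *
      (\<Sum>w\<in>?Q. Poly_Mapping.single w (Poly_Mapping.lookup q w))"
    using poly_mapping_sum_single[of p] poly_mapping_sum_single[of q] by simp
  also have "\<dots> = (\<Sum>w\<in>?P. \<Sum>w'\<in>?Q.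
      Poly_Mapping.single (w + w') (Poly_Mapping.lookup p w * Poly_Mapping.lookup q w'))"
    by (simp add: sum_product mult_single)
  finally have "free_act I b (p * q) v = (\<lambda>j. \<Sum>w\<in>?P. \<Sum>w'\<in>?Q. Poly_Mapping.lookup p w *
      Poly_Mapping.lookup q w' * foldr (gen_act I b) (letters w) (foldr (gen_act I b) (letters w') v) j)"
    by (simp add: free_act_sum free_act_single)
  also have "\<dots> = free_act I b p (free_act I b q v)"
    unfolding free_act_def[of I b q] unfolding free_act_def[of I b p] foldr_gen_act_sum
    by (simp add: sum_distrib_left mult.assoc)
  finally show ?thesis .
qed

lemma free_act_distrib:
  "free_act I b p (\<lambda>j. v j + w j) = (\<lambda>j. free_act I b p v j + free_act I b p w j)"
proof -
  \<comment> \<open>A sum indexed by \<open>bool\<close> turns additivity into an instance of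
    \<open>foldr_gen_act_sum\<close>.\<close>
  have "foldr (gen_act I b) ws (\<lambda>j. v j + w j) =
      (\<lambda>j. foldr (gen_act I b) ws v j + foldr (gen_act I b) ws w j)" for ws
    using foldr_gen_act_sum[of I b ws "\<lambda>_. 1" "\<lambda>k. if k then v else w" "UNIV :: bool set"]
    by (simp add: UNIV_bool add.commute)
  then show ?thesis by (simp add: free_act_def distrib_left sum.distrib)
qed

lemma free_act_null: "free_act I b p (\<lambda>_. 0) = (\<lambda>_. 0)"
proof -
  have "foldr (gen_act I b) ws (\<lambda>_. 0) = (\<lambda>_. 0)" for ws
    by (induction ws) (simp_all add: gen_act_def)
  then show ?thesis by (simp add: free_act_def)
qed

text \<open>\<open>tp i\<close> and \<open>hb i\<close> invert \<open>lab\<close>: they give the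
  other end of the arrow with label \<open>i\<close> at a hub or at a tip. Left multiplication by a
  transposition becomes the computable map \<open>tv\<close> on vertices.\<close>

fun tp :: "tip \<Rightarrow> hub \<Rightarrow> tip" where "tp i HE = i" | "tp i HC = nxt i" | "tp i HD = prv i"
definition hb :: "tip \<Rightarrow> tip \<Rightarrow> hub" where
  "hb i j = (if i = j then HE else if i = prv j then HC else HD)"
fun tv :: "tip \<Rightarrow> vertex \<Rightarrow> vertex" where
  "tv i (Hub h) = Tip (tp i h)" | "tv i (Tip j) = Hub (hb i j)"

lemma lab_tp: "lab h (tp i h) = i"
  by (cases h; cases i) simp_all

lemma lab_hb: "lab (hb i j) j = i"
  by (cases i; cases j) (simp_all add: hb_def)

lemma tr_perm: "tr i \<circ> perm v = perm (tv i v)"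
proof (cases v)
  case (Hub h)
  then show ?thesis using tr_perm_hub[of h "tp i h"] by (simp add: lab_tp)
next
  case (Tip j)
  then show ?thesis using tr_perm_tip[of "hb i j" j] by (simp add: lab_hb)
qed

lemma tv_tv: "tv i (tv i v) = v"
proof -
  have "tr i \<circ> (tr i \<circ> perm v) = perm v"
    by (cases i) (simp_all add: fun_eq_iff)
  then show ?thesis by (simp only: tr_perm perm_eq_iff)
qed

text \<open>The value of f for the label \<open>i\<close> at a vertex, read as the round trip weight
  of the arrow with that label.\<close>

definition weight :: "(tip \<Rightarrow> 'k::field) \<Rightarrow> tip \<Rightarrow> vertex \<Rightarrow> 'k" where
  "weight p i v = (case v of Hub h \<Rightarrow> hub_weight p h (tp i h) | Tip j \<Rightarrow> hub_weight p (hb i j) j)"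

lemma f_val_perm: "f_val a (tr i) (perm v) = weight (diff_weight a) i v"
proof (cases v)
  case (Hub h)
  then show ?thesis using f_val_hub[of a h "tp i h"] by (simp add: lab_tp weight_def)
next
  case (Tip j)
  then show ?thesis using f_val_tip[of a "hb i j" j] by (simp add: lab_hb weight_def)
qed

definition x_act :: "'i set \<Rightarrow> (sgen \<Rightarrow> 'i \<Rightarrow> 'i \<Rightarrow> 'k::field) \<Rightarrow> tip \<Rightarrow> ('i \<Rightarrow> 'k) \<Rightarrow> 'i \<Rightarrow> 'k" where
  "x_act I b t = gen_act I b (Xgen (tr t))"

text \<open>Conditions under which every relator acts as zero, so that \<open>the_elem\<close> in
  \<open>basis_module\<close> is meaningful. The relations linear in the generators indexed by
  transpositions follow from the weights \<open>wt\<close>; the quadratic ones are assumed at the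
  coordinates in \<open>I\<close>, the others being zero anyway.\<close>

locale weight_module =
  fixes a :: "(nat \<Rightarrow> nat) \<Rightarrow> 'k::field" and I :: "'i set"
    and b :: "sgen \<Rightarrow> 'i \<Rightarrow> 'i \<Rightarrow> 'k" and wt :: "'i \<Rightarrow> vertex"
  assumes finite_I: "finite I"
    and b_Delta: "i \<in> I \<Longrightarrow> b (Delta g) i = (if g = perm (wt i) then unit_vec i else (\<lambda>_. 0))"
    and b_Xgen: "i \<in> I \<Longrightarrow> b (Xgen (tr t)) i j \<noteq> 0 \<Longrightarrow> j \<in> I \<and> wt j = tv t (wt i)"
    and X_X: "(\<And>i. i \<notin> I \<Longrightarrow> v i = 0) \<Longrightarrow> j \<in> I \<Longrightarrow>
      x_act I b t (x_act I b t v) j = weight (diff_weight a) t (wt j) * v j"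
    and X_quadratic:
      "(\<And>i. i \<notin> I \<Longrightarrow> v i = 0) \<Longrightarrow> j \<in> I \<Longrightarrow>
        x_act I b T0 (x_act I b T1 v) j + x_act I b T1 (x_act I b T2 v) j + x_act I b T2 (x_act I b T0 v) j = 0"
      "(\<And>i. i \<notin> I \<Longrightarrow> v i = 0) \<Longrightarrow> j \<in> I \<Longrightarrow>
        x_act I b T1 (x_act I b T0 v) j + x_act I b T0 (x_act I b T2 v) j + x_act I b T2 (x_act I b T1 v) j = 0"
begin

abbreviation X where "X \<equiv> x_act I b"

abbreviation M :: "('k alg_elem, 'i \<Rightarrow> 'k) module" where "M \<equiv> basis_module I b"

lemma M_simps: "carrier M = {v. \<forall>i. i \<notin> I \<longrightarrow> v i = 0}" "\<zero>\<^bsub>M\<^esub> = (\<lambda>_. 0)"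
  "v \<oplus>\<^bsub>M\<^esub> w = (\<lambda>i. v i + w i)"
  by (simp_all add: basis_module_def)

lemma Delta_act:
  "gen_act I b (Delta g) v = (\<lambda>j. if j \<in> I \<and> g = perm (wt j) then v j else 0)"
proof
  fix j
  have "gen_act I b (Delta g) v j = (\<Sum>i\<in>I. if i = j then if g = perm (wt i) then v i else 0 else 0)"
    unfolding gen_act_def by (intro sum.cong) (auto simp: b_Delta unit_vec_def)
  then show "gen_act I b (Delta g) v j = (if j \<in> I \<and> g = perm (wt j) then v j else 0)"
    using finite_I by simp
qed

lemma X_support: "j \<notin> I \<Longrightarrow> X t v j = 0"
  unfolding x_act_def gen_act_def using b_Xgen by (intro sum.neutral) auto

lemma free_act_closed:
  assumes "p \<in> carrier (free_algebra generators)" "v \<in> carrier M"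
  shows "free_act I b p v \<in> carrier M"
  using assms
proof (induction arbitrary: v rule: free_algebra_induct)
  case (gen s)
  then consider g where "s = Delta g" | t where "s = Xgen (tr t)"
    unfolding generators_def O23_eq by blast
  then show ?case
    using X_support by cases (auto simp: free_act_gen Delta_act M_simps x_act_def)
qed (simp_all add: M_simps free_act_scal free_act_add free_act_mult)

lemma relator_act:
  assumes "p \<in> relators a" "v \<in> carrier M"
  shows "free_act I b p v = (\<lambda>_. 0)"
proof -
  note v = assms(2)[unfolded M_simps mem_Collect_eq, rule_format]
  have Xt: "\<exists>i. t = tr i" if "t \<in> O23" for t using that O23_eq by auto
  have gp: "\<exists>v. g = perm v" if "g \<in> carrier S3" for g using that range_perm by auto
  note acts = free_act_diff free_act_add free_act_mult free_act_gen free_act_sum free_act_zero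
    free_act_one
  have free_fun: "free_act I b (free_fun f) v = (\<lambda>j. f (perm (wt j)) * v j)" for f
  proof
    fix j
    show "free_act I b (free_fun f) v j = f (perm (wt j)) * v j"
    proof (cases "j \<in> I")
      case True
      have "free_act I b (free_fun f) v j = (\<Sum>w\<in>UNIV. if w = wt j then f (perm w) * v j else 0)"
        unfolding free_fun_def sum_perm acts free_act_scal Delta_act
        using True by (intro sum.cong) auto
      then show ?thesis by (simp add: finite_vertex)
    next
      case False
      then show ?thesis unfolding free_fun_def acts free_act_scal Delta_act using v by simp
    qed
  qed
  from assms(1) consider
      (dd) g h where "g \<in> carrier S3" "h \<in> carrier S3"
        "p = gen (Delta g) * gen (Delta h) - (if g = h then gen (Delta g) else 0)"
    | (sum) "p = (\<Sum>g\<in>carrier S3. gen (Delta g)) - 1"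
    | (dx) h t where "h \<in> carrier S3" "t \<in> O23"
        "p = gen (Delta h) * gen (Xgen t) - gen (Xgen t) * gen (Delta (t \<otimes>\<^bsub>S3\<^esub> h))"
    | (xx) t where "t \<in> O23" "p = gen (Xgen t) * gen (Xgen t) - free_fun (f_val a t)"
    | (q1) "p = gen (Xgen (tr T0)) * gen (Xgen (tr T1)) + gen (Xgen (tr T1)) * gen (Xgen (tr T2)) +
        gen (Xgen (tr T2)) * gen (Xgen (tr T0))"
    | (q2) "p = gen (Xgen (tr T1)) * gen (Xgen (tr T0)) + gen (Xgen (tr T0)) * gen (Xgen (tr T2)) +
        gen (Xgen (tr T2)) * gen (Xgen (tr T1))"
    unfolding relators_def tr.simps by blast
  then show ?thesis
  proof cases
    case dd
    then show ?thesis by (auto simp: acts Delta_act fun_eq_iff)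
  next
    case sum
    have "free_fun (\<lambda>_. 1) = (\<Sum>g\<in>carrier S3. gen (Delta g) :: sgen word \<Rightarrow>\<^sub>0 'k)"
      by (simp add: free_fun_def scal_simps)
    then show ?thesis
      using free_fun[of "\<lambda>_. 1"] by (simp add: sum free_act_diff free_act_one)
  next
    case dx
    obtain w i where wi: "h = perm w" "t = tr i" using dx Xt gp by blast
    \<comment> \<open>Coordinate \<open>j\<close> receives contributions only from basis vectors of
      weight \<open>tv i (wt j)\<close>, so cutting \<open>v\<close> down to that weight changes
      nothing.\<close>
    have "X i v j = gen_act I b (Xgen (tr i)) (gen_act I b (Delta (perm (tv i w))) v) j"
      if j: "j \<in> I" "w = wt j" for j
      unfolding x_act_def gen_act_def[of I b "Xgen (tr i)"]
    proof (rule sum.cong[OF refl])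
      fix k assume k: "k \<in> I"
      show "v k * b (Xgen (tr i)) k j = gen_act I b (Delta (perm (tv i w))) v k * b (Xgen (tr i)) k j"
      proof (cases "b (Xgen (tr i)) k j = 0")
        case False
        then have "tv i w = wt k" using b_Xgen[OF k False] j tv_tv by simp
        then show ?thesis using k by (simp add: Delta_act)
      qed simp
    qed
    moreover have "gen_act I b (Xgen (tr i)) (gen_act I b (Delta (perm (tv i w))) v) j = 0"
      if j: "j \<in> I \<longrightarrow> w \<noteq> wt j" for j
      unfolding gen_act_def[of I b "Xgen (tr i)"]
    proof (rule sum.neutral, rule ballI)
      fix k assume k: "k \<in> I"
      show "gen_act I b (Delta (perm (tv i w))) v k * b (Xgen (tr i)) k j = 0"
      proof (cases "b (Xgen (tr i)) k j = 0")
        case False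
        then have "wt j = tv i (wt k)" "j \<in> I" using b_Xgen[OF k False] by auto
        then have "tv i w \<noteq> wt k" using j tv_tv by metis
        then show ?thesis by (simp add: Delta_act)
      qed simp
    qed
    ultimately have "gen_act I b (Delta (perm w)) (gen_act I b (Xgen (tr i)) v) j =
        gen_act I b (Xgen (tr i)) (gen_act I b (Delta (perm (tv i w))) v) j" for j
      unfolding Delta_act[of "perm w"] by (auto simp: x_act_def)
    then show ?thesis
      using dx(3) by (simp add: wi acts S3_simps(1) tr_perm fun_eq_iff)
  next
    case xx
    obtain i where i: "t = tr i" using xx Xt by blast
    have "X i (X i v) j = f_val a t (perm (wt j)) * v j" for j
      using X_X[of v j i] v X_support[of j i] by (cases "j \<in> I") (simp_all add: i f_val_perm)
    then show ?thesis by (simp add: xx(2) i acts free_fun fun_eq_iff x_act_def)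
  next
    case q1
    have "X T0 (X T1 v) j + X T1 (X T2 v) j + X T2 (X T0 v) j = 0" for j
      using X_quadratic(1)[of v j] v X_support[of j] by (cases "j \<in> I") simp_all
    then show ?thesis by (simp add: q1 acts fun_eq_iff x_act_def del: tr.simps)
  next
    case q2
    have "X T1 (X T0 v) j + X T0 (X T2 v) j + X T2 (X T1 v) j = 0" for j
      using X_quadratic(2)[of v j] v X_support[of j] by (cases "j \<in> I") simp_all
    then show ?thesis by (simp add: q2 acts fun_eq_iff x_act_def del: tr.simps)
  qed
qed

text \<open>The elements acting as zero form a two-sided ideal; closure under multiplication on the
  right uses that the action preserves the carrier.\<close>

lemma rel_ideal_act:
  assumes "p \<in> rel_ideal a" "v \<in> carrier M"
  shows "free_act I b p v = (\<lambda>_. 0)"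
proof -
  let ?F = "free_algebra generators"
  define K where "K = {p \<in> carrier ?F. \<forall>v\<in>carrier M. free_act I b p v = (\<lambda>_. 0)}"
  have "ideal K ?F"
  proof (rule idealI[OF ring_free_algebra])
    show "subgroup K (add_monoid ?F)"
    proof (rule free_alg.add.subgroupI)
      show "K \<noteq> {}" unfolding K_def by (auto intro!: exI[of _ 0] simp: free_algebra_zero free_act_zero)
      show "\<ominus>\<^bsub>?F\<^esub> p \<in> K" if p: "p \<in> K" for p
      proof -
        have "\<ominus>\<^bsub>?F\<^esub> p = - p"
          using p by (intro free_alg.minus_equality) (auto simp: K_def free_algebra_minus)
        then show ?thesis
          using p by (auto simp: K_def free_act_minus free_algebra_minus)
      qed
    qed (auto simp: K_def free_act_add free_algebra_add)
  qed (auto simp: K_def free_act_mult free_algebra_mult free_act_null free_act_closed)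
  moreover have "relators a \<subseteq> K"
    using relators_closed relator_act unfolding K_def by blast
  ultimately have "rel_ideal a \<subseteq> K"
    unfolding rel_ideal_def by (rule free_alg.genideal_minimal)
  then show ?thesis using assms unfolding K_def by blast
qed

text \<open>All representatives of a class act alike, so the set passed to \<open>the_elem\<close>
  is a singleton.\<close>

lemma cls_act:
  assumes "p \<in> carrier (free_algebra generators)" "v \<in> carrier M"
  shows "cls a p \<odot>\<^bsub>M\<^esub> v = free_act I b p v"
proof -
  have "(\<lambda>p. free_act I b p v) ` cls a p = {free_act I b p v}"
  proof (intro equalityI subsetI)
    fix y assume "y \<in> (\<lambda>p. free_act I b p v) ` cls a p"
    then obtain h where "h \<in> rel_ideal a" "y = free_act I b (h + p) v"
      unfolding cls_def a_r_coset_def' by auto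
    then show "y \<in> {free_act I b p v}"
      using rel_ideal_act assms(2) by (simp add: free_act_add)
  next
    fix y assume "y \<in> {free_act I b p v}"
    moreover have "p \<in> cls a p"
    proof -
      interpret J: ideal "rel_ideal a" "free_algebra generators" by (rule ideal_rel_ideal)
      show ?thesis unfolding cls_def using J.a_rcos_self assms(1) by simp
    qed
    ultimately show "y \<in> (\<lambda>p. free_act I b p v) ` cls a p" by auto
  qed
  then show ?thesis by (simp add: basis_module_def)
qed

lemma left_module_M: "left_module (algA a) M"
proof (intro left_module.intro left_module_axioms.intro ring_algA)
  show "abelian_group M"
  proof (rule abelian_groupI)
    show "\<exists>y\<in>carrier M. y \<oplus>\<^bsub>M\<^esub> x = \<zero>\<^bsub>M\<^esub>" if "x \<in> carrier M" for x
      using that by (intro bexI[of _ "\<lambda>i. - x i"]) (auto simp: M_simps)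
  qed (auto simp: M_simps add_ac)
  show "\<one>\<^bsub>algA a\<^esub> \<odot>\<^bsub>M\<^esub> x = x" if "x \<in> carrier M" for x
    using cls_act[OF free_algebra_one that] by (simp add: cls_one free_act_one)
  fix r assume "r \<in> carrier (algA a)"
  then obtain p where p: "p \<in> carrier (free_algebra generators)" "r = cls a p"
    by (auto simp: carrier_algA)
  show "r \<odot>\<^bsub>M\<^esub> x \<in> carrier M" if "x \<in> carrier M" for x
    using p that by (simp add: cls_act free_act_closed)
  show "r \<odot>\<^bsub>M\<^esub> (x \<oplus>\<^bsub>M\<^esub> y) = r \<odot>\<^bsub>M\<^esub> x \<oplus>\<^bsub>M\<^esub> r \<odot>\<^bsub>M\<^esub> y" if "x \<in> carrier M" "y \<in> carrier M" for x y
  proof -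
    have "x \<oplus>\<^bsub>M\<^esub> y \<in> carrier M" using that by (simp add: M_simps)
    then show ?thesis using that p by (simp add: cls_act) (simp add: M_simps free_act_distrib)
  qed
  fix s assume "s \<in> carrier (algA a)"
  then obtain q where q: "q \<in> carrier (free_algebra generators)" "s = cls a q"
    by (auto simp: carrier_algA)
  show "(r \<oplus>\<^bsub>algA a\<^esub> s) \<odot>\<^bsub>M\<^esub> x = r \<odot>\<^bsub>M\<^esub> x \<oplus>\<^bsub>M\<^esub> s \<odot>\<^bsub>M\<^esub> x" if "x \<in> carrier M" for x
    using that p q
    by (simp add: cls_act free_algebra_add free_act_add M_simps(3) flip: cls_add)
  show "(r \<otimes>\<^bsub>algA a\<^esub> s) \<odot>\<^bsub>M\<^esub> x = r \<odot>\<^bsub>M\<^esub> (s \<odot>\<^bsub>M\<^esub> x)" if "x \<in> carrier M" for x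
    using that p q
    by (simp add: cls_act free_algebra_mult free_act_mult free_act_closed flip: cls_mult)
qed

lemma xA_act: "v \<in> carrier M \<Longrightarrow> xA a t \<odot>\<^bsub>M\<^esub> v = X t v"
  unfolding xA_def by (simp add: cls_act gen_closed free_act_gen x_act_def)

lemma dA_act: "v \<in> carrier M \<Longrightarrow> dA a w \<odot>\<^bsub>M\<^esub> v = (\<lambda>j. if j \<in> I \<and> w = wt j then v j else 0)"
  unfolding dA_def by (simp add: cls_act gen_closed free_act_gen Delta_act)

lemma scA_act: "v \<in> carrier M \<Longrightarrow> scA a c \<odot>\<^bsub>M\<^esub> v = (\<lambda>j. c * v j)"
  unfolding scA_def by (simp add: cls_act free_algebra_scal free_act_scal)

lemma unit_closed: "i \<in> I \<Longrightarrow> unit_vec i \<in> carrier M"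
  by (auto simp: M_simps unit_vec_def)

lemma X_unit: "i \<in> I \<Longrightarrow> X t (unit_vec i) = b (Xgen (tr t)) i"
  using finite_I by (simp add: x_act_def gen_act_def unit_vec_def if_distrib[of "\<lambda>x. x * _"] cong: if_cong)

text \<open>Weights have multiplicity one, so a weight idempotent followed by a scalar turns a
  nonzero vector of a submodule into a basis vector; \<open>trans\<close> yields all the
  others.\<close>

theorem simpleI:
  assumes "I \<noteq> {}" "inj_on wt I"
    and trans: "\<And>H i j. submodule H (algA a) M \<Longrightarrow> i \<in> I \<Longrightarrow> j \<in> I \<Longrightarrow> unit_vec i \<in> H \<Longrightarrow> unit_vec j \<in> H"
  shows "simple_module (algA a) M"
  unfolding simple_module_def
proof (intro conjI allI impI)
  interpret L: left_module "algA a" M by (rule left_module_M)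
  show "left_module (algA a) M" by (rule left_module_M)
  obtain i where i: "i \<in> I" using assms(1) by blast
  have "unit_vec i \<noteq> (\<lambda>_. 0 :: 'k)" by (auto simp: unit_vec_def fun_eq_iff)
  then show "carrier M \<noteq> {\<zero>\<^bsub>M\<^esub>}" using unit_closed[OF i] M_simps(2) by auto
  fix H assume H: "submodule H (algA a) M"
  note HD = L.submoduleD[OF H]
  have scA: "scA a c \<in> carrier (algA a)" for c
    by (simp add: scA_def cls_closed free_algebra_scal)
  show "H = {\<zero>\<^bsub>M\<^esub>} \<or> H = carrier M"
  proof (rule disjCI)
    assume "H \<noteq> carrier M"
    show "H = {\<zero>\<^bsub>M\<^esub>}"
    proof (rule ccontr)
      assume "H \<noteq> {\<zero>\<^bsub>M\<^esub>}"
      then obtain x where x: "x \<in> H" "x \<noteq> (\<lambda>_. 0)" using HD(2) M_simps(2) by auto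
      have xM: "x \<in> carrier M" using x HD by auto
      obtain k where k: "x k \<noteq> 0" using x(2) by auto
      then have kI: "k \<in> I" using xM by (auto simp: M_simps)
      have "scA a (inverse (x k)) \<odot>\<^bsub>M\<^esub> (dA a (wt k) \<odot>\<^bsub>M\<^esub> x) \<in> H"
        by (intro HD(4) scA xA_dA_closed x)
      moreover have "scA a (inverse (x k)) \<odot>\<^bsub>M\<^esub> (dA a (wt k) \<odot>\<^bsub>M\<^esub> x) = unit_vec k"
      proof -
        have "dA a (wt k) \<odot>\<^bsub>M\<^esub> x \<in> carrier M" using L.smult_closed xA_dA_closed xM by blast
        then show ?thesis
          using k kI assms(2)
          by (auto simp: scA_act dA_act xM unit_vec_def fun_eq_iff inj_on_eq_iff)
      qed
      ultimately have unit: "unit_vec j \<in> H" if "j \<in> I" for j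
        using trans[OF H kI that] by simp
      have "y \<in> H" if y: "y \<in> carrier M" for y
      proof -
        have "(\<lambda>j. \<Sum>i\<in>J. y i * unit_vec i j) \<in> H" if "finite J" "J \<subseteq> I" for J
          using that
        proof (induction J)
          case empty
          then show ?case using HD(2) by (simp add: M_simps)
        next
          case (insert i J)
          have "scA a (y i) \<odot>\<^bsub>M\<^esub> unit_vec i \<in> H"
            using HD(4)[OF scA unit] insert by simp
          then have "(\<lambda>j. y i * unit_vec i j) \<in> H"
            using insert by (simp add: scA_act unit_closed)
          from HD(3)[OF this insert.IH] insert show ?case by (simp add: M_simps)
        qed
        from this[OF finite_I] have "(\<lambda>j. \<Sum>i\<in>I. y i * unit_vec i j) \<in> H" by simp
        moreover have "(\<lambda>j. \<Sum>i\<in>I. y i * unit_vec i j) = y"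
          using y finite_I by (auto simp: unit_vec_def fun_eq_iff M_simps if_distrib[of "\<lambda>x. _ * x"] cong: if_cong)
        ultimately show ?thesis by simp
      qed
      then show False using \<open>H \<noteq> carrier M\<close> HD(1) by blast
    qed
  qed
qed

end

lemma vertex_cases:
  obtains "v = Hub HE" | "v = Hub HC" | "v = Hub HD" | "v = Tip T0" | "v = Tip T1" | "v = Tip T2"
proof -
  have "v \<in> {Hub HE, Hub HC, Hub HD, Tip T0, Tip T1, Tip T2}"
    using UNIV_vertex by blast
  with that show ?thesis by blast
qed

lemma weight_module_k_e: "weight_module a {\<one>\<^bsub>S3\<^esub>} k_e_act (\<lambda>_. Hub HE)"
  by unfold_locales (auto simp: S3_simps weight_def x_act_def gen_act_def)

section \<open>The module \<open>L\<close>\<close>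

lemma sign_perm: "sign (perm v) = (case v of Hub h \<Rightarrow> 1 | Tip j \<Rightarrow> -1)"
proof -
  have "permutation t13" "permutation t23"
    by (simp_all add: permutation_swap_id)
  then show ?thesis
    by (cases v rule: vertex_cases) (simp_all add: sign_compose sign_swap_id sign_id del: One_nat_def)
qed

definition L_index :: "(nat \<Rightarrow> nat) set" where "L_index = carrier S3 - {\<one>\<^bsub>S3\<^esub>}"

lemma L_index_iff: "perm v \<in> L_index \<longleftrightarrow> v \<noteq> Hub HE"
  using perm_in_S3[of v] perm_eq_iff[of v "Hub HE"] by (auto simp: L_index_def S3_simps simp del: perm_eq_iff)

lemma L_indexE: 
  assumes "g \<in> L_index"
  obtains v where "g = perm v" "v \<noteq> Hub HE"
proof -
  obtain v where "g = perm v" using assms range_perm by (auto simp: L_index_def)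
  with that assms L_index_iff show ?thesis by blast
qed

definition L_coeff :: "(tip \<Rightarrow> 'k::field) \<Rightarrow> tip \<Rightarrow> vertex \<Rightarrow> 'k" where
  "L_coeff p t v = (case v of Hub h \<Rightarrow> 1 | Tip j \<Rightarrow> weight p t v)"

lemma L_act_perm:
  "L_act a (Xgen (tr t)) (perm v) = (\<lambda>j. L_coeff (diff_weight a) t v * unit_vec (perm (tv t v)) j)"
  by (cases v) (simp_all add: sign_perm S3_simps(1) tr_perm f_val_perm L_coeff_def del: perm.simps tv.simps)

lemma inv_perm [simp]: "inv_into UNIV perm (perm v) = v"
  by (simp add: inv_f_f inj_perm)

lemma tv_eq_iff: "tv t v = w \<longleftrightarrow> v = tv t w"
  using tv_tv by metis

text \<open>A vector that vanishes at e may be summed over all six vertices, of which only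
  \<open>tv t w\<close> is sent to \<open>w\<close>.\<close>

lemma L_gen_act:
  assumes "v id = 0"
  shows "x_act L_index (L_act a) t v (perm w) =
    v (perm (tv t w)) * L_coeff (diff_weight a) t (tv t w)"
proof -
  have "x_act L_index (L_act a) t v (perm w) =
      (\<Sum>u\<in>UNIV - {Hub HE}. v (perm u) * L_act a (Xgen (tr t)) (perm u) (perm w))"
    unfolding x_act_def gen_act_def
  proof (rule sum.reindex_bij_betw[symmetric])
    show "bij_betw perm (UNIV - {Hub HE}) L_index"
      by (rule bij_betw_imageI) (auto intro: inj_on_subset[OF inj_perm] simp: L_index_iff elim: L_indexE)
  qed
  also have "\<dots> = (\<Sum>u\<in>UNIV. v (perm u) * L_act a (Xgen (tr t)) (perm u) (perm w))"
    using assms by (intro sum.mono_neutral_left) (auto simp: finite_vertex)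
  also have "\<dots> = (\<Sum>u\<in>UNIV. if u = tv t w then v (perm u) * L_coeff (diff_weight a) t u else 0)"
    by (intro sum.cong) (auto simp: L_act_perm unit_vec_def tv_tv simp del: L_act.simps)
  finally show ?thesis by (simp add: finite_vertex)
qed

lemma weight_module_L: "weight_module a L_index (L_act a) (inv_into UNIV perm)"
proof
  show "finite L_index"
    using finite_vertex range_perm by (metis L_index_def finite_Diff finite_imageI)
  show "L_act a (Delta g) i = (if g = perm (inv_into UNIV perm i) then unit_vec i else (\<lambda>_. 0))"
    if "i \<in> L_index" for i g
    using that by (auto elim: L_indexE)
  show "j \<in> L_index \<and> inv_into UNIV perm j = tv t (inv_into UNIV perm i)"
    if i: "i \<in> L_index" and nz: "L_act a (Xgen (tr t)) i j \<noteq> 0" for i t j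
  proof -
    obtain v where v: "i = perm v" "v \<noteq> Hub HE" using i by (rule L_indexE)
    have j: "j = perm (tv t v)" and c: "L_coeff (diff_weight a) t v \<noteq> 0"
      using nz by (auto simp: v L_act_perm unit_vec_def simp del: L_act.simps split: if_splits)
    \<comment> \<open>The arrow from a tip to e has coefficient zero, so weight e is never
      reached.\<close>
    have "tv t v \<noteq> Hub HE"
      using c v(2) by (cases v) (auto simp: L_coeff_def weight_def)
    then show ?thesis by (simp add: j v L_index_iff)
  qed
  fix v :: "(nat \<Rightarrow> nat) \<Rightarrow> 'a" and j
  assume v: "\<And>i. i \<notin> L_index \<Longrightarrow> v i = 0" and "j \<in> L_index"
  then obtain w where w: "j = perm w" "w \<noteq> Hub HE" by (auto elim: L_indexE)
  let ?X = "\<lambda>t. x_act L_index (L_act a) t"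
  have v0: "v id = 0" using v[of id] L_index_iff[of "Hub HE"] by simp
  have X: "?X t v (perm u) = v (perm (tv t u)) * L_coeff (diff_weight a) t (tv t u)" for t u
    using v0 by (rule L_gen_act)
  \<comment> \<open>The coordinate at e stays zero, so the formula applies a second time.\<close>
  have X0: "?X t v id = 0" for t
    using X[of t "Hub HE"] by (simp add: L_coeff_def weight_def hb_def)
  have XX: "?X s (?X t v) (perm u) = v (perm (tv t (tv s u))) * L_coeff (diff_weight a) t (tv t (tv s u)) *
      L_coeff (diff_weight a) s (tv s u)" for s t u
    using L_gen_act[of "?X t v" a s u, OF X0] X[of t "tv s u"] by simp
  show "?X t (?X t v) j = weight (diff_weight a) t (inv_into UNIV perm j) * v j" for t
  proof -
    have "L_coeff (diff_weight a) t w * L_coeff (diff_weight a) t (tv t w) = weight (diff_weight a) t w"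
      by (cases w rule: vertex_cases; cases t) (simp_all add: L_coeff_def weight_def hb_def)
    then show ?thesis unfolding w XX tv_tv by (simp add: mult.assoc mult.commute)
  qed
  show "?X T0 (?X T1 v) j + ?X T1 (?X T2 v) j + ?X T2 (?X T0 v) j = 0"
    unfolding w XX
    by (cases w rule: vertex_cases)
      (simp_all add: L_coeff_def weight_def hb_def diff_weight_def algebra_simps del: perm.simps)
  show "?X T1 (?X T0 v) j + ?X T0 (?X T2 v) j + ?X T2 (?X T1 v) j = 0"
    unfolding w XX
    by (cases w rule: vertex_cases)
      (simp_all add: L_coeff_def weight_def hb_def diff_weight_def algebra_simps del: perm.simps)
qed

section \<open>Modules of dimension twelve\<close>

text \<open>Every weight space is two-dimensional, with basis vectors indexed by \<^typ>\<open>bool\<close>; \<open>mat v w\<close> is the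
  matrix of the arrow from weight \<open>v\<close> to weight \<open>w\<close>.\<close>

definition pair_act ::
    "(vertex \<Rightarrow> vertex \<Rightarrow> bool \<Rightarrow> bool \<Rightarrow> 'k::field) \<Rightarrow> sgen \<Rightarrow> vertex \<times> bool \<Rightarrow> vertex \<times> bool \<Rightarrow> 'k" where
  "pair_act mat s i = (case s of
     Delta g \<Rightarrow> if g = perm (fst i) then unit_vec i else (\<lambda>_. 0)
   | Xgen t \<Rightarrow> (\<lambda>j. if t \<circ> perm (fst i) = perm (fst j) then mat (fst i) (fst j) (snd i) (snd j) else 0))"

lemma UNIV_pair: "(UNIV :: (vertex \<times> bool) set) = UNIV \<times> UNIV"
  by simp

lemma pair_gen_act:
  "x_act UNIV (pair_act mat) t v (w, c) =
    v (tv t w, False) * mat (tv t w) w False c + v (tv t w, True) * mat (tv t w) w True c"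
proof -
  have "x_act UNIV (pair_act mat) t v (w, c) =
      (\<Sum>u\<in>UNIV. \<Sum>b\<in>UNIV. v (u, b) * pair_act mat (Xgen (tr t)) (u, b) (w, c))"
    unfolding x_act_def gen_act_def UNIV_pair sum.cartesian_product by simp
  also have "\<dots> = (\<Sum>u\<in>UNIV. if u = tv t w then \<Sum>b\<in>UNIV. v (u, b) * mat u w b c else 0)"
    by (intro sum.cong) (auto simp: pair_act_def tr_perm tv_eq_iff[of t _ w])
  also have "\<dots> = (\<Sum>b\<in>UNIV. v (tv t w, b) * mat (tv t w) w b c)"
    by (simp add: finite_vertex)
  finally show ?thesis by (simp add: UNIV_bool)
qed

lemma weight_module_pairI:
  assumes "\<And>v w c t. x_act UNIV (pair_act mat) t (x_act UNIV (pair_act mat) t v) (w, c) =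
      weight (diff_weight a) t w * v (w, c)"
    and "\<And>v w c. x_act UNIV (pair_act mat) T0 (x_act UNIV (pair_act mat) T1 v) (w, c) +
      x_act UNIV (pair_act mat) T1 (x_act UNIV (pair_act mat) T2 v) (w, c) +
      x_act UNIV (pair_act mat) T2 (x_act UNIV (pair_act mat) T0 v) (w, c) = 0"
    and "\<And>v w c. x_act UNIV (pair_act mat) T1 (x_act UNIV (pair_act mat) T0 v) (w, c) +
      x_act UNIV (pair_act mat) T0 (x_act UNIV (pair_act mat) T2 v) (w, c) +
      x_act UNIV (pair_act mat) T2 (x_act UNIV (pair_act mat) T1 v) (w, c) = 0"
  shows "weight_module a UNIV (pair_act mat) fst"
proof
  show "finite (UNIV :: (vertex \<times> bool) set)"
    unfolding UNIV_pair using finite_vertex by (intro finite_SigmaI) auto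
  show "j \<in> UNIV \<and> fst j = tv t (fst i)" if "pair_act mat (Xgen (tr t)) i j \<noteq> 0" for i j t
    using that by (auto simp: pair_act_def tr_perm split: if_splits)
qed (use assms in \<open>auto simp: pair_act_def split_paired_all simp del: tr.simps\<close>)

definition id_mat :: "bool \<Rightarrow> bool \<Rightarrow> 'k::field" where
  "id_mat b c = (if b = c then 1 else 0)"

text \<open>\<open>mat_e\<close> and \<open>mat_c\<close> describe the left ideals generated by \<open>\<delta>\<^sub>e\<close> and \<open>\<delta>\<^sub>c\<close>. The weights other than \<open>e\<close> are
  identified through the matrix units \<open>u v\<close>, and the bases are scaled so that no denominators occur.\<close>

fun mat_e :: "(tip \<Rightarrow> 'k::field) \<Rightarrow> vertex \<Rightarrow> vertex \<Rightarrow> bool \<Rightarrow> bool \<Rightarrow> 'k" where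
  "mat_e p (Hub HC) (Tip j) b c = id_mat b c"
| "mat_e p (Tip j) (Hub HC) b c = p j * id_mat b c"
| "mat_e p (Hub HD) (Tip j) b c = id_mat b c"
| "mat_e p (Tip j) (Hub HD) b c = - p j * id_mat b c"
| "mat_e p (Hub HE) (Tip T0) b c = (if \<not> b \<and> \<not> c then p T1 * p T2 else 0)"
| "mat_e p (Hub HE) (Tip T1) b c = (if \<not> b \<and> c then p T0 * p T2 else 0)"
| "mat_e p (Hub HE) (Tip T2) b c = (if \<not> b then - p T0 * p T1 else 0)"
| "mat_e p (Tip T0) (Hub HE) b c = (if b \<and> c then 1 else 0)"
| "mat_e p (Tip T1) (Hub HE) b c = (if \<not> b \<and> c then -1 else 0)"
| "mat_e p (Tip T2) (Hub HE) b c = (if c then if b then -1 else 1 else 0)"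
| "mat_e p _ _ b c = 0"

fun mat_c :: "(tip \<Rightarrow> 'k::field) \<Rightarrow> vertex \<Rightarrow> vertex \<Rightarrow> bool \<Rightarrow> bool \<Rightarrow> 'k" where
  "mat_c p (Hub HC) (Tip j) b c = id_mat b c"
| "mat_c p (Tip j) (Hub HC) b c = p j * id_mat b c"
| "mat_c p (Hub HD) (Tip j) b c = id_mat b c -
     (if \<not> b \<and> c then (case j of T0 \<Rightarrow> 0 | T1 \<Rightarrow> p T2 | T2 \<Rightarrow> - p T1) else 0)"
| "mat_c p (Tip j) (Hub HD) b c = - p j * (id_mat b c +
     (if \<not> b \<and> c then (case j of T0 \<Rightarrow> 0 | T1 \<Rightarrow> p T2 | T2 \<Rightarrow> - p T1) else 0))"
| "mat_c p (Hub HE) (Tip T0) b c = (if b \<and> c then p T1 * p T2 else 0)"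
| "mat_c p (Hub HE) (Tip T1) b c = (if \<not> b \<and> c then - p T0 * p T2 else 0)"
| "mat_c p (Hub HE) (Tip T2) b c = (if c then if b then - p T0 * p T1 else p T0 * p T1 else 0)"
| "mat_c p (Tip T0) (Hub HE) b c = (if \<not> b \<and> \<not> c then 1 else 0)"
| "mat_c p (Tip T1) (Hub HE) b c = (if \<not> b \<and> c then 1 else 0)"
| "mat_c p (Tip T2) (Hub HE) b c = (if \<not> b then -1 else 0)"
| "mat_c p _ _ b c = 0"

text \<open>A finite check over vertices and labels. The weights are unfolded into differences
  because the trips between c and d need the three weights to add up to zero.\<close>

lemma weight_module_e: "weight_module a UNIV (pair_act (mat_e (diff_weight a))) fst"
proof (rule weight_module_pairI, unfold pair_gen_act, goal_cases)
  case (1 v w c t)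
  show ?case
    by (cases w rule: vertex_cases; cases t; cases c)
      (simp_all add: weight_def hb_def id_mat_def diff_weight_def algebra_simps)
next
  case (2 v w c)
  show ?case
    by (cases w rule: vertex_cases; cases c)
      (simp_all add: weight_def hb_def id_mat_def diff_weight_def algebra_simps)
next
  case (3 v w c)
  show ?case
    by (cases w rule: vertex_cases; cases c)
      (simp_all add: weight_def hb_def id_mat_def diff_weight_def algebra_simps)
qed

text \<open>The correction terms of \<open>mat_c\<close> at hub d record \<open>al_be\<close> for
  \<open>i = T0\<close>: there \<nu> acts as the product of the three weights, and dividing the
  action of al_0 be_j by \<open>p T0 * p j\<close> leaves 0, \<open>p T2\<close> and
  \<open>- p T1\<close>.\<close>

lemma weight_module_c: "weight_module a UNIV (pair_act (mat_c (diff_weight a))) fst"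
proof (rule weight_module_pairI, unfold pair_gen_act, goal_cases)
  case (1 v w c t)
  show ?case
    by (cases w rule: vertex_cases; cases t; cases c)
      (simp_all add: weight_def hb_def id_mat_def diff_weight_def algebra_simps)
next
  case (2 v w c)
  show ?case
    by (cases w rule: vertex_cases; cases c)
      (simp_all add: weight_def hb_def id_mat_def diff_weight_def algebra_simps)
next
  case (3 v w c)
  show ?case
    by (cases w rule: vertex_cases; cases c)
      (simp_all add: weight_def hb_def id_mat_def diff_weight_def algebra_simps)
qed

section \<open>Arrows and loops acting on weight modules\<close>

lemma tv_lab: "tv (lab h j) (Hub h) = Tip j" "tv (lab h j) (Tip j) = Hub h"
  using tr_perm_hub[of h j] tr_perm_tip[of h j] unfolding tr_perm perm_eq_iff by simp_all

context weight_module
begin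

lemma arrow_act:
  assumes "v \<in> carrier M"
  shows upA_act: "upA a h j \<odot>\<^bsub>M\<^esub> v = X (lab h j) (\<lambda>i. if i \<in> I \<and> Hub h = wt i then v i else 0)"
    and dnA_act: "dnA a h j \<odot>\<^bsub>M\<^esub> v = X (lab h j) (\<lambda>i. if i \<in> I \<and> Tip j = wt i then v i else 0)"
proof -
  interpret L: left_module "algA a" M by (rule left_module_M)
  have dM: "dA a w \<odot>\<^bsub>M\<^esub> v \<in> carrier M" for w
    using L.smult_closed[OF xA_dA_closed(1) assms] .
  show "upA a h j \<odot>\<^bsub>M\<^esub> v = X (lab h j) (\<lambda>i. if i \<in> I \<and> Hub h = wt i then v i else 0)"
    using xA_act[OF dM] unfolding dA_act[OF assms] upA_def
    by (simp add: L.smult_assoc xA_dA_closed assms dA_act[OF assms])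
  show "dnA a h j \<odot>\<^bsub>M\<^esub> v = X (lab h j) (\<lambda>i. if i \<in> I \<and> Tip j = wt i then v i else 0)"
    using xA_act[OF dM] unfolding dA_act[OF assms] dnA_def
    by (simp add: L.smult_assoc xA_dA_closed assms dA_act[OF assms])
qed

end

lemma arrow_closed: "upA a h j \<in> carrier (algA a)" "dnA a h j \<in> carrier (algA a)"
proof -
  interpret ring "algA a" by (rule ring_algA)
  show "upA a h j \<in> carrier (algA a)" "dnA a h j \<in> carrier (algA a)"
    by (simp_all add: upA_def dnA_def xA_dA_closed)
qed

text \<open>The trip from \<open>h\<close> to \<open>k\<close> through \<open>T1\<close> and back
  through \<open>T0\<close>: it is \<nu> at e for \<open>HE\<close>, \<open>HC\<close> and \<nu> at
  c for \<open>HC\<close>, \<open>HE\<close>. Written outside the locale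
  \<open>double_arrows\<close>, it can be evaluated in modules for every parameter.\<close>

definition loopA :: "((nat \<Rightarrow> nat) \<Rightarrow> 'k::field) \<Rightarrow> hub \<Rightarrow> hub \<Rightarrow> 'k alg_elem" where
  "loopA a h k = dnA a h T0 \<otimes>\<^bsub>algA a\<^esub> upA a k T0 \<otimes>\<^bsub>algA a\<^esub> (dnA a k T1 \<otimes>\<^bsub>algA a\<^esub> upA a h T1)"

lemma loop_act:
  assumes "left_module (algA a) M" "v \<in> carrier M"
  shows "loopA a h k \<odot>\<^bsub>M\<^esub> v =
    dnA a h T0 \<odot>\<^bsub>M\<^esub> (upA a k T0 \<odot>\<^bsub>M\<^esub> (dnA a k T1 \<odot>\<^bsub>M\<^esub> (upA a h T1 \<odot>\<^bsub>M\<^esub> v)))"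
proof -
  interpret L: left_module "algA a" M by fact
  show ?thesis using assms(2) by (simp add: loopA_def L.smult_assoc L.smult_closed arrow_closed)
qed

text \<open>Applied to the first basis vector at its hub, the loop has the product of the three
  weights as coordinate at the second one; genericity makes this product nonzero.\<close>

lemma loop_nonzero:
  assumes "generic a"
  shows "loopA a HE HC \<noteq> \<zero>\<^bsub>algA a\<^esub>"
    and "loopA a HC HE \<noteq> \<zero>\<^bsub>algA a\<^esub>"
proof -
  interpret E: weight_module a UNIV "pair_act (mat_e (diff_weight a))" fst
    by (rule weight_module_e)
  interpret LE: left_module "algA a" E.M by (rule E.left_module_M)
  have E: "v \<in> carrier E.M" for v by (simp add: E.M_simps)
  have "(loopA a HE HC \<odot>\<^bsub>E.M\<^esub> unit_vec (Hub HE, False)) (Hub HE, True) =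
      diff_weight a T0 * diff_weight a T1 * diff_weight a T2"
    unfolding loop_act[OF E.left_module_M E] E.upA_act[OF E] E.dnA_act[OF E] pair_gen_act
    by (simp add: hb_def id_mat_def unit_vec_def)
  also have "\<dots> \<noteq> 0" using diff_weight_nz[OF assms] by simp
  finally show "loopA a HE HC \<noteq> \<zero>\<^bsub>algA a\<^esub>"
    using LE.smult_zero_l[OF E[of "unit_vec (Hub HE, False)"]] by (auto simp: E.M_simps)
next
  interpret C: weight_module a UNIV "pair_act (mat_c (diff_weight a))" fst
    by (rule weight_module_c)
  interpret LC: left_module "algA a" C.M by (rule C.left_module_M)
  have C: "v \<in> carrier C.M" for v by (simp add: C.M_simps)
  have "(loopA a HC HE \<odot>\<^bsub>C.M\<^esub> unit_vec (Hub HC, False)) (Hub HC, True) =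
      diff_weight a T0 * diff_weight a T1 * diff_weight a T2"
    unfolding loop_act[OF C.left_module_M C] C.upA_act[OF C] C.dnA_act[OF C] pair_gen_act
    by (simp add: hb_def id_mat_def unit_vec_def)
  also have "\<dots> \<noteq> 0" using diff_weight_nz[OF assms] by simp
  finally show "loopA a HC HE \<noteq> \<zero>\<^bsub>algA a\<^esub>"
    using LC.smult_zero_l[OF C[of "unit_vec (Hub HC, False)"]] by (auto simp: C.M_simps)
qed

section \<open>The simple modules\<close>

lemma simple_k_e: "simple_module (algA a) (k_e :: ('k::field alg_elem, _) module)"
proof -
  interpret weight_module a "{\<one>\<^bsub>S3\<^esub>}" k_e_act "\<lambda>_. Hub HE"
    by (rule weight_module_k_e)
  show ?thesis unfolding k_e_def by (rule simpleI) auto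
qed

lemma k_e_generator:
  fixes a :: "(nat \<Rightarrow> nat) \<Rightarrow> 'k::field"
  defines "t \<equiv> unit_vec \<one>\<^bsub>S3\<^esub> :: (nat \<Rightarrow> nat) \<Rightarrow> 'k"
  shows "t \<in> carrier k_e" "t \<noteq> \<zero>\<^bsub>k_e\<^esub>" "dA a (Hub HE) \<odot>\<^bsub>k_e\<^esub> t = t"
    "loopA a HE HC \<odot>\<^bsub>k_e\<^esub> t = \<zero>\<^bsub>k_e\<^esub>"
proof -
  interpret weight_module a "{\<one>\<^bsub>S3\<^esub>}" k_e_act "\<lambda>_. Hub HE"
    by (rule weight_module_k_e)
  interpret L: left_module "algA a" M by (rule left_module_M)
  show t: "t \<in> carrier k_e" unfolding k_e_def t_def by (rule unit_closed) simp
  show "t \<noteq> \<zero>\<^bsub>k_e\<^esub>" unfolding k_e_def M_simps(2) t_def by (auto simp: unit_vec_def fun_eq_iff)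
  show "dA a (Hub HE) \<odot>\<^bsub>k_e\<^esub> t = t"
    unfolding k_e_def dA_act[OF t[unfolded k_e_def]] by (auto simp: t_def unit_vec_def)
  have "upA a HE T1 \<odot>\<^bsub>M\<^esub> t = \<zero>\<^bsub>M\<^esub>"
    using upA_act[OF t[unfolded k_e_def]] by (simp add: x_act_def gen_act_def M_simps)
  then show "loopA a HE HC \<odot>\<^bsub>k_e\<^esub> t = \<zero>\<^bsub>k_e\<^esub>"
    using t unfolding k_e_def by (simp add: loop_act left_module_M arrow_closed L.smult_zero_r)
qed

lemma L_module_eq: "L_module a = basis_module L_index (L_act a)"
  by (simp add: L_module_def L_index_def)

lemma simple_L:
  assumes "generic a"
  shows "simple_module (algA a) (L_module a)"
proof -
  interpret weight_module a L_index "L_act a" "inv_into UNIV perm"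
    by (rule weight_module_L)
  interpret L: left_module "algA a" M by (rule left_module_M)
  show ?thesis unfolding L_module_eq
  proof (rule simpleI)
    show "L_index \<noteq> {}" using L_index_iff[of "Hub HC"] by auto
    show "inj_on (inv_into UNIV perm) L_index"
      by (auto intro!: inj_onI elim!: L_indexE)
    fix H i j assume H: "submodule H (algA a) M" and ij: "i \<in> L_index" "j \<in> L_index" "unit_vec i \<in> H"
    note HD = L.submoduleD[OF H]
    define P where "P v \<longleftrightarrow> unit_vec (perm v) \<in> H" for v
    \<comment> \<open>Between weights other than e a generator moves a basis vector to a nonzero
      multiple of another: the coefficient is 1 or, up to sign, a weight, nonzero by
      genericity.\<close>
    have step: "P (tv t v)" if v: "v \<noteq> Hub HE" "tv t v \<noteq> Hub HE" "P v" for t v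
    proof -
      define c where "c = L_coeff (diff_weight a) t v"
      have c: "c \<noteq> 0"
      proof (cases v)
        case (Tip j)
        then show ?thesis
          using v(2) diff_weight_nz[OF assms, of j]
          by (cases "hb t j") (auto simp: c_def L_coeff_def weight_def)
      qed (simp add: c_def L_coeff_def)
      have unit: "unit_vec (perm v) \<in> carrier M" using v(3) HD(1) by (auto simp: P_def)
      have "scA a (inverse c) \<odot>\<^bsub>M\<^esub> (xA a t \<odot>\<^bsub>M\<^esub> unit_vec (perm v)) \<in> H"
        using v(3) by (intro HD(4)) (auto simp: P_def scA_def cls_closed free_algebra_scal xA_dA_closed)
      moreover have "xA a t \<odot>\<^bsub>M\<^esub> unit_vec (perm v) = (\<lambda>j. c * unit_vec (perm (tv t v)) j)"
        using xA_act[OF unit, of t] X_unit[of "perm v" t] v(1)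
        by (simp add: L_index_iff L_act_perm c_def del: L_act.simps)
      moreover have "xA a t \<odot>\<^bsub>M\<^esub> unit_vec (perm v) \<in> carrier M"
        using L.smult_closed[OF xA_dA_closed(2) unit] .
      ultimately show ?thesis
        using c by (simp add: scA_act P_def flip: mult.assoc)
    qed
    obtain v w where vw: "i = perm v" "v \<noteq> Hub HE" "j = perm w" "w \<noteq> Hub HE"
      using ij by (auto elim!: L_indexE)
    have hub_tip: "P (Tip j)" if "P (Hub h)" "h \<noteq> HE" for h j
      using step[of "Hub h" "lab h j", unfolded tv_lab] that by simp
    have tip_hub: "P (Hub h)" if "P (Tip j)" "h \<noteq> HE" for h j
      using step[of "Tip j" "lab h j", unfolded tv_lab] that by simp
    have "P v" using ij(3) vw by (simp add: P_def)
    \<comment> \<open>Hub c is joined to every tip and serves as the meeting point.\<close>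
    then have "P (Hub HC)"
      using vw(2) tip_hub hub_tip by (cases v) (metis hub.distinct(1) vertex.exhaust)+
    then have "P w"
      using vw(4) tip_hub hub_tip by (cases w) (metis hub.distinct(1))+
    then show "unit_vec j \<in> H" by (simp add: P_def vw)
  qed
qed

lemma L_generator:
  fixes a :: "(nat \<Rightarrow> nat) \<Rightarrow> 'k::field"
  defines "t \<equiv> unit_vec (perm (Hub HC)) :: (nat \<Rightarrow> nat) \<Rightarrow> 'k"
  shows "t \<in> carrier (L_module a)" "t \<noteq> \<zero>\<^bsub>L_module a\<^esub>" "dA a (Hub HC) \<odot>\<^bsub>L_module a\<^esub> t = t"
    "loopA a HC HE \<odot>\<^bsub>L_module a\<^esub> t
      = \<zero>\<^bsub>L_module a\<^esub>"
proof -
  interpret weight_module a L_index "L_act a" "inv_into UNIV perm"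
    by (rule weight_module_L)
  interpret L: left_module "algA a" M by (rule left_module_M)
  have c: "perm (Hub HC) \<in> L_index" by (simp add: L_index_iff del: perm.simps)
  show t: "t \<in> carrier (L_module a)" unfolding L_module_eq t_def using c by (rule unit_closed)
  show "t \<noteq> \<zero>\<^bsub>L_module a\<^esub>" unfolding L_module_eq M_simps(2) t_def by (auto simp: unit_vec_def fun_eq_iff)
  show "dA a (Hub HC) \<odot>\<^bsub>L_module a\<^esub> t = t"
    unfolding L_module_eq dA_act[OF t[unfolded L_module_eq]] using c
    by (auto simp: t_def unit_vec_def simp del: perm.simps)
  \<comment> \<open>This arrow ends at weight e, which does not occur in the module.\<close>
  have dn: "dnA a HE T1 \<odot>\<^bsub>M\<^esub> v = \<zero>\<^bsub>M\<^esub>" if v: "v \<in> carrier M" for v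
  proof -
    have "(dnA a HE T1 \<odot>\<^bsub>M\<^esub> v) j = 0" for j
    proof (cases "j \<in> L_index")
      case True
      then obtain w where w: "j = perm w" "w \<noteq> Hub HE" by (auto elim: L_indexE)
      have "tv T1 w \<noteq> Tip T1"
        using w(2) tv_eq_iff[of T1 w "Tip T1"] by (auto simp: hb_def)
      moreover have "id \<notin> L_index"
        using L_index_iff[of "Hub HE"] by simp
      ultimately show ?thesis
        unfolding dnA_act[OF v] w by (subst L_gen_act) (auto simp del: perm.simps)
    next
      case False
      then show ?thesis
        using L.smult_closed[OF arrow_closed(2) v] by (simp add: M_simps)
    qed
    then show ?thesis by (simp add: M_simps fun_eq_iff)
  qed
  show "loopA a HC HE \<odot>\<^bsub>L_module a\<^esub> t
      = \<zero>\<^bsub>L_module a\<^esub>"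
    using t unfolding L_module_eq
    by (simp add: loop_act left_module_M arrow_closed dn L.smult_closed L.smult_zero_r)
qed

text \<open>The idempotent at e fixes the generator of one module and is zero on the other.\<close>

lemma k_e_not_isomorphic_L: "\<not> mod_isomorphic (algA a) (k_e :: ('k::field alg_elem, _) module) (L_module a)"
proof
  assume "mod_isomorphic (algA a) (k_e :: ('k alg_elem, _) module) (L_module a)"
  then obtain h where h: "h \<in> mod_hom (algA a) (k_e :: ('k alg_elem, _) module) (L_module a)"
    "inj_on h (carrier k_e)"
    unfolding mod_isomorphic_def bij_betw_def by blast
  interpret weight_module a L_index "L_act a" "inv_into UNIV perm"
    by (rule weight_module_L)
  have k: "left_module (algA a) (k_e :: ('k alg_elem, _) module)"
    using simple_k_e[of a] by (simp add: simple_module_def)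
  interpret K: left_module "algA a" "k_e :: ('k alg_elem, _) module" by (rule k)
  let ?t = "unit_vec \<one>\<^bsub>S3\<^esub> :: (nat \<Rightarrow> nat) \<Rightarrow> 'k"
  have ht: "h ?t \<in> carrier (L_module a)"
    using mod_homD(1)[OF h(1)] k_e_generator(1) by blast
  have "h ?t = dA a (Hub HE) \<odot>\<^bsub>L_module a\<^esub> h ?t"
    using mod_homD(3)[OF h(1) xA_dA_closed(1)[of a "Hub HE"] k_e_generator(1)]
    by (simp add: k_e_generator(3))
  also have "\<dots> = \<zero>\<^bsub>L_module a\<^esub>"
    using ht unfolding L_module_eq
    by (auto simp: dA_act M_simps fun_eq_iff elim!: L_indexE)
  also have "\<dots> = h \<zero>\<^bsub>k_e\<^esub>"
    using mod_hom_zero[OF k _ h(1)] left_module_M by (simp add: L_module_eq)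
  finally have "h ?t = h \<zero>\<^bsub>k_e\<^esub>" .
  then have "?t = \<zero>\<^bsub>k_e\<^esub>"
    by (rule inj_onD[OF h(2) _ k_e_generator(1) K.M.zero_closed])
  then show False using k_e_generator(2) by blast
qed

section \<open>Extension of scalars along a cyclic module\<close>

locale scalar_extension = A?: ring A
  for A :: "('a, 'x) ring_scheme" (structure) and B :: "('b, 'y) ring_scheme"
    and \<phi> :: "'b \<Rightarrow> 'a" and N :: "('b, 'n) module" +
  assumes phi_closed: "b \<in> carrier B \<Longrightarrow> \<phi> b \<in> carrier A"
    and N_add: "m \<in> carrier N \<Longrightarrow> n \<in> carrier N \<Longrightarrow> m \<oplus>\<^bsub>N\<^esub> n \<in> carrier N"
    and N_smult: "b \<in> carrier B \<Longrightarrow> n \<in> carrier N \<Longrightarrow> b \<odot>\<^bsub>N\<^esub> n \<in> carrier N"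
begin

definition F where "F = free_Abelian_group (carrier A \<times> carrier N)"
definition T where "T = generate F (tensor_relations B A \<phi> N)"
text \<open>Multiplication by \<open>r\<close> on representatives, before passing to
  classes.\<close>

definition ext where "ext r = frag_extend (\<lambda>(x, n :: 'n). frag_of (r \<otimes> x, n))"
definition cl where "cl p = T #>\<^bsub>F\<^esub> p"

abbreviation E where "E \<equiv> extend_scalars B A \<phi> N"

lemma F_simps: "carrier F = {p. Poly_Mapping.keys p \<subseteq> carrier A \<times> carrier N}"
  "x \<otimes>\<^bsub>F\<^esub> y = x + y" "\<one>\<^bsub>F\<^esub> = 0"
  by (auto simp: F_def)

interpretation F: comm_group F
  unfolding F_def by (rule abelian_free_Abelian_group)

lemma F_diff: "p \<in> carrier F \<Longrightarrow> q \<in> carrier F \<Longrightarrow> p - q \<in> carrier F"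
  using keys_diff[of p q] by (auto simp: F_simps)

lemma F_minus: "p \<in> carrier F \<Longrightarrow> - p \<in> carrier F"
  by (simp add: F_simps)

lemma F_zero: "0 \<in> carrier F"
  by (simp add: F_simps)

lemma frag_of_F: "x \<in> carrier A \<Longrightarrow> n \<in> carrier N \<Longrightarrow> frag_of (x, n) \<in> carrier F"
  by (simp add: F_simps keys_frag_of)

lemma rels_F: "tensor_relations B A \<phi> N \<subseteq> carrier F"
  unfolding tensor_relations_def
  by (auto intro!: F_diff frag_of_F phi_closed N_add N_smult)

lemma T_subgroup: "subgroup T F"
  unfolding T_def by (rule F.generate_is_subgroup[OF rels_F])

lemma T_sub: "T \<subseteq> carrier F"
  using T_subgroup by (rule subgroup.subset)

lemma T_closed: "0 \<in> T" "p \<in> T \<Longrightarrow> q \<in> T \<Longrightarrow> p + q \<in> T" "p \<in> T \<Longrightarrow> - p \<in> T" "p \<in> T \<Longrightarrow> q \<in> T \<Longrightarrow> p - q \<in> T"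
proof -
  show "0 \<in> T" using subgroup.one_closed[OF T_subgroup] by (simp add: F_simps)
  show add: "p + q \<in> T" if "p \<in> T" "q \<in> T" for p q
    using subgroup.m_closed[OF T_subgroup that] by (simp add: F_simps)
  show minus: "- p \<in> T" if "p \<in> T" for p
  proof -
    have "inv\<^bsub>F\<^esub> p = - p"
      using that T_sub by (auto simp: F_def)
    then show ?thesis using subgroup.m_inv_closed[OF T_subgroup that] by simp
  qed
  show "p - q \<in> T" if "p \<in> T" "q \<in> T" for p q
    using add[OF that(1) minus[OF that(2)]] by simp
qed

lemma cl_def': "cl p = (\<lambda>t. t + p) ` T"
  by (auto simp: cl_def r_coset_def F_simps)

lemma cl_eq_iff: "cl p = cl q \<longleftrightarrow> p - q \<in> T"
proof
  assume "cl p = cl q"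
  then have "p \<in> (\<lambda>t. t + q) ` T"
    using T_closed(1) unfolding cl_def' by force
  then show "p - q \<in> T" by auto
next
  assume pq: "p - q \<in> T"
  show "cl p = cl q"
  proof (intro equalityI subsetI)
    fix z assume "z \<in> cl p"
    then obtain t where t: "t \<in> T" "z = t + p" unfolding cl_def' by auto
    then have "z = (t + (p - q)) + q" by simp
    then show "z \<in> cl q" using T_closed(2)[OF t(1) pq] unfolding cl_def' by blast
  next
    fix z assume "z \<in> cl q"
    then obtain t where t: "t \<in> T" "z = t + q" unfolding cl_def' by auto
    then have "z = (t - (p - q)) + p" by simp
    then show "z \<in> cl p" using T_closed(4)[OF t(1) pq] unfolding cl_def' by blast
  qed
qed

lemma ext_simps: "ext r (frag_of (x, n)) = frag_of (r \<otimes> x, n)" "ext r (p + q) = ext r p + ext r q"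
  "ext r (p - q) = ext r p - ext r q" "ext r 0 = 0" "ext r (- p) = - ext r p"
  by (simp_all add: ext_def frag_extend_add frag_extend_diff frag_extend_minus)

lemma F_induct [consumes 1, case_names zero diff frag]:
  assumes "p \<in> carrier F" "P 0"
    and "\<And>p q. p \<in> carrier F \<Longrightarrow> q \<in> carrier F \<Longrightarrow> P p \<Longrightarrow> P q \<Longrightarrow> P (p - q)"
    and "\<And>x n. x \<in> carrier A \<Longrightarrow> n \<in> carrier N \<Longrightarrow> P (frag_of (x, n))"
  shows "P p"
proof (rule free_Abelian_group_induct[of p "carrier A \<times> carrier N"])
  show "Poly_Mapping.keys p \<subseteq> carrier A \<times> carrier N" using assms(1) by (simp add: F_simps)
qed (use assms in \<open>auto simp: F_simps\<close>)

lemma ext_closed: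
  assumes "r \<in> carrier A" "p \<in> carrier F"
  shows "ext r p \<in> carrier F"
  using assms(2)
  by (induction rule: F_induct) (auto simp: ext_simps F_diff frag_of_F assms(1) F_zero)

lemma tensor_relation_cases:
  assumes "p \<in> tensor_relations B A \<phi> N"
  obtains x y n where "x \<in> carrier A" "y \<in> carrier A" "n \<in> carrier N"
      "p = frag_of (x \<oplus> y, n) - frag_of (x, n) - frag_of (y, n)"
    | x m n where "x \<in> carrier A" "m \<in> carrier N" "n \<in> carrier N"
      "p = frag_of (x, m \<oplus>\<^bsub>N\<^esub> n) - frag_of (x, m) - frag_of (x, n)"
    | x b n where "x \<in> carrier A" "b \<in> carrier B" "n \<in> carrier N"
      "p = frag_of (x \<otimes> \<phi> b, n) - frag_of (x, b \<odot>\<^bsub>N\<^esub> n)"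
  using assms unfolding tensor_relations_def Un_iff mem_Collect_eq
proof (elim disjE exE conjE, goal_cases)
  case (1 x y n)
  show ?case by (rule that(1)[OF 1(5-7,4)])
next
  case (2 x m n)
  show ?case by (rule that(2)[OF 2(5-7,4)])
next
  case (3 x b n)
  show ?case by (rule that(3)[OF 3(5-7,4)])
qed

lemma rels_T: "p \<in> tensor_relations B A \<phi> N \<Longrightarrow> p \<in> T"
  unfolding T_def by (rule generate.incl)

lemma relations:
  "x \<in> carrier A \<Longrightarrow> y \<in> carrier A \<Longrightarrow> n \<in> carrier N \<Longrightarrow>
    frag_of (x \<oplus> y, n) - frag_of (x, n) - frag_of (y, n) \<in> T"
  "x \<in> carrier A \<Longrightarrow> m \<in> carrier N \<Longrightarrow> n \<in> carrier N \<Longrightarrow>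
    frag_of (x, m \<oplus>\<^bsub>N\<^esub> n) - frag_of (x, m) - frag_of (x, n) \<in> T"
  "x \<in> carrier A \<Longrightarrow> b \<in> carrier B \<Longrightarrow> n \<in> carrier N \<Longrightarrow>
    frag_of (x \<otimes> \<phi> b, n) - frag_of (x, b \<odot>\<^bsub>N\<^esub> n) \<in> T"
  by (rule rels_T, unfold tensor_relations_def, blast)+

lemma ext_rel:
  assumes r: "r \<in> carrier A" and p: "p \<in> tensor_relations B A \<phi> N"
  shows "ext r p \<in> T"
  using p
proof (cases rule: tensor_relation_cases)
  case (1 x y n)
  then show ?thesis using r relations(1)[of "r \<otimes> x" "r \<otimes> y" n] by (simp add: ext_simps A.r_distr)
next
  case (2 x m n)
  then show ?thesis using r relations(2)[of "r \<otimes> x" m n] by (simp add: ext_simps)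
next
  case (3 x b n)
  then show ?thesis
    using r relations(3)[of "r \<otimes> x" b n] phi_closed by (simp add: ext_simps A.m_assoc)
qed

text \<open>This makes scalar multiplication on classes well defined. As \<open>ext r\<close> is
  additive, the generators of \<open>T\<close> suffice.\<close>

lemma ext_T:
  assumes r: "r \<in> carrier A" and p: "p \<in> T"
  shows "ext r p \<in> T"
  using p unfolding T_def
proof (induction rule: generate.induct)
  case one
  show ?case using T_closed(1) by (simp add: F_simps ext_simps flip: T_def)
next
  case (incl h)
  then show ?case using ext_rel[OF r] by (simp flip: T_def)
next
  case (inv h)
  then have "h \<in> carrier F" using rels_F by blast
  then have "inv\<^bsub>F\<^esub> h = - h" by (auto simp: F_def)
  then show ?case using T_closed(3) ext_rel[OF r inv] by (simp add: ext_simps flip: T_def)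
next
  case (eng h1 h2)
  then show ?case using T_closed(2) by (simp add: F_simps ext_simps flip: T_def)
qed

lemma E_simps: "carrier E = cl ` carrier F" "\<zero>\<^bsub>E\<^esub> = cl 0"
  by (auto simp: extend_scalars_def Let_def carrier_FactGroup cl_def r_coset_def F_simps
      simp flip: F_def T_def)

lemma E_add:
  assumes "p \<in> carrier F" "q \<in> carrier F"
  shows "cl p \<oplus>\<^bsub>E\<^esub> cl q = cl (p + q)"
proof -
  interpret T: normal T F
    using F.subgroup_imp_normal T_subgroup by blast
  have "cl p \<oplus>\<^bsub>E\<^esub> cl q = cl p <#>\<^bsub>F\<^esub> cl q"
    by (simp add: extend_scalars_def Let_def flip: F_def T_def)
  also have "\<dots> = cl (p + q)"
    unfolding cl_def using T.rcos_sum[OF assms] by (simp add: F_simps)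
  finally show ?thesis .
qed

lemma E_smult:
  assumes r: "r \<in> carrier A"
  shows "r \<odot>\<^bsub>E\<^esub> cl p = cl (ext r p)"
proof -
  have "(\<lambda>p. cl (ext r p)) ` cl p = {cl (ext r p)}"
  proof -
    have "cl (ext r (t + p)) = cl (ext r p)" if "t \<in> T" for t
      unfolding cl_eq_iff using ext_T[OF r that] by (simp add: ext_simps)
    then show ?thesis
      unfolding cl_def'[of p] using T_closed(1) by (auto simp: image_image)
  qed
  moreover have "r \<odot>\<^bsub>E\<^esub> cl p = the_elem ((\<lambda>p. cl (ext r p)) ` cl p)"
    by (simp add: extend_scalars_def Let_def cl_def ext_def flip: F_def T_def)
  ultimately show ?thesis by simp
qed

lemma left_module_E: "left_module A E"
proof (intro left_module.intro left_module_axioms.intro)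
  show "ring A" by (rule A.ring_axioms)
  have F_add: "p + q \<in> carrier F" if "p \<in> carrier F" "q \<in> carrier F" for p q
    using F.m_closed[OF that] by (simp only: F_simps(2))
  show "abelian_group E"
  proof (rule abelian_groupI)
    show "\<exists>y\<in>carrier E. y \<oplus>\<^bsub>E\<^esub> x = \<zero>\<^bsub>E\<^esub>" if x: "x \<in> carrier E" for x
    proof -
      obtain p where p: "p \<in> carrier F" "x = cl p" using x by (auto simp: E_simps)
      then show ?thesis
        using F_minus[OF p(1)] by (intro bexI[of _ "cl (- p)"]) (auto simp: E_simps E_add)
    qed
    show "\<zero>\<^bsub>E\<^esub> \<in> carrier E" by (simp add: E_simps F_zero)
    fix x y assume x: "x \<in> carrier E" and y: "y \<in> carrier E"
    obtain p where p: "p \<in> carrier F" "x = cl p" using x by (auto simp: E_simps)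
    obtain q where q: "q \<in> carrier F" "y = cl q" using y by (auto simp: E_simps)
    show "x \<oplus>\<^bsub>E\<^esub> y \<in> carrier E" using p q by (simp add: E_add F_add E_simps)
    show "x \<oplus>\<^bsub>E\<^esub> y = y \<oplus>\<^bsub>E\<^esub> x" using p q by (simp add: E_add add.commute)
    show "\<zero>\<^bsub>E\<^esub> \<oplus>\<^bsub>E\<^esub> x = x" using p by (simp add: E_add F_zero E_simps(2))
    fix z assume z: "z \<in> carrier E"
    obtain q' where q': "q' \<in> carrier F" "z = cl q'" using z by (auto simp: E_simps)
    show "x \<oplus>\<^bsub>E\<^esub> y \<oplus>\<^bsub>E\<^esub> z = x \<oplus>\<^bsub>E\<^esub> (y \<oplus>\<^bsub>E\<^esub> z)"
      using p q q' by (simp add: E_add F_add add.assoc)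
  qed
next
  show "r \<odot>\<^bsub>E\<^esub> x \<in> carrier E" if "r \<in> carrier A" "x \<in> carrier E" for r x
    using that ext_closed by (auto simp: E_simps E_smult)
  show "(r \<oplus> s) \<odot>\<^bsub>E\<^esub> x = r \<odot>\<^bsub>E\<^esub> x \<oplus>\<^bsub>E\<^esub> s \<odot>\<^bsub>E\<^esub> x"
    if rs: "r \<in> carrier A" "s \<in> carrier A" and x: "x \<in> carrier E" for r s x
  proof -
    obtain p where p: "p \<in> carrier F" "x = cl p" using x by (auto simp: E_simps)
    have "ext (r \<oplus> s) p - (ext r p + ext s p) \<in> T"
      using p(1)
    proof (induction rule: F_induct)
      case zero
      show ?case using T_closed(1) by (simp add: ext_simps)
    next
      case (diff p q)
      from T_closed(4)[OF diff.IH] show ?case by (simp add: ext_simps algebra_simps)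
    next
      case (frag x n)
      then show ?case
        using relations(1)[of "r \<otimes> x" "s \<otimes> x" n] rs
        by (simp add: ext_simps A.l_distr diff_diff_eq)
    qed
    then show ?thesis
      using p rs by (simp add: E_smult E_add ext_closed cl_eq_iff)
  qed
  show "r \<odot>\<^bsub>E\<^esub> (x \<oplus>\<^bsub>E\<^esub> y) = r \<odot>\<^bsub>E\<^esub> x \<oplus>\<^bsub>E\<^esub> r \<odot>\<^bsub>E\<^esub> y"
    if r: "r \<in> carrier A" and xy: "x \<in> carrier E" "y \<in> carrier E" for r x y
    using xy r by (auto simp: E_simps E_add E_smult ext_simps ext_closed)
  show "(r \<otimes> s) \<odot>\<^bsub>E\<^esub> x = r \<odot>\<^bsub>E\<^esub> (s \<odot>\<^bsub>E\<^esub> x)"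
    if rs: "r \<in> carrier A" "s \<in> carrier A" and x: "x \<in> carrier E" for r s x
  proof -
    obtain p where p: "p \<in> carrier F" "x = cl p" using x by (auto simp: E_simps)
    have "ext (r \<otimes> s) p = ext r (ext s p)"
      using p(1) by (induction rule: F_induct) (auto simp: ext_simps A.m_assoc rs)
    then show ?thesis using p rs by (simp add: E_smult)
  qed
  show "\<one> \<odot>\<^bsub>E\<^esub> x = x" if x: "x \<in> carrier E" for x
  proof -
    obtain p where p: "p \<in> carrier F" "x = cl p" using x by (auto simp: E_simps)
    have "ext \<one> p = p"
      using p(1) by (induction rule: F_induct) (auto simp: ext_simps)
    then show ?thesis using p by (simp add: E_smult)
  qed
qed

lemma frag_zero: "n \<in> carrier N \<Longrightarrow> frag_of (\<zero>, n) \<in> T"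
  using T_closed(3)[OF relations(1)[of "\<zero>" "\<zero>" n]] by simp

text \<open>Moving scalars across the tensor sign turns every tensor into a pure one with the
  generator on the right.\<close>

lemma cyclic_generation:
  assumes n0: "n\<^sub>0 \<in> carrier N" and cyc: "\<And>n. n \<in> carrier N \<Longrightarrow> \<exists>b\<in>carrier B. n = b \<odot>\<^bsub>N\<^esub> n\<^sub>0"
    and p: "p \<in> carrier F"
  shows "\<exists>r\<in>carrier A. cl p = cl (frag_of (r, n\<^sub>0))"
  using p
proof (induction rule: F_induct)
  case zero
  show ?case
    using T_closed(3)[OF frag_zero[OF n0]] by (intro bexI[of _ "\<zero>"]) (simp_all add: cl_eq_iff)
next
  case (diff p q)
  then obtain r s where rs: "r \<in> carrier A" "s \<in> carrier A" "p - frag_of (r, n\<^sub>0) \<in> T" "q - frag_of (s, n\<^sub>0) \<in> T"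
    by (auto simp: cl_eq_iff)
  define u where "u = r \<oplus> \<ominus> s"
  have u: "u \<in> carrier A" "u \<oplus> s = r"
    using rs by (simp_all add: u_def A.a_assoc A.l_neg)
  have "frag_of (r, n\<^sub>0) - frag_of (u, n\<^sub>0) - frag_of (s, n\<^sub>0) \<in> T"
    using relations(1)[OF u(1) rs(2) n0] u by simp
  from T_closed(2)[OF T_closed(4)[OF rs(3,4)] this]
  have "p - q - frag_of (u, n\<^sub>0) \<in> T" by (simp add: algebra_simps)
  then show ?case using u(1) by (auto simp: cl_eq_iff)
next
  case (frag x n)
  then obtain b where b: "b \<in> carrier B" "n = b \<odot>\<^bsub>N\<^esub> n\<^sub>0" using cyc by blast
  have "frag_of (x, n) - frag_of (x \<otimes> \<phi> b, n\<^sub>0) \<in> T"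
    using T_closed(3)[OF relations(3)[OF frag(1) b(1) n0]] b(2) by simp
  then show ?case
    using frag b phi_closed by (intro bexI[of _ "x \<otimes> \<phi> b"]) (simp_all add: cl_eq_iff)
qed

text \<open>The map from the tensor product to \<open>A\<close> induced by \<open>\<kappa>\<close> detects nonzero pure tensors.\<close>

lemma balanced_map_zero:
  assumes k_closed: "\<And>n. n \<in> carrier N \<Longrightarrow> \<kappa> n \<in> carrier A"
    and k_add: "\<And>m n. m \<in> carrier N \<Longrightarrow> n \<in> carrier N \<Longrightarrow> \<kappa> (m \<oplus>\<^bsub>N\<^esub> n) = \<kappa> m \<oplus> \<kappa> n"
    and k_bal: "\<And>b n. b \<in> carrier B \<Longrightarrow> n \<in> carrier N \<Longrightarrow> \<phi> b \<otimes> \<kappa> n = \<kappa> (b \<odot>\<^bsub>N\<^esub> n)"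
    and rn: "r \<in> carrier A" "n \<in> carrier N" and zero: "frag_of (r, n) \<in> T"
  shows "r \<otimes> \<kappa> n = \<zero>"
proof -
  have "(\<lambda>(x, n). x \<otimes> \<kappa> n) ` (carrier A \<times> carrier N) \<subseteq> carrier (add_monoid A)"
    using k_closed by auto
  then obtain h where h: "h \<in> hom F (add_monoid A)"
    "\<And>z. z \<in> carrier A \<times> carrier N \<Longrightarrow> h (frag_of z) = (\<lambda>(x, n). x \<otimes> \<kappa> n) z"
    unfolding F_def by (rule comm_group.free_Abelian_group_universal[OF A.a_comm_group]) auto
  have frag: "h (frag_of (x, n)) = x \<otimes> \<kappa> n" if "x \<in> carrier A" "n \<in> carrier N" for x n
    using h(2)[of "(x, n)"] that by simp
  have h_closed: "h p \<in> carrier A" if "p \<in> carrier F" for p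
    using h(1) that by (auto simp: hom_def)
  have h_add: "h (p + q) = h p \<oplus> h q" if "p \<in> carrier F" "q \<in> carrier F" for p q
    using h(1) that by (auto simp: hom_def F_simps(2))
  have h_diff: "h (p - q) = \<zero> \<longleftrightarrow> h p = h q" if pq: "p \<in> carrier F" "q \<in> carrier F" for p q
  proof -
    have "h p = h (p - q) \<oplus> h q"
      using h_add[OF F_diff[OF pq] pq(2)] by simp
    then show ?thesis using h_closed pq F_diff[OF pq] by auto
  qed
  have rel: "h p = \<zero>" if "p \<in> tensor_relations B A \<phi> N" for p
  proof -
    have d: "h (p - q - q') = \<zero> \<longleftrightarrow> h p = h q \<oplus> h q'"
      if "p \<in> carrier F" "q \<in> carrier F" "q' \<in> carrier F" for p q q'
      using h_diff[of p "q + q'"] h_add[of q q'] that F.m_closed[of q q']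
      by (simp add: F_simps(2) diff_diff_eq)
    note closed = frag_of_F frag k_closed phi_closed N_add N_smult
    from that show ?thesis
    proof (cases rule: tensor_relation_cases)
      case 1
      then show ?thesis by (simp add: d closed A.l_distr)
    next
      case 2
      then show ?thesis by (simp add: d closed A.r_distr k_add)
    next
      case 3
      then show ?thesis by (simp add: h_diff closed A.m_assoc k_bal)
    qed
  qed
  have "h p = \<zero>" if "p \<in> T" for p
    using that unfolding T_def
  proof (induction rule: generate.induct)
    case one
    show ?case using h_diff[of 0 0] by (simp add: F_simps)
  next
    case (inv p)
    then have p: "p \<in> carrier F" using rels_F by blast
    then have "inv\<^bsub>F\<^esub> p = 0 - p" by (auto simp: F_def)
    then show ?case
      using h_diff[of 0 p] h_diff[of 0 0] rel[OF inv] p by (simp add: F_simps)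
  next
    case (eng p q)
    then have "p \<in> carrier F" "q \<in> carrier F" using T_sub by (auto simp: T_def)
    then show ?case using h_add eng.IH by (simp add: F_simps(2))
  qed (rule rel)
  from this[OF zero] show ?thesis using frag rn by simp
qed

text \<open>Pure tensors with \<open>n\<^sub>0\<close> exhaust the module, and \<kappa>, which sends
  \<open>n\<^sub>0\<close> to \<open>\<phi> b\<^sub>0\<close>, induces the map to \<open>A\<close>
  that yields the annihilator condition. The module is thus the left ideal generated by
  \<open>\<phi> b\<^sub>0\<close>.\<close>

theorem idempotent_module_E:
  assumes n0: "n\<^sub>0 \<in> carrier N" and cyc: "\<And>n. n \<in> carrier N \<Longrightarrow> \<exists>b\<in>carrier B. n = b \<odot>\<^bsub>N\<^esub> n\<^sub>0"
    and b0: "b\<^sub>0 \<in> carrier B" "b\<^sub>0 \<odot>\<^bsub>N\<^esub> n\<^sub>0 = n\<^sub>0"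
    and k_closed: "\<And>n. n \<in> carrier N \<Longrightarrow> \<kappa> n \<in> carrier A"
    and k_add: "\<And>m n. m \<in> carrier N \<Longrightarrow> n \<in> carrier N \<Longrightarrow> \<kappa> (m \<oplus>\<^bsub>N\<^esub> n) = \<kappa> m \<oplus> \<kappa> n"
    and k_bal: "\<And>b n. b \<in> carrier B \<Longrightarrow> n \<in> carrier N \<Longrightarrow> \<phi> b \<otimes> \<kappa> n = \<kappa> (b \<odot>\<^bsub>N\<^esub> n)"
    and k_n0: "\<kappa> n\<^sub>0 = \<phi> b\<^sub>0"
  shows "idempotent_module A E (\<phi> b\<^sub>0) (cl (frag_of (\<one>, n\<^sub>0)))"
proof (intro idempotent_module.intro idempotent_module_axioms.intro left_module_E)
  have smult: "r \<odot>\<^bsub>E\<^esub> cl (frag_of (\<one>, n\<^sub>0)) = cl (frag_of (r, n\<^sub>0))" if "r \<in> carrier A" for r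
    using that by (simp add: E_smult ext_simps)
  show "\<phi> b\<^sub>0 \<in> carrier A" using b0 phi_closed by blast
  show "cl (frag_of (\<one>, n\<^sub>0)) \<in> carrier E"
    using n0 frag_of_F by (auto simp: E_simps)
  show "\<phi> b\<^sub>0 \<odot>\<^bsub>E\<^esub> cl (frag_of (\<one>, n\<^sub>0)) = cl (frag_of (\<one>, n\<^sub>0))"
    using relations(3)[of "\<one>" b\<^sub>0 n\<^sub>0] b0 n0 phi_closed by (simp add: smult cl_eq_iff)
  show "\<exists>r\<in>carrier A. x = r \<odot>\<^bsub>E\<^esub> cl (frag_of (\<one>, n\<^sub>0))" if "x \<in> carrier E" for x
    using that cyclic_generation[OF n0 cyc] smult by (fastforce simp: E_simps)
  fix r assume r: "r \<in> carrier A" "r \<odot>\<^bsub>E\<^esub> cl (frag_of (\<one>, n\<^sub>0)) = \<zero>\<^bsub>E\<^esub>"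
  then have "frag_of (r, n\<^sub>0) \<in> T"
    by (simp add: smult E_simps cl_eq_iff)
  from balanced_map_zero[OF k_closed k_add k_bal r(1) n0 this]
  show "r \<otimes> \<phi> b\<^sub>0 = \<zero>" by (simp add: k_n0)
qed

end

section \<open>Verma modules\<close>

lemma verma_idempotent_module: "\<exists>m. idempotent_module (algA a) (verma a (perm v)) (dA a v) m"
proof -
  interpret k_algebra "algA a" "scA a" by (rule k_alg)
  let ?N = "eval_module (perm v) :: ((nat \<Rightarrow> nat) \<Rightarrow> 'a, 'a) module"
  have incl: "fun_incl a f = cls a (free_fun f)" for f
    by (simp add: fun_incl_def cls_def)
  interpret X: scalar_extension "algA a" fun_ring "fun_incl a" ?N
    by (intro scalar_extension.intro scalar_extension_axioms.intro ring_algA)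
      (simp_all add: incl cls_closed free_fun_closed eval_module_def)
  define b0 where "b0 = (\<lambda>g\<in>carrier S3. if g = perm v then 1 else (0 :: 'a))"
  have "free_fun b0 = (\<Sum>w\<in>UNIV. if w = v then gen (Delta (perm w)) else 0)"
    unfolding free_fun_def sum_perm b0_def using perm_in_S3
    by (intro sum.cong) (auto simp: scal_simps)
  then have b0: "fun_incl a b0 = dA a v"
    by (simp add: incl dA_def finite_vertex)
  have "idempotent_module (algA a) X.E (fun_incl a b0) (X.cl (frag_of (\<one>\<^bsub>algA a\<^esub>, 1)))"
  \<comment> \<open>The one-dimensional module is embedded in the algebra as the line through its
    weight idempotent.\<close>
  proof (rule X.idempotent_module_E[where \<kappa> = "\<lambda>c. scA a c \<otimes>\<^bsub>algA a\<^esub> dA a v"])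
    show "\<exists>b\<in>carrier fun_ring. n = b \<odot>\<^bsub>?N\<^esub> 1" for n
      using perm_in_S3[of v]
      by (intro bexI[of _ "\<lambda>g\<in>carrier S3. n"]) (auto simp: eval_module_def fun_ring_def)
    show "fun_incl a b \<otimes>\<^bsub>algA a\<^esub> (scA a n \<otimes>\<^bsub>algA a\<^esub> dA a v) = scA a (b \<odot>\<^bsub>?N\<^esub> n) \<otimes>\<^bsub>algA a\<^esub> dA a v" for b n
      using sc_left_commute[of "cls a (free_fun b)" "dA a v" n]
      by (simp add: incl free_fun_dA cls_closed free_fun_closed xA_dA_closed eval_module_def sc_sc mult.commute)
  qed (use perm_in_S3[of v] in \<open>auto simp: b0 eval_module_def fun_ring_def b0_def[symmetric] xA_dA_closed
      sc_add sc_one l_distr\<close>, simp_all add: b0_def)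
  then show ?thesis unfolding b0 verma_def by blast
qed

text \<open>Each \<open>u' v\<close> is fixed on the left by the idempotent at e or at c. If both
  idempotents were zero on \<open>S\<close>, so would be every \<open>u' v\<close>, and hence the
  sum of the \<open>u v\<close> times \<open>u' v\<close>, which is one.\<close>

lemma simple_module_weight:
  assumes a: "generic a" and S: "simple_module (algA a) S"
  obtains x where "x \<in> carrier S" "dA a (Hub HE) \<odot>\<^bsub>S\<^esub> x \<noteq> \<zero>\<^bsub>S\<^esub>"
    | x where "x \<in> carrier S" "dA a (Hub HC) \<odot>\<^bsub>S\<^esub> x \<noteq> \<zero>\<^bsub>S\<^esub>"
proof -
  interpret D: double_arrows "algA a" "scA a" "diff_weight a" "dA a" "upA a" "dnA a"
    using a by (rule double_arrows_algA)
  interpret S: left_module "algA a" S using S by (simp add: simple_module_def)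
  have "\<exists>x\<in>carrier S. dA a (Hub HE) \<odot>\<^bsub>S\<^esub> x \<noteq> \<zero>\<^bsub>S\<^esub> \<or> dA a (Hub HC) \<odot>\<^bsub>S\<^esub> x \<noteq> \<zero>\<^bsub>S\<^esub>"
  proof (rule ccontr)
    assume none: "\<not> ?thesis"
    have kill: "dA a (Hub (D.src v)) \<odot>\<^bsub>S\<^esub> x = \<zero>\<^bsub>S\<^esub>" if "x \<in> carrier S" for v x
      using none that unfolding D.src_def by auto
    have u': "D.u' v \<odot>\<^bsub>S\<^esub> x = \<zero>\<^bsub>S\<^esub>" if x: "x \<in> carrier S" for v x
    proof -
      have "D.u' v \<odot>\<^bsub>S\<^esub> x = dA a (Hub (D.src v)) \<odot>\<^bsub>S\<^esub> (D.u' v \<odot>\<^bsub>S\<^esub> x)"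
        using S.smult_assoc[of "dA a (Hub (D.src v))" "D.u' v" x] x by (simp add: D.d_u')
      then show ?thesis using kill x by (simp add: S.smult_closed)
    qed
    have "x = \<zero>\<^bsub>S\<^esub>" if x: "x \<in> carrier S" for x
    proof -
      have "x = finsum (algA a) (\<lambda>v. D.u v \<otimes>\<^bsub>algA a\<^esub> D.u' v) UNIV \<odot>\<^bsub>S\<^esub> x"
        using x by (simp add: D.sum_u_u' S.smult_one)
      also have "\<dots> = finsum S (\<lambda>v. (D.u v \<otimes>\<^bsub>algA a\<^esub> D.u' v) \<odot>\<^bsub>S\<^esub> x) UNIV"
        using x by (intro S.finsum_smult finite_vertex) auto
      also have "(\<lambda>v. (D.u v \<otimes>\<^bsub>algA a\<^esub> D.u' v) \<odot>\<^bsub>S\<^esub> x) = (\<lambda>v. \<zero>\<^bsub>S\<^esub>)"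
        using x by (intro ext) (simp add: S.smult_assoc S.smult_zero_r u')
      finally show ?thesis by simp
    qed
    then show False using S S.M.zero_closed unfolding simple_module_def by blast
  qed
  with that show thesis by blast
qed

theorem theorem1:
  fixes a :: "(nat \<Rightarrow> nat) \<Rightarrow> 'k::{alg_closed_field, field_char_0}"
  assumes "a \<in> frakA3" and "generic a"
  shows "simple_module (algA a) k_e \<and>
    simple_module (algA a) (L_module a) \<and>
    \<not> mod_isomorphic (algA a) k_e (L_module a) \<and>
    (\<forall>S :: ('k alg_elem, 's) module. simple_module (algA a) S \<longrightarrow>
       mod_isomorphic (algA a) S k_e \<or> mod_isomorphic (algA a) S (L_module a)) \<and>
    is_projective_cover TYPE('m) TYPE('n) (algA a) (verma a \<one>\<^bsub>S3\<^esub>) k_e \<and>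
    is_injective_hull TYPE('m) TYPE('n) (algA a) (verma a \<one>\<^bsub>S3\<^esub>) k_e \<and>
    is_projective_cover TYPE('m) TYPE('n) (algA a) (verma a (t13 \<otimes>\<^bsub>S3\<^esub> t23)) (L_module a) \<and>
    is_injective_hull TYPE('m) TYPE('n) (algA a) (verma a (t13 \<otimes>\<^bsub>S3\<^esub> t23)) (L_module a)"
proof -
  interpret D: double_arrows "algA a" "scA a" "diff_weight a" "dA a" "upA a" "dnA a"
    using assms(2) by (rule double_arrows_algA)
  have "D.be T0 \<otimes>\<^bsub>algA a\<^esub> D.al T1 \<noteq> \<zero>\<^bsub>algA a\<^esub>" "D.al T0 \<otimes>\<^bsub>algA a\<^esub> D.be T1 \<noteq> \<zero>\<^bsub>algA a\<^esub>"
    using loop_nonzero[OF assms(2)] by (simp_all add: loopA_def D.al_def D.be_def)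
  from D.two_vertex_algebra[OF this] interpret E: two_vertex_algebra "algA a" "scA a"
    "dA a (Hub HE)" "dA a (Hub HC)" "D.al T0" "D.al T1" "D.be T0" "D.be T1" UNIV D.u D.u' "\<lambda>v. v = Hub HE" .
  \<comment> \<open>The mirror image of \<open>E\<close>, in which \<nu> is the loop at c.\<close>
  interpret C: two_vertex_algebra "algA a" "scA a"
    "dA a (Hub HC)" "dA a (Hub HE)" "D.be T0" "D.be T1" "D.al T0" "D.al T1" UNIV D.u D.u' "\<lambda>v. v \<noteq> Hub HE"
    by (rule E.swap)
  have weights: "verma a \<one>\<^bsub>S3\<^esub> = verma a (perm (Hub HE))"
    "verma a (t13 \<otimes>\<^bsub>S3\<^esub> t23) = verma a (perm (Hub HC))"
    by (simp_all add: S3_simps)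
  obtain m where m: "idempotent_module (algA a) (verma a (perm (Hub HE))) (dA a (Hub HE)) m"
    using verma_idempotent_module by blast
  obtain m' where m': "idempotent_module (algA a) (verma a (perm (Hub HC))) (dA a (Hub HC)) m'"
    using verma_idempotent_module by blast
  have z: "E.nu \<odot>\<^bsub>k_e\<^esub> unit_vec \<one>\<^bsub>S3\<^esub> = \<zero>\<^bsub>k_e\<^esub>"
    using k_e_generator(4)[of a] unfolding E.nu_def unfolding loopA_def D.al_def D.be_def .
  have n: "C.nu \<odot>\<^bsub>L_module a\<^esub> unit_vec (perm (Hub HC)) = \<zero>\<^bsub>L_module a\<^esub>"
    using L_generator(4)[of a] unfolding C.nu_def unfolding loopA_def D.al_def D.be_def .
  interpret PE: frobenius_module_top "algA a" "scA a" "verma a (perm (Hub HE))" "dA a (Hub HE)" m E.nu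
    "UNIV \<times> UNIV" E.coeff_basis E.dual_basis k_e "unit_vec \<one>\<^bsub>S3\<^esub>"
    by (intro frobenius_module_top.intro frobenius_module_top_axioms.intro E.frobenius[OF m] simple_k_e
        k_e_generator(1-3) z)
  interpret PC: frobenius_module_top "algA a" "scA a" "verma a (perm (Hub HC))" "dA a (Hub HC)" m' C.nu
    "UNIV \<times> UNIV" C.coeff_basis C.dual_basis "L_module a" "unit_vec (perm (Hub HC))"
    by (intro frobenius_module_top.intro frobenius_module_top_axioms.intro C.frobenius[OF m']
        simple_L[OF assms(2)] L_generator(1-3) n)
  \<comment> \<open>A simple module has a nonzero vector of weight e or c, and either one identifies
    it with the corresponding top.\<close>
  have "mod_isomorphic (algA a) S k_e \<or> mod_isomorphic (algA a) S (L_module a)"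
    if S: "simple_module (algA a) S" for S :: "('k alg_elem, 's) module"
    using simple_module_weight[OF assms(2) S]
  proof cases
    case (1 x)
    then show ?thesis using PE.simple_isomorphic_top[OF S] by (simp add: dA_dA)
  next
    case (2 x)
    then show ?thesis using PC.simple_isomorphic_top[OF S] by (simp add: dA_dA)
  qed
  then show ?thesis
    unfolding weights
    using simple_k_e simple_L[OF assms(2)] k_e_not_isomorphic_L PE.projective_cover PE.injective_hull
      PC.projective_cover PC.injective_hull by blast
qed

end
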